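(* Let $(M,g_M,J)$ be a Kähler manifold, $(N,g_N)$ a Riemannian manifold, and $F:(M,g_M,J)\to(N,g_N)$ a semi-slant Riemannian map, with $\ker F_*=\mathcal{D}_1\oplus\mathcal{D}_2$, such that the distribution $\mathcal{D}_1$ is integrable. Then $F$ is harmonic if and only if $\mathrm{trace}(\nabla F_* )=0$ on $\mathcal{D}_2$ and $\widetilde{H}=0$, where $\widetilde{H}$ denotes the mean curvature vector field of $\mathrm{range}\,F_*$.
   Context: A $C^\infty$-map $F:(M,g_M)\to(N,g_N)$ between Riemannian manifolds is a Riemannian map if for each $p\in M$ the map $(F_* )_p:(\ker (F_* )_p)^{\perp}\to (F_* )_p((\ker (F_* )_p)^{\perp})\subset T_{F(p)}N$ is a linear isometry with respect to $g_M$ and $g_N$. If $(M,g_M,J)$ is almost Hermitian, a Riemannian map $F$ is a semi-slant Riemannian map if there is a distribution $\mathcal{D}_1\subset\ker F_*$ such that $\ker F_*=\mathcal{D}_1\oplus\mathcal{D}_2$, $J(\mathcal{D}_1)=\mathcal{D}_1$, where $\mathcal{D}_2$ is the orthogonal complement of $\mathcal{D}_1$ in $\ker F_*$, and the angle $\theta=\theta(X)$ between $JX$ and the space $(\mathcal{D}_2)_p$ (so $\cos\theta$ is the norm of the orthogonal projection of $JX$ to $(\mathcal{D}_2)_p$ divided by $|JX|$) is constant for all nonzero $X\in(\mathcal{D}_2)_p$ and $p\in M$; $\theta$ is called the semi-slant angle. The second fundamental form of $F$ is $(\nabla F_* )(X,Y)=\nabla^F_X F_*Y-F_*(\nabla_XY)$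 for $X,Y\in\Gamma(TM)$, with $\nabla^F$ the pullback connection on $F^{-1}TN$ and $\nabla$ the Levi-Civita connection of $g_M$. $F$ is harmonic if $\tau(F)=\mathrm{trace}(\nabla F_* )=0$. For a subbundle $E\subset TM$, the trace of $\nabla F_*$ on $E$ is $\sum_i(\nabla F_* )(e_i,e_i)$ over a local orthonormal frame $\{e_i\}$ of $E$. $\mathrm{range}\,F_*$ is regarded as a subbundle of $F^{-1}TN$, and $F^{-1}TN=\mathrm{range}\,F_*\oplus(\mathrm{range}\,F_* )^{\perp}$ with corresponding projections $\bar P,\bar Q$. With $l=\dim(\ker F_* )^{\perp}$ and $\{Z_1,\dots,Z_l\}$ a local orthonormal frame of $(\ker F_* )^{\perp}$, the mean curvature vector field of $\mathrm{range}\,F_*$ is $\widetilde H=\frac1l\sum_{i=1}^l\bar Q(\nabla^F_{Z_i}F_*Z_i)$ (and $\widetilde H=0$ if $l=0$). *)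

theory Defs
  imports "HOL-Analysis.Analysis"
begin

section \<open>Smooth maps between Euclidean spaces\<close>

text \<open>Both notions are meant for open \<open>S\<close> only.\<close>

fun Ck_on :: "nat \<Rightarrow> 'x::euclidean_space set \<Rightarrow> ('x \<Rightarrow> 'y::real_normed_vector) \<Rightarrow> bool" where
  "Ck_on 0 S f \<longleftrightarrow> continuous_on S f"
| "Ck_on (Suc k) S f \<longleftrightarrow>
     f differentiable_on S \<and> (\<forall>v. Ck_on k S (\<lambda>x. frechet_derivative f (at x) v))"

definition smooth_on :: "'x::euclidean_space set \<Rightarrow> ('x \<Rightarrow> 'y::real_normed_vector) \<Rightarrow> bool" where
  "smooth_on S f \<longleftrightarrow> (\<forall>k. Ck_on k S f)"


section \<open>Manifolds\<close>

text \<open>The points of a manifold form a whole type \<open>'a\<close>, whose topology is the manifold topology.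
  A chart is an open set \<open>U\<close> together with a coordinate map on it into the model space
  \<open>'m\<close>; values of the coordinate map outside \<open>U\<close> are irrelevant. The field \<open>met\<close> carries the
  Riemannian metric.

  The tangent space at \<open>p\<close> is a copy of the model space: a tangent vector at \<open>p\<close> is recorded
  by its components in one fixed chart \<open>chart_at M p\<close> around \<open>p\<close>. Thus vector fields are
  functions \<open>'a \<Rightarrow> 'm\<close>, and the component function in a fixed chart \<open>c\<close> is
  obtained by applying, at each point \<open>q\<close>, the change of coordinates from \<open>chart_at M q\<close>
  to \<open>c\<close>.\<close>

type_synonym ('a, 'm) chart = "'a set \<times> ('a \<Rightarrow> 'm)"

record ('a, 'm) mfd =
  charts :: "('a, 'm) chart set"
  met :: "'a \<Rightarrow> 'm \<Rightarrow> 'm \<Rightarrow> real"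

abbreviation cdom :: "('a, 'm) chart \<Rightarrow> 'a set" where
  "cdom c \<equiv> fst c"

abbreviation cmap :: "('a, 'm) chart \<Rightarrow> 'a \<Rightarrow> 'm" where
  "cmap c \<equiv> snd c"

abbreviation cinv :: "('a, 'm) chart \<Rightarrow> 'm \<Rightarrow> 'a" where
  "cinv c \<equiv> inv_into (fst c) (snd c)"

definition smooth_manifold ::
    "('a::{t2_space, second_countable_topology}, 'm::euclidean_space) mfd \<Rightarrow> bool" where
  "smooth_manifold M \<longleftrightarrow>
     (\<Union>c\<in>charts M. cdom c) = UNIV \<and>
     (\<forall>c\<in>charts M. open (cdom c) \<and> open (cmap c ` cdom c) \<and>
        homeomorphism (cdom c) (cmap c ` cdom c) (cmap c) (cinv c)) \<and>
     (\<forall>c\<in>charts M. \<forall>d\<in>charts M.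
        smooth_on (cmap c ` (cdom c \<inter> cdom d)) (cmap d \<circ> cinv c))"

definition chart_at ::
    "('a::{t2_space, second_countable_topology}, 'm::euclidean_space) mfd \<Rightarrow> 'a \<Rightarrow> ('a, 'm) chart" where
  "chart_at M p = (SOME c. c \<in> charts M \<and> p \<in> cdom c)"

text \<open>\<open>to_chart M c p v\<close>: the components in the chart \<open>c\<close> of the tangent vector \<open>v\<close>
  at \<open>p\<close>. \<open>of_chart M c p w\<close>: the tangent vector at \<open>p\<close> whose components in \<open>c\<close>
  are \<open>w\<close>, that is, the value at \<open>p\<close> of the coordinate vector field in direction \<open>w\<close>.\<close>

definition to_chart ::
    "('a::{t2_space, second_countable_topology}, 'm::euclidean_space) mfd \<Rightarrow> ('a, 'm) chart \<Rightarrow> 'a \<Rightarrow> 'm \<Rightarrow> 'm" where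
  "to_chart M c p v =
     frechet_derivative (cmap c \<circ> cinv (chart_at M p)) (at (cmap (chart_at M p) p)) v"

definition of_chart ::
    "('a::{t2_space, second_countable_topology}, 'm::euclidean_space) mfd \<Rightarrow> ('a, 'm) chart \<Rightarrow> 'a \<Rightarrow> 'm \<Rightarrow> 'm" where
  "of_chart M c p w =
     frechet_derivative (cmap (chart_at M p) \<circ> cinv c) (at (cmap c p)) w"

definition smooth_field_on ::
    "('a::{t2_space, second_countable_topology}, 'm::euclidean_space) mfd \<Rightarrow> 'a set \<Rightarrow> ('a \<Rightarrow> 'm) \<Rightarrow> bool" where
  "smooth_field_on M U X \<longleftrightarrow>
     (\<forall>c\<in>charts M. smooth_on (cmap c ` (cdom c \<inter> U)) (\<lambda>x. to_chart M c (cinv c x) (X (cinv c x))))"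

text \<open>Local representative of a field in the chart \<open>c\<close>, and coefficients of the metric in \<open>c\<close>
  at the coordinate point \<open>x\<close>.\<close>

definition field_in_chart ::
    "('a::{t2_space, second_countable_topology}, 'm::euclidean_space) mfd \<Rightarrow> ('a, 'm) chart \<Rightarrow> ('a \<Rightarrow> 'm) \<Rightarrow> 'm \<Rightarrow> 'm" where
  "field_in_chart M c X x = to_chart M c (cinv c x) (X (cinv c x))"

definition met_in_chart ::
    "('a::{t2_space, second_countable_topology}, 'm::euclidean_space) mfd \<Rightarrow> ('a, 'm) chart \<Rightarrow> 'm \<Rightarrow> 'm \<Rightarrow> 'm \<Rightarrow> real" where
  "met_in_chart M c x v w =
     met M (cinv c x) (of_chart M c (cinv c x) v) (of_chart M c (cinv c x) w)"

definition riemannian_manifold ::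
    "('a::{t2_space, second_countable_topology}, 'm::euclidean_space) mfd \<Rightarrow> bool" where
  "riemannian_manifold M \<longleftrightarrow>
     smooth_manifold M \<and>
     (\<forall>p. bilinear (met M p) \<and> (\<forall>v w. met M p v w = met M p w v) \<and> (\<forall>v. v \<noteq> 0 \<longrightarrow> met M p v v > 0)) \<and>
     (\<forall>c\<in>charts M. \<forall>v w. smooth_on (cmap c ` cdom c) (\<lambda>x. met_in_chart M c x v w))"


section \<open>Linear algebra in the tangent spaces\<close>

definition gnorm ::
    "('a::{t2_space, second_countable_topology}, 'm::euclidean_space) mfd \<Rightarrow> 'a \<Rightarrow> 'm \<Rightarrow> real" where
  "gnorm M p v = sqrt (met M p v v)"

definition orth_compl ::
    "('a::{t2_space, second_countable_topology}, 'm::euclidean_space) mfd \<Rightarrow> 'a \<Rightarrow> 'm set \<Rightarrow> 'm set" where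
  "orth_compl M p S = {v. \<forall>w\<in>S. met M p v w = 0}"

definition orth_proj ::
    "('a::{t2_space, second_countable_topology}, 'm::euclidean_space) mfd \<Rightarrow> 'a \<Rightarrow> 'm set \<Rightarrow> 'm \<Rightarrow> 'm" where
  "orth_proj M p S v = (THE w. w \<in> S \<and> v - w \<in> orth_compl M p S)"

definition angle_to_subspace ::
    "('a::{t2_space, second_countable_topology}, 'm::euclidean_space) mfd \<Rightarrow> 'a \<Rightarrow> 'm \<Rightarrow> 'm set \<Rightarrow> real" where
  "angle_to_subspace M p v S = arccos (gnorm M p (orth_proj M p S v) / gnorm M p v)"


section \<open>The Levi-Civita connection\<close>

text \<open>In a chart, a connection is given by a form \<open>G\<close> with
  \<open>\<nabla>\<^sub>u Y = D Y (u) + G u Y\<close>. It is torsion free iff \<open>G\<close> is symmetric, and metric iff the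
  derivative of the metric coefficients is as below. The lemma \<open>ex1_levi_civita_form\<close>
  shows that exactly one such form exists.\<close>

definition is_levi_civita_form ::
    "('a::{t2_space, second_countable_topology}, 'm::euclidean_space) mfd \<Rightarrow> ('a, 'm) chart \<Rightarrow> 'm \<Rightarrow>
      ('m \<Rightarrow> 'm \<Rightarrow> 'm) \<Rightarrow> bool" where
  "is_levi_civita_form M c x G \<longleftrightarrow>
     bilinear G \<and> (\<forall>u v. G u v = G v u) \<and>
     (\<forall>u v w. frechet_derivative (\<lambda>y. met_in_chart M c y v w) (at x) u =
        met_in_chart M c x (G u v) w + met_in_chart M c x v (G u w))"

definition levi_civita_form ::
    "('a::{t2_space, second_countable_topology}, 'm::euclidean_space) mfd \<Rightarrow> ('a, 'm) chart \<Rightarrow> 'm \<Rightarrow>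
      'm \<Rightarrow> 'm \<Rightarrow> 'm" where
  "levi_civita_form M c x = (THE G. is_levi_civita_form M c x G)"

lemma posdef_representation:
  fixes h :: "'m::euclidean_space \<Rightarrow> 'm \<Rightarrow> real"
  assumes h: "bilinear h" and pos: "\<And>v. v \<noteq> 0 \<Longrightarrow> h v v > 0" and f: "linear f"
  shows "\<exists>w. \<forall>z. h w z = f z"
proof -
  let ?L = "\<lambda>w. \<Sum>b\<in>Basis. h w b *\<^sub>R b"
  have lin: "linear ?L"
    using h by (intro linearI)
      (simp_all add: bilinear_ladd bilinear_lmul scaleR_add_left sum.distrib scaleR_sum_right)
  have comp: "?L w \<bullet> b = h w b" if "b \<in> Basis" for w b
    using that by simp
  have ext: "g z = (\<Sum>b\<in>Basis. (z \<bullet> b) * g b)" if "linear g" for g :: "'m \<Rightarrow> real" and z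
  proof -
    have "g z = g (\<Sum>b\<in>Basis. (z \<bullet> b) *\<^sub>R b)"
      by (simp add: euclidean_representation)
    also have "\<dots> = (\<Sum>b\<in>Basis. (z \<bullet> b) * g b)"
      by (simp add: linear_sum[OF that] linear_scale[OF that])
    finally show ?thesis .
  qed
  have hl: "linear (h w)" for w
    using h by (simp add: bilinear_def)
  have "inj ?L"
  proof (subst linear_injective_0[OF lin], intro allI impI)
    fix w assume "?L w = 0"
    then have "h w b = 0" if "b \<in> Basis" for b
      using comp[OF that, of w] by simp
    then have "h w w = 0"
      using ext[OF hl, of w w] by simp
    then show "w = 0" using pos[of w] by force
  qed
  then have "surj ?L"
    using lin linear_injective_imp_surjective by blast
  from surjD[OF this, of "\<Sum>b\<in>Basis. f b *\<^sub>R b"]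
  obtain w where w: "?L w = (\<Sum>b\<in>Basis. f b *\<^sub>R b)"
    by (auto simp only:)
  have "h w b = f b" if "b \<in> Basis" for b
    using comp[OF that, of w] that unfolding w by simp
  then have "h w z = f z" for z
    using ext[OF hl, of w z] ext[OF f, of z] by simp
  then show ?thesis by blast
qed

lemma koszul_ex1:
  fixes h :: "'m::euclidean_space \<Rightarrow> 'm \<Rightarrow> real" and D :: "'m \<Rightarrow> 'm \<Rightarrow> 'm \<Rightarrow> real"
  assumes h: "bilinear h" and sym: "\<And>v w. h v w = h w v" and pos: "\<And>v. v \<noteq> 0 \<Longrightarrow> h v v > 0"
    and D1: "\<And>v w. linear (\<lambda>u. D u v w)" and D2: "\<And>u w. linear (\<lambda>v. D u v w)"
    and Dsym: "\<And>u v w. D u v w = D u w v"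
  shows "\<exists>!G. bilinear G \<and> (\<forall>u v. G u v = G v u) \<and> (\<forall>u v w. D u v w = h (G u v) w + h v (G u w))"
proof -
  have D3: "linear (\<lambda>w. D u v w)" for u v
    using D2[of u v] by (subst Dsym)
  have eqI: "a = b" if "\<And>w. h a w = h b w" for a b
  proof (rule ccontr)
    assume "a \<noteq> b"
    then have "h (a - b) (a - b) > 0" by (simp add: pos)
    moreover have "h (a - b) (a - b) = 0"
      using that[of "a - b"] h by (simp add: bilinear_lsub)
    ultimately show False by simp
  qed
  let ?K = "\<lambda>u v w. (D u v w + D v u w - D w u v) / 2"
  have K: "h (G u v) w = ?K u v w"
    if "\<forall>u v. G u v = G v u" "\<forall>u v w. D u v w = h (G u v) w + h v (G u w)" for G u v w
    using that by (simp add: sym)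
  have "\<exists>g. \<forall>z. h g z = ?K u v z" for u v
  proof (rule posdef_representation[OF h pos])
    show "linear (?K u v)"
      by (intro linearI) (simp_all add: linear_add[OF D1] linear_add[OF D3] linear_scale[OF D1]
         linear_scale[OF D3] algebra_simps add_divide_distrib diff_divide_distrib)
  qed
  then obtain G where G: "\<And>u v z. h (G u v) z = ?K u v z"
    by metis
  show ?thesis
  proof (rule ex1I[of _ G], intro conjI allI)
    show "G u v = G v u" for u v
      by (rule eqI) (simp add: G Dsym)
    show "D u v w = h (G u v) w + h v (G u w)" for u v w
      unfolding sym[of v] G using Dsym[of u v w] Dsym[of v u w] Dsym[of w u v]
      by (simp add: field_simps)
    show "bilinear G"
      unfolding bilinear_def
      by (intro conjI allI linearI; rule eqI)
        (simp_all add: G bilinear_ladd[OF h] bilinear_lmul[OF h] linear_add[OF D1] linear_add[OF D2]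
           linear_add[OF D3] linear_scale[OF D1] linear_scale[OF D2] linear_scale[OF D3]
           algebra_simps add_divide_distrib diff_divide_distrib)
  next
    fix G' assume "bilinear G' \<and> (\<forall>u v. G' u v = G' v u) \<and>
      (\<forall>u v w. D u v w = h (G' u v) w + h v (G' u w))"
    then have "h (G' u v) w = ?K u v w" for u v w
      using K[of G'] by meson
    then show "G' = G"
      by (intro ext eqI) (simp only: G)
  qed
qed

lemma chart_at_mem:
  assumes "smooth_manifold M"
  shows "chart_at M p \<in> charts M" "p \<in> cdom (chart_at M p)"
proof -
  have "\<exists>c. c \<in> charts M \<and> p \<in> cdom c"
    using assms unfolding smooth_manifold_def by blast
  from someI_ex[OF this] show "chart_at M p \<in> charts M" "p \<in> cdom (chart_at M p)"
    unfolding chart_at_def by auto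
qed

lemma chart_props:
  assumes "smooth_manifold M" "c \<in> charts M"
  shows "open (cdom c)" "open (cmap c ` cdom c)"
    "homeomorphism (cdom c) (cmap c ` cdom c) (cmap c) (cinv c)"
  using assms unfolding smooth_manifold_def by auto

lemma open_chart_image:
  assumes "smooth_manifold M" "c \<in> charts M" "open U"
  shows "open (cmap c ` (cdom c \<inter> U))"
proof -
  have "openin (top_of_set (cmap c ` cdom c)) (cmap c ` (cdom c \<inter> U))"
    using chart_props[OF assms(1,2)] assms(3)
    by (intro homeomorphism_imp_open_map[of "cdom c" _ _ "cinv c"]) (auto simp: openin_open)
  then show ?thesis
    using chart_props(2)[OF assms(1,2)] openin_open_trans by blast
qed

lemma cinv_cmap:
  assumes "smooth_manifold M" "c \<in> charts M" "p \<in> cdom c"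
  shows "cinv c (cmap c p) = p"
  using chart_props(3)[OF assms(1,2)] assms(3) by (simp add: homeomorphism_def)

lemma smooth_on_differentiable_at:
  assumes "smooth_on S f" "open S" "x \<in> S"
  shows "f differentiable (at x)"
proof -
  have "Ck_on (Suc 0) S f" using assms(1) unfolding smooth_on_def by blast
  then show ?thesis
    using assms(2,3) by (simp add: differentiable_on_eq_differentiable_at)
qed

lemma transition_differentiable:
  assumes "smooth_manifold M" "c \<in> charts M" "d \<in> charts M" "p \<in> cdom c" "p \<in> cdom d"
  shows "(cmap d \<circ> cinv c) differentiable (at (cmap c p))"
proof (rule smooth_on_differentiable_at)
  show "smooth_on (cmap c ` (cdom c \<inter> cdom d)) (cmap d \<circ> cinv c)"
    using assms unfolding smooth_manifold_def by blast
  show "open (cmap c ` (cdom c \<inter> cdom d))"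
    using assms chart_props open_chart_image by blast
  show "cmap c p \<in> cmap c ` (cdom c \<inter> cdom d)" using assms by blast
qed

lemma linear_of_chart:
  assumes "smooth_manifold M" "c \<in> charts M" "p \<in> cdom c"
  shows "linear (of_chart M c p)"
proof -
  have "(cmap (chart_at M p) \<circ> cinv c) differentiable (at (cmap c p))"
    using assms chart_at_mem transition_differentiable by blast
  then show ?thesis
    unfolding of_chart_def by (simp add: linear_frechet_derivative)
qed

lemma to_chart_of_chart:
  assumes M: "smooth_manifold M" and c: "c \<in> charts M" and p: "p \<in> cdom c"
  shows "to_chart M c p (of_chart M c p w) = w"
proof -
  define d where "d = chart_at M p"
  have d: "d \<in> charts M" "p \<in> cdom d" using chart_at_mem[OF M] by (simp_all add: d_def)
  let ?f = "cmap d \<circ> cinv c" and ?g = "cmap c \<circ> cinv d"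
  have fx: "?f (cmap c p) = cmap d p" by (simp add: cinv_cmap[OF M c p])
  have "?f differentiable (at (cmap c p))" "?g differentiable (at (?f (cmap c p)))"
    using transition_differentiable[OF M] c p d fx by simp_all
  then have "((?g \<circ> ?f) has_derivative
      (frechet_derivative ?g (at (cmap d p)) \<circ> frechet_derivative ?f (at (cmap c p)))) (at (cmap c p))"
    using fx by (metis diff_chain_at frechet_derivative_works)
  moreover have "((?g \<circ> ?f) has_derivative id) (at (cmap c p))"
  proof (rule has_derivative_transform_within_open[OF has_derivative_id])
    show "open (cmap c ` (cdom c \<inter> cdom d))"
      using open_chart_image[OF M c] chart_props(1)[OF M d(1)] .
    show "cmap c p \<in> cmap c ` (cdom c \<inter> cdom d)" using p d by blast
  qed (auto simp: cinv_cmap[OF M c] cinv_cmap[OF M d(1)])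
  ultimately have "frechet_derivative ?g (at (cmap d p)) \<circ> frechet_derivative ?f (at (cmap c p)) = id"
    by (rule has_derivative_unique)
  then show ?thesis
    unfolding to_chart_def of_chart_def d_def[symmetric] by (metis comp_apply id_apply)
qed

lemma ex1_levi_civita_form:
  assumes R: "riemannian_manifold M" and c: "c \<in> charts M" and x: "x \<in> cmap c ` cdom c"
  shows "\<exists>!G. is_levi_civita_form M c x G"
proof -
  have M: "smooth_manifold M" using R by (simp add: riemannian_manifold_def)
  let ?S = "cmap c ` cdom c" and ?h = "met_in_chart M c"
  have op: "open ?S" using chart_props[OF M c] by blast
  have met: "bilinear (met M p)" "met M p v w = met M p w v" "v \<noteq> 0 \<Longrightarrow> met M p v v > 0" for p v w
    using R by (auto simp: riemannian_manifold_def)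
  have dom: "cinv c y \<in> cdom c" if "y \<in> ?S" for y
    using that by (simp add: inv_into_into)
  note lin = linear_of_chart[OF M c dom]
  have sym: "?h y v w = ?h y w v" for y v w
    by (simp add: met_in_chart_def met(2))
  have add: "?h y (v + v') w = ?h y v w + ?h y v' w" and scale: "?h y (r *\<^sub>R v) w = r * ?h y v w"
    if "y \<in> ?S" for y v v' w r
    by (simp_all add: met_in_chart_def linear_add[OF lin[OF that]] linear_scale[OF lin[OF that]]
        bilinear_ladd[OF met(1)] bilinear_lmul[OF met(1)])
  have "?h x w (v + v') = ?h x w v + ?h x w v'" "?h x w (r *\<^sub>R v) = r * ?h x w v" for v v' w r
    using add[OF x] scale[OF x] sym by metis+
  then have h: "bilinear (?h x)"
    unfolding bilinear_def by (intro conjI allI linearI) (simp_all add: add[OF x] scale[OF x])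
  have pos: "?h x v v > 0" if "v \<noteq> 0" for v
  proof -
    have "of_chart M c (cinv c x) v \<noteq> 0"
    proof
      assume 0: "of_chart M c (cinv c x) v = 0"
      then have "of_chart M c (cinv c x) v = of_chart M c (cinv c x) 0"
        using linear_0[OF lin[OF x]] by simp
      then have "v = 0" using to_chart_of_chart[OF M c dom[OF x]] by metis
      with that show False by simp
    qed
    then show ?thesis by (simp add: met_in_chart_def met(3))
  qed
  have diff: "(\<lambda>y. ?h y v w) differentiable (at x)" for v w
    using R c op x smooth_on_differentiable_at unfolding riemannian_manifold_def by blast
  let ?D = "\<lambda>u v w. frechet_derivative (\<lambda>y. ?h y v w) (at x) u"
  have D: "((\<lambda>y. ?h y v w) has_derivative (\<lambda>u. ?D u v w)) (at x)" for v w
    using diff frechet_derivative_works by blast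
  have D1: "linear (\<lambda>u. ?D u v w)" for v w
    using D has_derivative_linear by blast
  have D2: "linear (\<lambda>v. ?D u v w)" for u w
  proof (rule linearI)
    fix v v' :: 'b and r :: real
    have "((\<lambda>y. ?h y (v + v') w) has_derivative (\<lambda>u. ?D u v w + ?D u v' w)) (at x)"
      by (rule has_derivative_transform_within_open[OF has_derivative_add[OF D D] op x])
        (simp add: add)
    from has_derivative_unique[OF D this]
    show "?D u (v + v') w = ?D u v w + ?D u v' w" by metis
    have "((\<lambda>y. ?h y (r *\<^sub>R v) w) has_derivative (\<lambda>u. r *\<^sub>R ?D u v w)) (at x)"
      by (rule has_derivative_transform_within_open[OF has_derivative_scaleR_right[OF D] op x])
        (simp add: scale)
    from has_derivative_unique[OF D this]
    show "?D u (r *\<^sub>R v) w = r *\<^sub>R ?D u v w" by metis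
  qed
  have Dsym: "?D u v w = ?D u w v" for u v w
    using sym by metis
  show ?thesis
    unfolding is_levi_civita_form_def
    using koszul_ex1[of "?h x" ?D, OF h sym pos D1 D2 Dsym] .
qed

text \<open>\<open>cov_deriv M p u Y\<close> is \<open>\<nabla>\<^sub>u Y\<close> at \<open>p\<close> for a tangent vector \<open>u\<close> at \<open>p\<close>, computed
  in the chart \<open>chart_at M p\<close>, in which \<open>u\<close> and the result are their own components. Since
  torsion freeness and metricity do not depend on the chart, neither does the value.\<close>

definition cov_deriv ::
    "('a::{t2_space, second_countable_topology}, 'm::euclidean_space) mfd \<Rightarrow> 'a \<Rightarrow> 'm \<Rightarrow> ('a \<Rightarrow> 'm) \<Rightarrow> 'm" where
  "cov_deriv M p u Y =
     (let c = chart_at M p; x = cmap c p in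
       frechet_derivative (field_in_chart M c Y) (at x) u + levi_civita_form M c x u (Y p))"


section \<open>Almost Hermitian and Kaehler manifolds\<close>

definition almost_hermitian ::
    "('a::{t2_space, second_countable_topology}, 'm::euclidean_space) mfd \<Rightarrow> ('a \<Rightarrow> 'm \<Rightarrow> 'm) \<Rightarrow> bool" where
  "almost_hermitian M J \<longleftrightarrow>
     riemannian_manifold M \<and>
     (\<forall>p. linear (J p) \<and> (\<forall>v. J p (J p v) = - v) \<and> (\<forall>v w. met M p (J p v) (J p w) = met M p v w)) \<and>
     (\<forall>c\<in>charts M. \<forall>v. smooth_on (cmap c ` cdom c)
        (field_in_chart M c (\<lambda>q. J q (of_chart M c q v))))"

text \<open>\<open>\<nabla>J = 0\<close>, tested on local smooth vector fields.\<close>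

definition kaehler_manifold ::
    "('a::{t2_space, second_countable_topology}, 'm::euclidean_space) mfd \<Rightarrow> ('a \<Rightarrow> 'm \<Rightarrow> 'm) \<Rightarrow> bool" where
  "kaehler_manifold M J \<longleftrightarrow>
     almost_hermitian M J \<and>
     (\<forall>U Y p u. open U \<and> p \<in> U \<and> smooth_field_on M U Y \<longrightarrow>
        cov_deriv M p u (\<lambda>q. J q (Y q)) = J p (cov_deriv M p u Y))"


section \<open>Distributions and local frames\<close>

definition local_frame ::
    "('a::{t2_space, second_countable_topology}, 'm::euclidean_space) mfd \<Rightarrow> ('a \<Rightarrow> 'm set) \<Rightarrow> 'a set \<Rightarrow>
      nat \<Rightarrow> (nat \<Rightarrow> 'a \<Rightarrow> 'm) \<Rightarrow> bool" where
  "local_frame M E U k e \<longleftrightarrow>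
     (\<forall>i<k. smooth_field_on M U (e i)) \<and>
     (\<forall>q\<in>U. span ((\<lambda>i. e i q) ` {..<k}) = E q \<and> dim (E q) = k)"

definition distribution ::
    "('a::{t2_space, second_countable_topology}, 'm::euclidean_space) mfd \<Rightarrow> ('a \<Rightarrow> 'm set) \<Rightarrow> bool" where
  "distribution M E \<longleftrightarrow> (\<forall>p. \<exists>U k e. open U \<and> p \<in> U \<and> local_frame M E U k e)"

definition orthonormal_frame_near ::
    "('a::{t2_space, second_countable_topology}, 'm::euclidean_space) mfd \<Rightarrow> ('a \<Rightarrow> 'm set) \<Rightarrow> 'a \<Rightarrow>
      (nat \<Rightarrow> 'a \<Rightarrow> 'm) \<Rightarrow> bool" where
  "orthonormal_frame_near M E p e \<longleftrightarrow>
     (\<exists>U. open U \<and> p \<in> U \<and> local_frame M E U (dim (E p)) e \<and>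
       (\<forall>q\<in>U. \<forall>i<dim (E p). \<forall>j<dim (E p). met M q (e i q) (e j q) = (if i = j then 1 else 0)))"

text \<open>A distribution is integrable if an integral manifold passes through every point. The
  integral manifold through \<open>p\<close> is given by a local parametrization: an injective immersion
  \<open>\<psi>\<close> of the relatively open subset \<open>W \<inter> V\<close> of a linear subspace \<open>V\<close> of the model space.
  (A smooth map on \<open>W \<inter> V\<close> extends to an open subset of the model space, by composition with a
  linear projection onto \<open>V\<close>.)\<close>

definition smooth_param ::
    "('a::{t2_space, second_countable_topology}, 'm::euclidean_space) mfd \<Rightarrow> 'm set \<Rightarrow> ('m \<Rightarrow> 'a) \<Rightarrow> bool" where
  "smooth_param M W \<psi> \<longleftrightarrow>
     continuous_on W \<psi> \<and> (\<forall>c\<in>charts M. smooth_on (W \<inter> \<psi> -` cdom c) (cmap c \<circ> \<psi>))"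

definition param_differential ::
    "('a::{t2_space, second_countable_topology}, 'm::euclidean_space) mfd \<Rightarrow> ('m \<Rightarrow> 'a) \<Rightarrow> 'm \<Rightarrow> 'm \<Rightarrow> 'm" where
  "param_differential M \<psi> x v = frechet_derivative (cmap (chart_at M (\<psi> x)) \<circ> \<psi>) (at x) v"

definition integrable_distribution ::
    "('a::{t2_space, second_countable_topology}, 'm::euclidean_space) mfd \<Rightarrow> ('a \<Rightarrow> 'm set) \<Rightarrow> bool" where
  "integrable_distribution M E \<longleftrightarrow>
     (\<forall>p. \<exists>W V \<psi>. open W \<and> subspace V \<and> smooth_param M W \<psi> \<and> inj_on \<psi> (W \<inter> V) \<and> p \<in> \<psi> ` (W \<inter> V) \<and>
       (\<forall>x\<in>W \<inter> V. inj_on (param_differential M \<psi> x) V \<and> param_differential M \<psi> x ` V = E (\<psi> x)))"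


section \<open>Maps between manifolds\<close>

definition smooth_map ::
    "('a::{t2_space, second_countable_topology}, 'm::euclidean_space) mfd \<Rightarrow>
     ('b::{t2_space, second_countable_topology}, 'n::euclidean_space) mfd \<Rightarrow> ('a \<Rightarrow> 'b) \<Rightarrow> bool" where
  "smooth_map M N F \<longleftrightarrow>
     continuous_on UNIV F \<and>
     (\<forall>c\<in>charts M. \<forall>d\<in>charts N.
        smooth_on (cmap c ` (cdom c \<inter> F -` cdom d)) (cmap d \<circ> F \<circ> cinv c))"

definition differential ::
    "('a::{t2_space, second_countable_topology}, 'm::euclidean_space) mfd \<Rightarrow>
     ('b::{t2_space, second_countable_topology}, 'n::euclidean_space) mfd \<Rightarrow> ('a \<Rightarrow> 'b) \<Rightarrow> 'a \<Rightarrow> 'm \<Rightarrow> 'n" where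
  "differential M N F p v =
     frechet_derivative (cmap (chart_at N (F p)) \<circ> F \<circ> cinv (chart_at M p)) (at (cmap (chart_at M p) p)) v"

definition ker_diff ::
    "('a::{t2_space, second_countable_topology}, 'm::euclidean_space) mfd \<Rightarrow>
     ('b::{t2_space, second_countable_topology}, 'n::euclidean_space) mfd \<Rightarrow> ('a \<Rightarrow> 'b) \<Rightarrow> 'a \<Rightarrow> 'm set" where
  "ker_diff M N F p = {v. differential M N F p v = 0}"

definition horizontal ::
    "('a::{t2_space, second_countable_topology}, 'm::euclidean_space) mfd \<Rightarrow>
     ('b::{t2_space, second_countable_topology}, 'n::euclidean_space) mfd \<Rightarrow> ('a \<Rightarrow> 'b) \<Rightarrow> 'a \<Rightarrow> 'm set" where
  "horizontal M N F p = orth_compl M p (ker_diff M N F p)"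

definition riemannian_map ::
    "('a::{t2_space, second_countable_topology}, 'm::euclidean_space) mfd \<Rightarrow>
     ('b::{t2_space, second_countable_topology}, 'n::euclidean_space) mfd \<Rightarrow> ('a \<Rightarrow> 'b) \<Rightarrow> bool" where
  "riemannian_map M N F \<longleftrightarrow>
     riemannian_manifold M \<and> riemannian_manifold N \<and> smooth_map M N F \<and>
     (\<forall>p. \<forall>v\<in>horizontal M N F p. \<forall>w\<in>horizontal M N F p.
        met N (F p) (differential M N F p v) (differential M N F p w) = met M p v w)"

text \<open>The decomposition of the kernel and the angle are parameters. That the kernel is the direct
  sum of \<open>D1\<close> and \<open>D2\<close> is automatic, as \<open>D2\<close> is the orthogonal complement of \<open>D1\<close> in it.\<close>

definition semi_slant_riemannian_map ::
    "('a::{t2_space, second_countable_topology}, 'm::euclidean_space) mfd \<Rightarrow> ('a \<Rightarrow> 'm \<Rightarrow> 'm) \<Rightarrow>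
     ('b::{t2_space, second_countable_topology}, 'n::euclidean_space) mfd \<Rightarrow> ('a \<Rightarrow> 'b) \<Rightarrow>
     ('a \<Rightarrow> 'm set) \<Rightarrow> ('a \<Rightarrow> 'm set) \<Rightarrow> real \<Rightarrow> bool" where
  "semi_slant_riemannian_map M J N F D1 D2 \<theta> \<longleftrightarrow>
     almost_hermitian M J \<and> riemannian_map M N F \<and> distribution M D1 \<and>
     (\<forall>p. D1 p \<subseteq> ker_diff M N F p \<and>
          D2 p = ker_diff M N F p \<inter> orth_compl M p (D1 p) \<and>
          J p ` D1 p = D1 p) \<and>
     (\<forall>p. \<forall>X\<in>D2 p. X \<noteq> 0 \<longrightarrow> angle_to_subspace M p (J p X) (D2 p) = \<theta>)"


section \<open>Second fundamental form, harmonicity, mean curvature of the range\<close>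

text \<open>A section of the pullback bundle along \<open>F\<close> is a function \<open>S\<close> with \<open>S q\<close> a tangent vector
  of \<open>N\<close> at \<open>F q\<close>. Below, \<open>c\<close> and \<open>d\<close> are charts around \<open>p\<close> and \<open>F p\<close>; the pullback
  connection is \<open>D S (u) + G (F\<^sub>* u) S\<close> in components, with \<open>G\<close> the connection form of \<open>N\<close>.\<close>

definition pullback_cov_deriv ::
    "('a::{t2_space, second_countable_topology}, 'm::euclidean_space) mfd \<Rightarrow>
     ('b::{t2_space, second_countable_topology}, 'n::euclidean_space) mfd \<Rightarrow> ('a \<Rightarrow> 'b) \<Rightarrow>
     'a \<Rightarrow> 'm \<Rightarrow> ('a \<Rightarrow> 'n) \<Rightarrow> 'n" where
  "pullback_cov_deriv M N F p u S =
     (let c = chart_at M p; d = chart_at N (F p) in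
       frechet_derivative (\<lambda>x. to_chart N d (F (cinv c x)) (S (cinv c x))) (at (cmap c p)) u
       + levi_civita_form N d (cmap d (F p)) (differential M N F p u) (S p))"

definition second_fund_form ::
    "('a::{t2_space, second_countable_topology}, 'm::euclidean_space) mfd \<Rightarrow>
     ('b::{t2_space, second_countable_topology}, 'n::euclidean_space) mfd \<Rightarrow> ('a \<Rightarrow> 'b) \<Rightarrow>
     ('a \<Rightarrow> 'm) \<Rightarrow> ('a \<Rightarrow> 'm) \<Rightarrow> 'a \<Rightarrow> 'n" where
  "second_fund_form M N F X Y p =
     pullback_cov_deriv M N F p (X p) (\<lambda>q. differential M N F q (Y q))
     - differential M N F p (cov_deriv M p (X p) Y)"

text \<open>The trace on a subbundle and the mean curvature do not depend on the chosen local
  orthonormal frame, since both are traces of tensors.\<close>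

definition trace_sff ::
    "('a::{t2_space, second_countable_topology}, 'm::euclidean_space) mfd \<Rightarrow>
     ('b::{t2_space, second_countable_topology}, 'n::euclidean_space) mfd \<Rightarrow> ('a \<Rightarrow> 'b) \<Rightarrow>
     ('a \<Rightarrow> 'm set) \<Rightarrow> 'a \<Rightarrow> 'n" where
  "trace_sff M N F E p =
     (let e = (SOME e. orthonormal_frame_near M E p e) in
       \<Sum>i<dim (E p). second_fund_form M N F (e i) (e i) p)"

definition harmonic_map ::
    "('a::{t2_space, second_countable_topology}, 'm::euclidean_space) mfd \<Rightarrow>
     ('b::{t2_space, second_countable_topology}, 'n::euclidean_space) mfd \<Rightarrow> ('a \<Rightarrow> 'b) \<Rightarrow> bool" where
  "harmonic_map M N F \<longleftrightarrow> (\<forall>p. trace_sff M N F (\<lambda>q. UNIV) p = 0)"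

definition range_diff ::
    "('a::{t2_space, second_countable_topology}, 'm::euclidean_space) mfd \<Rightarrow>
     ('b::{t2_space, second_countable_topology}, 'n::euclidean_space) mfd \<Rightarrow> ('a \<Rightarrow> 'b) \<Rightarrow> 'a \<Rightarrow> 'n set" where
  "range_diff M N F p = range (differential M N F p)"

text \<open>Projection of the fibre at \<open>p\<close> of the pullback bundle to the orthogonal complement of the
  range.\<close>

definition range_perp_proj ::
    "('a::{t2_space, second_countable_topology}, 'm::euclidean_space) mfd \<Rightarrow>
     ('b::{t2_space, second_countable_topology}, 'n::euclidean_space) mfd \<Rightarrow> ('a \<Rightarrow> 'b) \<Rightarrow> 'a \<Rightarrow> 'n \<Rightarrow> 'n" where
  "range_perp_proj M N F p w = orth_proj N (F p) (orth_compl N (F p) (range_diff M N F p)) w"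

text \<open>For \<open>l = 0\<close> the sum is empty and the value is \<open>0\<close>.\<close>

definition mean_curvature_range ::
    "('a::{t2_space, second_countable_topology}, 'm::euclidean_space) mfd \<Rightarrow>
     ('b::{t2_space, second_countable_topology}, 'n::euclidean_space) mfd \<Rightarrow> ('a \<Rightarrow> 'b) \<Rightarrow> 'a \<Rightarrow> 'n" where
  "mean_curvature_range M N F p =
     (let l = dim (horizontal M N F p);
          Z = (SOME Z. orthonormal_frame_near M (horizontal M N F) p Z) in
       (1 / real l) *\<^sub>R (\<Sum>i<l. range_perp_proj M N F p
          (pullback_cov_deriv M N F p (Z i p) (\<lambda>q. differential M N F q (Z i q)))))"

end

theory Submission
  imports Defs
begin

text \<open>Write \<open>B = \<nabla>F\<^sub>*\<close> and split the tangent bundle orthogonally as \<open>D1 \<oplus> D2 \<oplus> H\<close> with \<open>H\<close> horizontal;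
  all three bundles have local orthonormal frames, because their ranks are lower semicontinuous with
  constant sum. The trace of \<open>B\<close> is the sum of three terms.
  On \<open>D1\<close>, sections \<open>X, Y\<close> of the kernel satisfy \<open>B(X, Y) = - F\<^sub>*(\<nabla>\<^sub>X Y)\<close>, and \<open>\<nabla>J = 0\<close> together with
  \<open>[JX, X] \<in> D1\<close> gives \<open>B(JX, JX) = - B(X, X)\<close>; as \<open>J\<close> maps orthonormal bases of \<open>D1\<close> to such bases,
  this trace vanishes. On \<open>D2\<close> the trace is a value of \<open>F\<^sub>*\<close>. On \<open>H\<close>, differentiating
  \<open>g\<^sub>N(F\<^sub>* Y, F\<^sub>* Z) = g\<^sub>M(Y, Z)\<close> shows that \<open>B\<close> takes values orthogonal to the range of \<open>F\<^sub>*\<close>, so that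
  the trace is a multiple of the mean curvature of the range. Hence the last two terms are
  orthogonal, and their sum vanishes iff both do.\<close>

section \<open>Calculus of smooth functions\<close>

text \<open>Only \<open>D1\<close> comes with local frames. \<open>D2\<close> and the horizontal
  spaces are given fibre by fibre, while \<open>trace_sff\<close> and
  \<open>mean_curvature_range\<close> pick their frames by \<open>SOME\<close>; unless such frames
  exist, these are arbitrary values. Existence rests on smooth orthogonal projections: the
  horizontal one is an adjoint formula in \<open>F\<^sub>*\<close>, the one onto \<open>D1\<close>
  comes from its frames, and the one onto \<open>D2\<close> is the remainder. Each provides as many
  orthonormal local sections as its fibre at \<open>p\<close> has dimensions, whence the
  semicontinuity.

  A second obstacle is that a tangent vector is recorded in a chart picked arbitrarily at its base
  point, so no field can be differentiated as it stands; all fields are moved to one fixed chart.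
  There the second fundamental form is an explicit bilinear expression at a point, and its traces
  may be computed from any orthonormal basis of a fibre.

  Finally, integrability supplies integral manifolds, not brackets: that \<open>[JX, X]\<close> lies
  in \<open>D1\<close> is obtained by differentiating along a parametrization.\<close>

lemma frechet_derivative_cong_open:
  assumes "open S" "x \<in> S" "\<And>y. y \<in> S \<Longrightarrow> f y = g y"
  shows "frechet_derivative f (at x) = frechet_derivative g (at x)"
proof -
  have "(f has_derivative D) (at x) \<longleftrightarrow> (g has_derivative D) (at x)" for D
    using assms has_derivative_transform_within_open[of f D x UNIV S g]
      has_derivative_transform_within_open[of g D x UNIV S f] by auto
  then show ?thesis by (simp add: frechet_derivative_def)
qed

lemma differentiable_cong_open:
  assumes "open S" "x \<in> S" "\<And>y. y \<in> S \<Longrightarrow> f y = g y"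
  shows "f differentiable (at x) \<longleftrightarrow> g differentiable (at x)"
proof -
  have "(f has_derivative D) (at x) \<longleftrightarrow> (g has_derivative D) (at x)" for D
    using assms has_derivative_transform_within_open[of f D x UNIV S g]
      has_derivative_transform_within_open[of g D x UNIV S f] by auto
  then show ?thesis by (simp add: differentiable_def)
qed

lemma Ck_on_cong:
  assumes "open S" "\<And>y. y \<in> S \<Longrightarrow> f y = g y" "Ck_on k S f"
  shows "Ck_on k S g"
  using assms(2,3)
proof (induction k arbitrary: f g)
  case 0
  then show ?case by (simp cong: continuous_on_cong)
next
  case (Suc k)
  have "g differentiable_on S"
    using Suc.prems assms(1) differentiable_cong_open[OF assms(1), of _ f g]
    by (simp add: differentiable_on_eq_differentiable_at)
  moreover have "Ck_on k S (\<lambda>x. frechet_derivative g (at x) v)" for v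
  proof (rule Suc.IH[of "\<lambda>x. frechet_derivative f (at x) v"])
    show "frechet_derivative f (at y) v = frechet_derivative g (at y) v" if "y \<in> S" for y
      using frechet_derivative_cong_open[OF assms(1) that, of f g] Suc.prems(1) by simp
    show "Ck_on k S (\<lambda>x. frechet_derivative f (at x) v)" using Suc.prems by simp
  qed
  ultimately show ?case by simp
qed

lemma Ck_on_subset: "Ck_on k S f \<Longrightarrow> T \<subseteq> S \<Longrightarrow> Ck_on k T f"
  by (induction k arbitrary: f) (auto intro: continuous_on_subset differentiable_on_subset)

text \<open>A derivative depends only on a neighbourhood of the point. This gluing is needed because
  a map into \<open>N\<close> can be read in a chart of \<open>N\<close> only near a point, whereas
  smoothness is demanded over a whole chart domain of \<open>M\<close>.\<close>

lemma Ck_on_local: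
  assumes "\<And>x. x \<in> S \<Longrightarrow> \<exists>T. open T \<and> x \<in> T \<and> Ck_on k T f"
  shows "Ck_on k S f"
  using assms
proof (induction k arbitrary: f)
  case 0
  then have "isCont f x" if "x \<in> S" for x
    using that by (metis Ck_on.simps(1) continuous_on_eq_continuous_at)
  then show ?case by (simp add: continuous_at_imp_continuous_on)
next
  case (Suc k)
  have "f differentiable (at x)" if "x \<in> S" for x
    using Suc.prems[OF that] by (auto simp: differentiable_on_eq_differentiable_at)
  then have "f differentiable_on S"
    by (simp add: differentiable_at_imp_differentiable_on)
  moreover have "Ck_on k S (\<lambda>x. frechet_derivative f (at x) v)" for v
    using Suc.prems by (intro Suc.IH) auto
  ultimately show ?case by simp
qed

lemma Ck_on_Suc_imp: "Ck_on (Suc k) S f \<Longrightarrow> Ck_on k S f"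
  by (induction k arbitrary: f) (auto intro: differentiable_imp_continuous_on)

lemma Ck_on_const: "Ck_on k S (\<lambda>x. c)"
  by (induction k arbitrary: c) auto

lemma Ck_on_SucD:
  assumes "open S" "Ck_on (Suc k) S f" "x \<in> S"
  shows "(f has_derivative frechet_derivative f (at x)) (at x)"
  using assms by (simp add: differentiable_on_eq_differentiable_at frechet_derivative_works)

text \<open>Derivatives are unique on open sets, so an explicitly computed \<open>D\<close> may
  stand for \<open>frechet_derivative\<close> in the recursion. The sum, product, chain and power
  rules below all enter through this rule.\<close>

lemma Ck_on_SucI:
  assumes "open S" "\<And>x. x \<in> S \<Longrightarrow> (f has_derivative D x) (at x)" "\<And>v. Ck_on k S (\<lambda>x. D x v)"
  shows "Ck_on (Suc k) S f"
proof -
  have "f differentiable_on S"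
    using assms by (auto simp: differentiable_on_eq_differentiable_at differentiable_def)
  moreover have "Ck_on k S (\<lambda>x. frechet_derivative f (at x) v)" for v
    by (rule Ck_on_cong[OF assms(1) _ assms(3)[of v]]) (simp add: frechet_derivative_at[OF assms(2), symmetric])
  ultimately show ?thesis by simp
qed

lemma Ck_on_add:
  assumes "open S" "Ck_on k S f" "Ck_on k S g"
  shows "Ck_on k S (\<lambda>x. f x + g x)"
  using assms(2,3)
proof (induction k arbitrary: f g)
  case 0
  then show ?case by (simp add: continuous_on_add)
next
  case (Suc k)
  show ?case
  proof (rule Ck_on_SucI[OF assms(1)])
    show "((\<lambda>x. f x + g x) has_derivative (\<lambda>v. frechet_derivative f (at x) v + frechet_derivative g (at x) v)) (at x)"
      if "x \<in> S" for x
      using Suc.prems that by (intro has_derivative_add Ck_on_SucD[OF assms(1)])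
  qed (use Suc in auto)
qed

lemma Ck_on_sum:
  assumes "open S" "\<And>i. i \<in> I \<Longrightarrow> Ck_on k S (f i)"
  shows "Ck_on k S (\<lambda>x. \<Sum>i\<in>I. f i x)"
  using assms(2)
  by (induction I rule: infinite_finite_induct) (auto intro: Ck_on_const Ck_on_add[OF assms(1)])

lemma Ck_on_bounded_linear:
  assumes "open S" "Ck_on k S f" "bounded_linear L"
  shows "Ck_on k S (\<lambda>x. L (f x))"
  using assms(2)
proof (induction k arbitrary: f)
  case 0
  then show ?case by (simp add: bounded_linear.continuous_on[OF assms(3)])
next
  case (Suc k)
  show ?case
  proof (rule Ck_on_SucI[OF assms(1)])
    show "((\<lambda>x. L (f x)) has_derivative (\<lambda>v. L (frechet_derivative f (at x) v))) (at x)"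
      if "x \<in> S" for x
      using Suc.prems that by (intro bounded_linear.has_derivative[OF assms(3)] Ck_on_SucD[OF assms(1)])
  qed (use Suc in auto)
qed

lemma Ck_on_scaleR:
  fixes s :: "'x::euclidean_space \<Rightarrow> real"
  assumes "open S" "Ck_on k S s" "Ck_on k S f"
  shows "Ck_on k S (\<lambda>x. s x *\<^sub>R f x)"
  using assms(2,3)
proof (induction k arbitrary: s f)
  case 0
  then show ?case by (simp add: continuous_on_scaleR)
next
  case (Suc k)
  show ?case
  proof (rule Ck_on_SucI[OF assms(1)])
    show "((\<lambda>x. s x *\<^sub>R f x) has_derivative
        (\<lambda>v. s x *\<^sub>R frechet_derivative f (at x) v + frechet_derivative s (at x) v *\<^sub>R f x)) (at x)"
      if "x \<in> S" for x
      using Suc.prems that by (intro has_derivative_scaleR Ck_on_SucD[OF assms(1)])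
    show "Ck_on k S (\<lambda>x. s x *\<^sub>R frechet_derivative f (at x) v + frechet_derivative s (at x) v *\<^sub>R f x)" for v
      \<comment> \<open>Each summand of the product rule keeps one factor undifferentiated, and that
        factor has to be lowered from order \<open>Suc k\<close> to \<open>k\<close>.\<close>
      using Suc.prems Suc.prems[THEN Ck_on_Suc_imp]
      by (intro Ck_on_add[OF assms(1)] Suc.IH) auto
  qed
qed

lemma linear_expand:
  fixes L :: "'x::euclidean_space \<Rightarrow> 'y::real_vector"
  assumes "linear L"
  shows "L w = (\<Sum>b\<in>Basis. (w \<bullet> b) *\<^sub>R L b)"
proof -
  have "L w = L (\<Sum>b\<in>Basis. (w \<bullet> b) *\<^sub>R b)"
    by (simp only: euclidean_representation)
  also have "\<dots> = (\<Sum>b\<in>Basis. (w \<bullet> b) *\<^sub>R L b)"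
    by (simp only: linear_sum[OF assms] linear_scale[OF assms])
  finally show ?thesis .
qed

text \<open>The derivative of the outer function is expanded along a basis, so that only its directional
  derivatives in fixed directions occur.\<close>

lemma Ck_on_compose:
  fixes f :: "'x::euclidean_space \<Rightarrow> 'y::euclidean_space" and g :: "'y \<Rightarrow> 'z::real_normed_vector"
  assumes "open S" "open T" "f ` S \<subseteq> T" "Ck_on k S f" "Ck_on k T g"
  shows "Ck_on k S (\<lambda>x. g (f x))"
  using assms(4,5)
proof (induction k arbitrary: g)
  case 0
  then show ?case
    using assms(3) by (auto intro: continuous_on_compose2)
next
  case (Suc k)
  have fin: "f x \<in> T" if "x \<in> S" for x using that assms(3) by blast
  show ?case
  proof (rule Ck_on_SucI[OF assms(1)])
    fix x assume x: "x \<in> S"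
    note dg = Ck_on_SucD[OF assms(2) Suc.prems(2) fin[OF x]]
    have "((\<lambda>x. g (f x)) has_derivative (\<lambda>v. frechet_derivative g (at (f x)) (frechet_derivative f (at x) v))) (at x)"
      using diff_chain_at[OF Ck_on_SucD[OF assms(1) Suc.prems(1) x] dg] by (simp add: o_def)
    moreover have "(\<lambda>v. frechet_derivative g (at (f x)) (frechet_derivative f (at x) v))
        = (\<lambda>v. \<Sum>b\<in>Basis. (frechet_derivative f (at x) v \<bullet> b) *\<^sub>R frechet_derivative g (at (f x)) b)"
      by (rule ext, rule linear_expand[OF has_derivative_linear[OF dg]])
    ultimately show "((\<lambda>x. g (f x)) has_derivative
       (\<lambda>v. \<Sum>b\<in>Basis. (frechet_derivative f (at x) v \<bullet> b) *\<^sub>R frechet_derivative g (at (f x)) b)) (at x)"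
      by (rule back_subst)
  next
    fix v
    show "Ck_on k S (\<lambda>x. \<Sum>b\<in>Basis. (frechet_derivative f (at x) v \<bullet> b) *\<^sub>R frechet_derivative g (at (f x)) b)"
    proof (intro Ck_on_sum Ck_on_scaleR assms(1))
      show "Ck_on k S (\<lambda>x. frechet_derivative f (at x) v \<bullet> b)" for b
        using Suc.prems by (intro Ck_on_bounded_linear[OF assms(1) _ bounded_linear_inner_left]) simp
      show "Ck_on k S (\<lambda>x. frechet_derivative g (at (f x)) b)" for b
        using Suc.prems Ck_on_Suc_imp
        by (intro Suc.IH[of "\<lambda>y. frechet_derivative g (at y) b"]) auto
    qed
  qed
qed

text \<open>The exponent is kept general because differentiation lowers it by one at the cost of a
  constant factor. The case \<open>a = -1/2\<close> normalises fields in the Gram-Schmidt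
  process.\<close>

lemma Ck_on_powr: "Ck_on k {0<..} (\<lambda>x::real. x powr a)"
proof (induction k arbitrary: a)
  case 0
  show ?case by (auto intro!: continuous_intros)
next
  case (Suc k)
  show ?case
  proof (rule Ck_on_SucI)
    show "((\<lambda>x. x powr a) has_derivative (\<lambda>v. (v * a) *\<^sub>R (x powr (a - 1)))) (at x)"
      if "x \<in> {0<..}" for x
    proof -
      have "((\<lambda>z. z powr a) has_derivative (*) (a * x powr (a - 1))) (at x)"
        using has_real_derivative_powr[of x a] that by (simp add: has_field_derivative_def)
      moreover have "(*) (a * x powr (a - 1)) = (\<lambda>v. (v * a) *\<^sub>R (x powr (a - 1)))"
        by (auto simp: fun_eq_iff)
      ultimately show ?thesis by simp
    qed
    show "Ck_on k {0<..} (\<lambda>x. (v * a) *\<^sub>R (x powr (a - 1)))" for v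
      by (rule Ck_on_scaleR[OF _ Ck_on_const Suc]) simp
  qed simp
qed

section \<open>Closure properties of smooth functions\<close>

lemma smooth_on_cong: "open S \<Longrightarrow> (\<And>y. y \<in> S \<Longrightarrow> f y = g y) \<Longrightarrow> smooth_on S f \<Longrightarrow> smooth_on S g"
  unfolding smooth_on_def using Ck_on_cong by blast

lemma smooth_on_subset: "smooth_on S f \<Longrightarrow> T \<subseteq> S \<Longrightarrow> smooth_on T f"
  unfolding smooth_on_def using Ck_on_subset by blast

lemma smooth_on_local:
  assumes "\<And>x. x \<in> S \<Longrightarrow> \<exists>T. open T \<and> x \<in> T \<and> smooth_on T f"
  shows "smooth_on S f"
  using assms unfolding smooth_on_def by (meson Ck_on_local)

lemma smooth_on_const: "smooth_on S (\<lambda>x. c)"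
  unfolding smooth_on_def using Ck_on_const by blast

lemma smooth_on_ident: "smooth_on S (\<lambda>x. x)"
  unfolding smooth_on_def
proof
  show "Ck_on k S (\<lambda>x. x)" for k by (cases k) (auto simp: Ck_on_const)
qed

lemma smooth_on_add: "open S \<Longrightarrow> smooth_on S f \<Longrightarrow> smooth_on S g \<Longrightarrow> smooth_on S (\<lambda>x. f x + g x)"
  unfolding smooth_on_def using Ck_on_add by blast

lemma smooth_on_sum: "open S \<Longrightarrow> (\<And>i. i \<in> I \<Longrightarrow> smooth_on S (f i)) \<Longrightarrow> smooth_on S (\<lambda>x. \<Sum>i\<in>I. f i x)"
  unfolding smooth_on_def by (simp add: Ck_on_sum)

lemma smooth_on_bounded_linear: "open S \<Longrightarrow> smooth_on S f \<Longrightarrow> bounded_linear L \<Longrightarrow> smooth_on S (\<lambda>x. L (f x))"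
  unfolding smooth_on_def using Ck_on_bounded_linear by blast

lemma smooth_on_scaleR: "open S \<Longrightarrow> smooth_on S s \<Longrightarrow> smooth_on S f \<Longrightarrow> smooth_on S (\<lambda>x. s x *\<^sub>R f x)"
  unfolding smooth_on_def using Ck_on_scaleR by blast

lemma smooth_on_compose:
  fixes f :: "'x::euclidean_space \<Rightarrow> 'y::euclidean_space" and g :: "'y \<Rightarrow> 'z::real_normed_vector"
  shows "open S \<Longrightarrow> open T \<Longrightarrow> f ` S \<subseteq> T \<Longrightarrow> smooth_on S f \<Longrightarrow> smooth_on T g \<Longrightarrow> smooth_on S (\<lambda>x. g (f x))"
  unfolding smooth_on_def using Ck_on_compose by blast

lemma smooth_on_powr:
  fixes f :: "'x::euclidean_space \<Rightarrow> real"
  assumes "open S" "smooth_on S f" "\<And>x. x \<in> S \<Longrightarrow> f x > 0"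
  shows "smooth_on S (\<lambda>x. f x powr a)"
  using Ck_on_powr assms(3)
  by (intro smooth_on_compose[OF assms(1) _ _ assms(2), of "{0<..}" "\<lambda>x. x powr a"]) (auto simp: smooth_on_def)

lemma smooth_on_frechet: "smooth_on S f \<Longrightarrow> smooth_on S (\<lambda>x. frechet_derivative f (at x) v)"
  unfolding smooth_on_def by (metis Ck_on.simps(2))

lemma smooth_on_has_derivative:
  assumes "smooth_on S f" "open S" "x \<in> S"
  shows "(f has_derivative frechet_derivative f (at x)) (at x)"
  using smooth_on_differentiable_at[OF assms] frechet_derivative_works by blast

lemma smooth_on_imp_continuous_on: "smooth_on S f \<Longrightarrow> continuous_on S f"
  unfolding smooth_on_def by (metis Ck_on.simps(1))

lemma smooth_on_inner_const:
  assumes "open S" "smooth_on S f" shows "smooth_on S (\<lambda>x. f x \<bullet> b)"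
  by (rule smooth_on_bounded_linear[OF assms bounded_linear_inner_left])

text \<open>Metrics, complex structures and differentials are known to be smooth in the base point
  only for each fixed argument; expanding a varying argument along the basis reduces to that
  case.\<close>

lemma smooth_on_linear_apply:
  fixes T :: "'x::euclidean_space \<Rightarrow> 'y::euclidean_space \<Rightarrow> 'z::real_normed_vector"
  assumes "open S" "\<And>x. x \<in> S \<Longrightarrow> linear (T x)" "\<And>w. smooth_on S (\<lambda>x. T x w)" "smooth_on S s"
  shows "smooth_on S (\<lambda>x. T x (s x))"
proof (rule smooth_on_cong[OF assms(1)])
  show "smooth_on S (\<lambda>x. \<Sum>b\<in>Basis. (s x \<bullet> b) *\<^sub>R T x b)"
    by (intro smooth_on_sum smooth_on_scaleR smooth_on_inner_const assms)
qed (simp add: linear_expand[OF assms(2), symmetric])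

text \<open>A product rule that never treats \<open>T\<close> as an operator-valued map: only its
  values on fixed vectors are differentiated, and the varying argument is expanded along the
  basis.\<close>

lemma has_derivative_linear_apply:
  fixes T :: "'x::euclidean_space \<Rightarrow> 'y::euclidean_space \<Rightarrow> 'z::real_normed_vector"
  assumes "open S" "x \<in> S" "\<And>y. y \<in> S \<Longrightarrow> linear (T y)"
    "\<And>w. ((\<lambda>y. T y w) has_derivative (\<lambda>u. T' u w)) (at x)" "(s has_derivative s') (at x)"
  shows "((\<lambda>y. T y (s y)) has_derivative (\<lambda>u. T' u (s x) + T x (s' u))) (at x)"
proof -
  \<comment> \<open>Linearity passes from \<open>T\<close> to each \<open>T' u\<close> by uniqueness
    of derivatives.\<close>
  have lin: "linear (T' u)" for u
  proof (rule linearI)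
    fix v w :: 'y and r :: real
    have "((\<lambda>y. T y (v + w)) has_derivative (\<lambda>u. T' u v + T' u w)) (at x)"
      by (rule has_derivative_transform_within_open[OF has_derivative_add[OF assms(4,4)] assms(1,2)])
        (simp add: linear_add[OF assms(3)])
    from has_derivative_unique[OF assms(4) this] show "T' u (v + w) = T' u v + T' u w" by metis
    have "((\<lambda>y. T y (r *\<^sub>R v)) has_derivative (\<lambda>u. r *\<^sub>R T' u v)) (at x)"
      by (rule has_derivative_transform_within_open[OF has_derivative_scaleR_right[OF assms(4)] assms(1,2)])
        (simp add: linear_scale[OF assms(3)])
    from has_derivative_unique[OF assms(4) this] show "T' u (r *\<^sub>R v) = r *\<^sub>R T' u v" by metis
  qed
  have "((\<lambda>y. \<Sum>b\<in>Basis. (s y \<bullet> b) *\<^sub>R T y b) has_derivative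
     (\<lambda>u. \<Sum>b\<in>Basis. (s x \<bullet> b) *\<^sub>R T' u b + (s' u \<bullet> b) *\<^sub>R T x b)) (at x)"
    by (intro has_derivative_sum has_derivative_scaleR has_derivative_inner_left assms)
  then have "((\<lambda>y. \<Sum>b\<in>Basis. (s y \<bullet> b) *\<^sub>R T y b) has_derivative (\<lambda>u. T' u (s x) + T x (s' u))) (at x)"
    by (simp add: sum.distrib linear_expand[OF lin, symmetric] linear_expand[OF assms(3)[OF assms(2)], symmetric])
  then show ?thesis
    by (rule has_derivative_transform_within_open[OF _ assms(1,2)])
      (simp add: linear_expand[OF assms(3), symmetric])
qed

text \<open>The second difference of \<open>f\<close> is expressed by the mean value theorem through either iterated
  derivative.\<close>

lemma second_derivative_symmetric_real:
  fixes f :: "'x::euclidean_space \<Rightarrow> real"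
  assumes S: "open S" "x \<in> S" and f: "smooth_on S f"
  shows "frechet_derivative (\<lambda>y. frechet_derivative f (at y) v) (at x) u
       = frechet_derivative (\<lambda>y. frechet_derivative f (at y) u) (at x) v"
proof -
  define D where "D = (\<lambda>a b y. frechet_derivative (\<lambda>z. frechet_derivative f (at z) a) (at y) b)"
  obtain e where e: "e > 0" "ball x e \<subseteq> S" using S openE by blast
  have near: "x + s *\<^sub>R a + t *\<^sub>R b \<in> ball x r"
    if "\<bar>s\<bar> \<le> h" "\<bar>t\<bar> \<le> h" "h * (norm a + norm b) < r" for s t h r a b
  proof -
    have "norm (s *\<^sub>R a + t *\<^sub>R b) \<le> \<bar>s\<bar> * norm a + \<bar>t\<bar> * norm b"
      by (metis norm_scaleR norm_triangle_ineq)
    also have "\<dots> \<le> h * norm a + h * norm b"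
      using that by (intro add_mono mult_right_mono) auto
    finally show ?thesis using that(3) by (simp add: dist_norm norm_minus_commute algebra_simps)
  qed
  \<comment> \<open>This is the second difference over the parallelogram with sides
    \<open>h *\<^sub>R a\<close> and \<open>h *\<^sub>R b\<close>. The mean value theorem is applied
    to the increment \<open>?g\<close> in direction \<open>b\<close> as a function of the step in
    direction \<open>a\<close>, and once more in direction \<open>b\<close>.\<close>
  have key: "\<exists>s t. 0 < s \<and> s < h \<and> 0 < t \<and> t < h \<and>
      f (x + h *\<^sub>R a + h *\<^sub>R b) - f (x + h *\<^sub>R a) - f (x + h *\<^sub>R b) + f x = h * h * D a b (x + s *\<^sub>R a + t *\<^sub>R b)"
    if h: "0 < h" "h * (norm a + norm b) < e" for a b h
  proof -
    have inS: "x + s *\<^sub>R a + t *\<^sub>R b \<in> S" if "0 \<le> s" "s \<le> h" "0 \<le> t" "t \<le> h" for s t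
      using near[of s h t a b e] that h e(2) by auto
    let ?g = "\<lambda>s. f (x + s *\<^sub>R a + h *\<^sub>R b) - f (x + s *\<^sub>R a)"
    have d1: "((\<lambda>s. f (x + s *\<^sub>R a + t *\<^sub>R b)) has_real_derivative frechet_derivative f (at (x + s *\<^sub>R a + t *\<^sub>R b)) a) (at s)"
      if "0 \<le> s" "s \<le> h" "0 \<le> t" "t \<le> h" for s t
    proof -
      have l: "((\<lambda>s. x + s *\<^sub>R a + t *\<^sub>R b) has_derivative (\<lambda>r. r *\<^sub>R a)) (at s)"
        by (auto intro!: derivative_eq_intros)
      note F = smooth_on_has_derivative[OF f S(1) inS[OF that]]
      from diff_chain_at[OF l F] show ?thesis
        by (simp add: has_field_derivative_def o_def linear_scale[OF has_derivative_linear[OF F]] mult.commute[of _ "frechet_derivative _ _ _"])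
    qed
    have "\<exists>s>0. s < h \<and> ?g h - ?g 0 = (h - 0) *
       (frechet_derivative f (at (x + s *\<^sub>R a + h *\<^sub>R b)) a - frechet_derivative f (at (x + s *\<^sub>R a)) a)"
      using h(1) d1[of _ h] d1[of _ 0] by (intro MVT2) (auto intro!: derivative_intros)
    then obtain s where s: "0 < s" "s < h" "?g h - ?g 0 = h *
       (frechet_derivative f (at (x + s *\<^sub>R a + h *\<^sub>R b)) a - frechet_derivative f (at (x + s *\<^sub>R a)) a)" by auto
    have d2: "((\<lambda>t. frechet_derivative f (at (x + s *\<^sub>R a + t *\<^sub>R b)) a) has_real_derivative D a b (x + s *\<^sub>R a + t *\<^sub>R b)) (at t)"
      if "0 \<le> t" "t \<le> h" for t
    proof -
      have l: "((\<lambda>t. x + s *\<^sub>R a + t *\<^sub>R b) has_derivative (\<lambda>r. r *\<^sub>R b)) (at t)"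
        by (auto intro!: derivative_eq_intros)
      note F = smooth_on_has_derivative[OF smooth_on_frechet[OF f, of a] S(1) inS[of s t]]
      show ?thesis
        using diff_chain_at[OF l F] that s
        by (simp add: has_field_derivative_def o_def linear_scale[OF has_derivative_linear[OF F]] D_def mult.commute[of _ "frechet_derivative _ _ _"])
    qed
    have "\<exists>t>0. t < h \<and> frechet_derivative f (at (x + s *\<^sub>R a + h *\<^sub>R b)) a - frechet_derivative f (at (x + s *\<^sub>R a + 0 *\<^sub>R b)) a
       = (h - 0) * D a b (x + s *\<^sub>R a + t *\<^sub>R b)"
      using h(1) d2 by (intro MVT2) auto
    then obtain t where t: "0 < t" "t < h"
      "frechet_derivative f (at (x + s *\<^sub>R a + h *\<^sub>R b)) a - frechet_derivative f (at (x + s *\<^sub>R a)) a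
       = h * D a b (x + s *\<^sub>R a + t *\<^sub>R b)" by auto
    have "f (x + h *\<^sub>R a + h *\<^sub>R b) - f (x + h *\<^sub>R a) - f (x + h *\<^sub>R b) + f x = ?g h - ?g 0"
      by simp
    then show ?thesis using s(1,2) t(1,2) unfolding s(3) t(3) by (metis mult.assoc)
  qed
  have cont: "isCont (D a b) x" for a b
    unfolding D_def
    using smooth_on_imp_continuous_on[OF smooth_on_frechet[OF smooth_on_frechet[OF f]]] S
    by (metis continuous_on_eq_continuous_at)
  have "\<bar>D v u x - D u v x\<bar> \<le> d" if d: "d > 0" for d
  proof -
    obtain r1 where r1: "r1 > 0" "\<And>y. dist y x < r1 \<Longrightarrow> \<bar>D v u y - D v u x\<bar> < d / 2"
      using cont[of v u] d unfolding continuous_at_eps_delta dist_real_def by (meson half_gt_zero)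
    obtain r2 where r2: "r2 > 0" "\<And>y. dist y x < r2 \<Longrightarrow> \<bar>D u v y - D u v x\<bar> < d / 2"
      using cont[of u v] d unfolding continuous_at_eps_delta dist_real_def by (meson half_gt_zero)
    define r where "r = min e (min r1 r2)"
    have r: "r > 0" using e r1 r2 by (simp add: r_def)
    \<comment> \<open>This size keeps both parallelograms inside the ball of radius
      \<open>r\<close>; the factor \<open>2\<close> gives a strict inequality, and the summand
      \<open>1\<close> keeps the denominator positive when \<open>u\<close> and \<open>v\<close>
      vanish.\<close>
    define h where "h = r / (2 * (norm u + norm v + 1))"
    have pos: "norm u + norm v + 1 > 0" by (simp add: add_nonneg_pos)
    have h0: "h > 0" using r pos by (simp add: h_def)
    have "h * (norm u + norm v) \<le> h * (norm u + norm v + 1)" using h0 by simp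
    also have "\<dots> = r / 2" using pos by (simp add: h_def field_simps)
    finally have h: "h * (norm u + norm v) < r" using r by simp
    then have h': "h * (norm v + norm u) < r" by (simp add: add.commute)
    obtain s t where st: "0 < s" "s < h" "0 < t" "t < h"
      "f (x + h *\<^sub>R u + h *\<^sub>R v) - f (x + h *\<^sub>R u) - f (x + h *\<^sub>R v) + f x = h * h * D u v (x + s *\<^sub>R u + t *\<^sub>R v)"
      using key[of h u v] h0 h by (auto simp: r_def)
    obtain s' t' where st': "0 < s'" "s' < h" "0 < t'" "t' < h"
      "f (x + h *\<^sub>R v + h *\<^sub>R u) - f (x + h *\<^sub>R v) - f (x + h *\<^sub>R u) + f x = h * h * D v u (x + s' *\<^sub>R v + t' *\<^sub>R u)"
      using key[of h v u] h0 h' by (auto simp: r_def)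
    have "h * h * D u v (x + s *\<^sub>R u + t *\<^sub>R v) = h * h * D v u (x + s' *\<^sub>R v + t' *\<^sub>R u)"
      using st(5) st'(5) by (simp add: algebra_simps)
    then have eq: "D u v (x + s *\<^sub>R u + t *\<^sub>R v) = D v u (x + s' *\<^sub>R v + t' *\<^sub>R u)" using h0 by simp
    have "dist (x + s *\<^sub>R u + t *\<^sub>R v) x < r2" "dist (x + s' *\<^sub>R v + t' *\<^sub>R u) x < r1"
      using near[of s h t u v r] near[of s' h t' v u r] st st' h h' by (auto simp: r_def dist_commute)
    then show ?thesis using r1(2) r2(2) eq by (smt (verit) field_sum_of_halves)
  qed
  then have "D v u x = D u v x"
    by (metis abs_le_zero_iff dense_ge eq_iff_diff_eq_0)
  then show ?thesis by (simp add: D_def)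
qed

lemma second_derivative_symmetric:
  fixes f :: "'x::euclidean_space \<Rightarrow> 'y::euclidean_space"
  assumes S: "open S" "x \<in> S" and f: "smooth_on S f"
  shows "frechet_derivative (\<lambda>y. frechet_derivative f (at y) v) (at x) u
       = frechet_derivative (\<lambda>y. frechet_derivative f (at y) u) (at x) v"
proof (rule euclidean_eqI)
  fix b :: 'y
  let ?f = "\<lambda>y. f y \<bullet> b"
  have 1: "frechet_derivative ?f (at y) a = frechet_derivative f (at y) a \<bullet> b" if "y \<in> S" for y a
    using frechet_derivative_at[OF has_derivative_inner_left[OF smooth_on_has_derivative[OF f S(1) that], of b]]
    by metis
  have "frechet_derivative (\<lambda>y. frechet_derivative ?f (at y) a) (at x) c
      = frechet_derivative (\<lambda>y. frechet_derivative f (at y) a) (at x) c \<bullet> b" for a c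
  proof -
    have "frechet_derivative (\<lambda>y. frechet_derivative ?f (at y) a) (at x)
      = frechet_derivative (\<lambda>y. frechet_derivative f (at y) a \<bullet> b) (at x)"
      by (rule frechet_derivative_cong_open[OF S]) (rule 1)
    then show ?thesis
      using frechet_derivative_at[OF has_derivative_inner_left[OF smooth_on_has_derivative[OF smooth_on_frechet[OF f, of a] S], of b]]
      by metis
  qed
  with second_derivative_symmetric_real[OF S smooth_on_inner_const[OF S(1) f, of b]]
  show "frechet_derivative (\<lambda>y. frechet_derivative f (at y) v) (at x) u \<bullet> b
       = frechet_derivative (\<lambda>y. frechet_derivative f (at y) u) (at x) v \<bullet> b" by simp
qed


section \<open>Tangent vectors in charts\<close>

lemma linear_to_chart:
  assumes M: "smooth_manifold M" "c \<in> charts M" "p \<in> cdom c"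
  shows "linear (to_chart M c p)"
  using transition_differentiable[OF M(1) chart_at_mem(1)[OF M(1)] M(2) chart_at_mem(2)[OF M(1)] M(3)]
  unfolding to_chart_def by (rule linear_frechet_derivative)

lemma to_chart_chart_at:
  assumes M: "smooth_manifold M"
  shows "to_chart M (chart_at M p) p v = v"
proof -
  let ?c = "chart_at M p"
  note c = chart_at_mem[OF M, of p]
  have "((cmap ?c \<circ> cinv ?c) has_derivative (\<lambda>x. x)) (at (cmap ?c p))"
    by (rule has_derivative_transform_within_open[OF has_derivative_ident chart_props(2)[OF M c(1)]])
      (use c in \<open>auto simp: cinv_cmap[OF M c(1)]\<close>)
  from frechet_derivative_at[OF this] show ?thesis
    unfolding to_chart_def by metis
qed

text \<open>A one-sided inverse of an endomorphism of a finite-dimensional space is two-sided, so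
  the opposite composition \<open>to_chart_of_chart\<close> suffices.\<close>

lemma of_chart_to_chart:
  assumes M: "smooth_manifold M" "c \<in> charts M" "p \<in> cdom c"
  shows "of_chart M c p (to_chart M c p v) = v"
proof -
  have "to_chart M c p \<circ> of_chart M c p = id"
    using to_chart_of_chart[OF M] by (simp add: fun_eq_iff)
  then have "of_chart M c p \<circ> to_chart M c p = id"
    using linear_inverse_left[OF linear_to_chart[OF M] linear_of_chart[OF M]] by blast
  then show ?thesis by (simp add: fun_eq_iff)
qed

text \<open>The chain rule that leaves the reference chart at \<open>g x\<close>. It serves three
  kinds of \<open>g\<close>: an inverse chart, the map \<open>F\<close> in coordinates, and the
  parametrization of an integral manifold.\<close>

lemma chart_change_derivative:
  assumes M: "smooth_manifold M" "c \<in> charts M"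
    and T: "open T" "x \<in> T" "g ` T \<subseteq> cdom c \<inter> cdom (chart_at M (g x))"
    and A: "((cmap (chart_at M (g x)) \<circ> g) has_derivative A) (at x)"
  shows "((cmap c \<circ> g) has_derivative (\<lambda>v. to_chart M c (g x) (A v))) (at x)"
proof -
  let ?d = "chart_at M (g x)"
  note d = chart_at_mem[OF M(1), of "g x"]
  have "(cmap c \<circ> cinv ?d) differentiable (at (cmap ?d (g x)))"
    by (rule transition_differentiable[OF M(1) d(1) M(2) d(2)]) (use T in auto)
  then have "((cmap c \<circ> cinv ?d) has_derivative to_chart M c (g x)) (at ((cmap ?d \<circ> g) x))"
    unfolding to_chart_def by (simp add: frechet_derivative_works)
  from diff_chain_at[OF A this]
  have "(((cmap c \<circ> cinv ?d) \<circ> (cmap ?d \<circ> g)) has_derivative (\<lambda>v. to_chart M c (g x) (A v))) (at x)"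
    by (simp add: o_def)
  then show ?thesis
    by (rule has_derivative_transform_within_open[OF _ T(1,2)])
      (use T(3) in \<open>auto simp: cinv_cmap[OF M(1) d(1)] image_subset_iff\<close>)
qed

lemma open_chart_overlap:
  assumes M: "smooth_manifold M" "c \<in> charts M" "d \<in> charts M"
  shows "open (cmap c ` (cdom c \<inter> cdom d))"
  using open_chart_image[OF M(1,2)] chart_props(1)[OF M(1,3)] .

lemma cinv_mem:
  assumes "x \<in> cmap c ` (cdom c \<inter> U)" "smooth_manifold M" "c \<in> charts M"
  shows "cinv c x \<in> cdom c \<inter> U" "cmap c (cinv c x) = x"
  using assms by (auto simp: cinv_cmap[OF assms(2,3)])

text \<open>The reference chart at \<open>p\<close> cancels between the two factors. As it varies
  with \<open>p\<close> without any regularity, smooth dependence on \<open>p\<close> becomes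
  visible only after this cancellation.\<close>

lemma to_chart_of_chart_transition:
  assumes M: "smooth_manifold M" "c \<in> charts M" "d \<in> charts M" and p: "p \<in> cdom c" "p \<in> cdom d"
  shows "to_chart M d p (of_chart M c p w) = frechet_derivative (cmap d \<circ> cinv c) (at (cmap c p)) w"
proof -
  let ?e = "chart_at M p"
  note e = chart_at_mem[OF M(1), of p]
  let ?T = "cmap c ` (cdom c \<inter> (cdom d \<inter> cdom ?e))"
  have "((cmap d \<circ> cinv c) has_derivative (\<lambda>v. to_chart M d (cinv c (cmap c p)) (of_chart M c p v))) (at (cmap c p))"
  proof (rule chart_change_derivative[OF M(1,3), of ?T])
    show "open ?T"
      by (intro open_chart_image[OF M(1,2)] open_Int chart_props(1)[OF M(1)] M(3) e(1))
    show "cmap c p \<in> ?T" using p e by auto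
    show "cinv c ` ?T \<subseteq> cdom d \<inter> cdom (chart_at M (cinv c (cmap c p)))"
      using cinv_mem[OF _ M(1,2)] by (auto simp: cinv_cmap[OF M(1,2)] p)
    show "((cmap (chart_at M (cinv c (cmap c p))) \<circ> cinv c) has_derivative of_chart M c p) (at (cmap c p))"
      unfolding of_chart_def cinv_cmap[OF M(1,2) p(1)]
      using transition_differentiable[OF M(1,2) e(1) p(1) e(2)] frechet_derivative_works by blast
  qed
  from frechet_derivative_at[OF this] show ?thesis
    unfolding cinv_cmap[OF M(1,2) p(1)] by metis
qed

section \<open>Maps between manifolds in fixed charts\<close>

lemma smooth_mapD:
  assumes "smooth_map M N F" "smooth_manifold M" "smooth_manifold N" "c \<in> charts M" "d \<in> charts N"
  shows "open (cdom c \<inter> F -` cdom d)" "open (cmap c ` (cdom c \<inter> F -` cdom d))"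
    "smooth_on (cmap c ` (cdom c \<inter> F -` cdom d)) (cmap d \<circ> F \<circ> cinv c)"
proof -
  have "open (F -` cdom d)"
    using assms chart_props(1)[OF assms(3,5)] by (auto simp: smooth_map_def continuous_on_open_vimage)
  then show "open (cdom c \<inter> F -` cdom d)" "open (cmap c ` (cdom c \<inter> F -` cdom d))"
    using chart_props(1)[OF assms(2,4)] open_chart_image[OF assms(2,4)] by auto
  show "smooth_on (cmap c ` (cdom c \<inter> F -` cdom d)) (cmap d \<circ> F \<circ> cinv c)"
    using assms unfolding smooth_map_def by blast
qed

text \<open>The derivative of \<open>cmap d \<circ> F \<circ> cinv (chart_at M p)\<close> is
  computed in two ways and compared. The right-hand side involves only the Jacobian in the fixed
  charts \<open>c\<close> and \<open>d\<close>, which can be differentiated again in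
  \<open>p\<close>.\<close>

lemma to_chart_differential:
  assumes F: "smooth_map M N F" and M: "smooth_manifold M" "c \<in> charts M" "p \<in> cdom c"
    and N: "smooth_manifold N" "d \<in> charts N" "F p \<in> cdom d"
  shows "to_chart N d (F p) (differential M N F p v)
    = frechet_derivative (cmap d \<circ> F \<circ> cinv c) (at (cmap c p)) (to_chart M c p v)"
proof -
  let ?c = "chart_at M p" and ?d = "chart_at N (F p)"
  note c = chart_at_mem[OF M(1), of p] and d = chart_at_mem[OF N(1), of "F p"]
  let ?T = "cmap ?c ` (cdom ?c \<inter> (cdom c \<inter> (F -` cdom d \<inter> F -` cdom ?d)))"
  have opF: "open (F -` cdom d')" if "d' \<in> charts N" for d'
    using F chart_props(1)[OF N(1) that] by (auto simp: smooth_map_def continuous_on_open_vimage)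
  have T: "open ?T"
    by (intro open_chart_image[OF M(1) c(1)] open_Int opF chart_props(1)[OF M(1,2)] N(2) d(1))
  have T2: "cmap ?c p \<in> ?T"
    using c d M N by auto
  have p: "cinv ?c (cmap ?c p) = p" by (simp add: cinv_cmap[OF M(1)] c)
  then have pc: "(cmap c \<circ> cinv ?c) (cmap ?c p) = cmap c p" by simp
  have "((cmap d \<circ> (F \<circ> cinv ?c)) has_derivative
      (\<lambda>v. to_chart N d ((F \<circ> cinv ?c) (cmap ?c p)) (differential M N F p v))) (at (cmap ?c p))"
  proof (rule chart_change_derivative[OF N(1,2) T T2])
    show "(F \<circ> cinv ?c) ` ?T \<subseteq> cdom d \<inter> cdom (chart_at N ((F \<circ> cinv ?c) (cmap ?c p)))"
      by (auto simp: cinv_cmap[OF M(1)] c)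
    have "((cmap ?d \<circ> F \<circ> cinv ?c) has_derivative differential M N F p) (at (cmap ?c p))"
      unfolding differential_def
      using smooth_mapD[OF F M(1) N(1) c(1) d(1)] c d by (intro smooth_on_has_derivative) auto
    then show "((cmap (chart_at N ((F \<circ> cinv ?c) (cmap ?c p))) \<circ> (F \<circ> cinv ?c)) has_derivative
        differential M N F p) (at (cmap ?c p))"
      by (simp add: p o_def)
  qed
  then have 1: "((cmap d \<circ> F \<circ> cinv ?c) has_derivative (\<lambda>v. to_chart N d (F p) (differential M N F p v))) (at (cmap ?c p))"
    by (simp add: p o_def)
  have "((cmap c \<circ> cinv ?c) has_derivative to_chart M c p) (at (cmap ?c p))"
    unfolding to_chart_def
    using transition_differentiable[OF M(1) c(1) M(2) c(2) M(3)] frechet_derivative_works by blast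
  moreover have "((cmap d \<circ> F \<circ> cinv c) has_derivative frechet_derivative (cmap d \<circ> F \<circ> cinv c) (at (cmap c p)))
      (at ((cmap c \<circ> cinv ?c) (cmap ?c p)))"
    unfolding pc
    by (rule smooth_on_has_derivative[OF smooth_mapD(3,2)[OF F M(1) N(1) M(2) N(2)]]) (use M N in auto)
  ultimately have "(((cmap d \<circ> F \<circ> cinv c) \<circ> (cmap c \<circ> cinv ?c)) has_derivative
      (frechet_derivative (cmap d \<circ> F \<circ> cinv c) (at (cmap c p)) \<circ> to_chart M c p)) (at (cmap ?c p))"
    by (rule diff_chain_at)
  then have "((cmap d \<circ> F \<circ> cinv ?c) has_derivative
      (frechet_derivative (cmap d \<circ> F \<circ> cinv c) (at (cmap c p)) \<circ> to_chart M c p)) (at (cmap ?c p))"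
    by (rule has_derivative_transform_within_open[OF _ T T2])
      (auto simp: cinv_cmap[OF M(1)] c M)
  from has_derivative_unique[OF 1 this] show ?thesis by (simp add: fun_eq_iff)
qed

lemma linear_differential:
  assumes F: "smooth_map M N F" and M: "smooth_manifold M" and N: "smooth_manifold N"
  shows "linear (differential M N F p)"
proof -
  note c = chart_at_mem[OF M, of p] and d = chart_at_mem[OF N, of "F p"]
  have "(cmap (chart_at N (F p)) \<circ> F \<circ> cinv (chart_at M p)) differentiable (at (cmap (chart_at M p) p))"
    using smooth_mapD[OF F M N c(1) d(1)] c d by (intro smooth_on_differentiable_at) auto
  then show ?thesis unfolding differential_def by (rule linear_frechet_derivative)
qed


section \<open>Smooth functions and fields\<close>

definition smooth_fun_on ::
    "('a::{t2_space, second_countable_topology}, 'm::euclidean_space) mfd \<Rightarrow> 'a set \<Rightarrow> ('a \<Rightarrow> real) \<Rightarrow> bool" where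
  "smooth_fun_on M U s \<longleftrightarrow> (\<forall>c\<in>charts M. smooth_on (cmap c ` (cdom c \<inter> U)) (\<lambda>x. s (cinv c x)))"

lemma smooth_fun_on_const: "smooth_fun_on M U (\<lambda>q. r)"
  by (simp add: smooth_fun_on_def smooth_on_const)

lemma smooth_fun_on_powr:
  assumes "smooth_manifold M" "open U" "smooth_fun_on M U s" "\<And>q. q \<in> U \<Longrightarrow> s q > 0"
  shows "smooth_fun_on M U (\<lambda>q. s q powr a)"
  unfolding smooth_fun_on_def
proof
  fix c assume c: "c \<in> charts M"
  show "smooth_on (cmap c ` (cdom c \<inter> U)) (\<lambda>x. s (cinv c x) powr a)"
    using assms c by (intro smooth_on_powr open_chart_image)
      (auto simp: smooth_fun_on_def cinv_cmap)
qed

text \<open>Makes positivity of a smooth function an open condition, on which the normalisation of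
  fields near a point rests.\<close>

lemma smooth_fun_on_imp_continuous_on:
  assumes M: "smooth_manifold M" and U: "open U" and s: "smooth_fun_on M U s"
  shows "continuous_on U s"
proof (rule continuous_at_imp_continuous_on, intro ballI)
  fix q assume q: "q \<in> U"
  let ?c = "chart_at M q"
  note c = chart_at_mem[OF M, of q]
  have "continuous_on (cmap ?c ` (cdom ?c \<inter> U)) (\<lambda>x. s (cinv ?c x))"
    using s c smooth_on_imp_continuous_on unfolding smooth_fun_on_def by blast
  moreover have "continuous_on (cdom ?c \<inter> U) (cmap ?c)"
    using chart_props(3)[OF M c(1)] by (meson Int_lower1 continuous_on_subset homeomorphism_def)
  ultimately have "continuous_on (cdom ?c \<inter> U) (\<lambda>q. s (cinv ?c (cmap ?c q)))"
    by (rule continuous_on_compose2) auto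
  then have "continuous_on (cdom ?c \<inter> U) s"
    by (rule continuous_on_eq) (auto simp: cinv_cmap[OF M c(1)])
  then show "isCont s q"
    using continuous_on_eq_continuous_at[of "cdom ?c \<inter> U"] chart_props(1)[OF M c(1)] U q c by blast
qed

lemma smooth_field_on_subset: "smooth_field_on M U X \<Longrightarrow> V \<subseteq> U \<Longrightarrow> smooth_field_on M V X"
  unfolding smooth_field_on_def by (meson Int_mono image_mono order_refl smooth_on_subset)

lemma smooth_field_on_add:
  assumes M: "smooth_manifold M" and U: "open U" and X: "smooth_field_on M U X" and Y: "smooth_field_on M U Y"
  shows "smooth_field_on M U (\<lambda>q. X q + Y q)"
  unfolding smooth_field_on_def
proof
  fix c assume c: "c \<in> charts M"
  note op = open_chart_image[OF M c U]
  show "smooth_on (cmap c ` (cdom c \<inter> U)) (\<lambda>x. to_chart M c (cinv c x) (X (cinv c x) + Y (cinv c x)))"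
  proof (rule smooth_on_cong[OF op])
    show "smooth_on (cmap c ` (cdom c \<inter> U)) (\<lambda>x. to_chart M c (cinv c x) (X (cinv c x)) + to_chart M c (cinv c x) (Y (cinv c x)))"
      using X Y c unfolding smooth_field_on_def by (intro smooth_on_add[OF op]) auto
  qed (metis cinv_mem(1)[OF _ M c] IntD1 linear_add[OF linear_to_chart[OF M c]])
qed

lemma smooth_field_on_scale:
  assumes M: "smooth_manifold M" and U: "open U" and s: "smooth_fun_on M U s" and X: "smooth_field_on M U X"
  shows "smooth_field_on M U (\<lambda>q. s q *\<^sub>R X q)"
  unfolding smooth_field_on_def
proof
  fix c assume c: "c \<in> charts M"
  note op = open_chart_image[OF M c U]
  show "smooth_on (cmap c ` (cdom c \<inter> U)) (\<lambda>x. to_chart M c (cinv c x) (s (cinv c x) *\<^sub>R X (cinv c x)))"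
  proof (rule smooth_on_cong[OF op])
    show "smooth_on (cmap c ` (cdom c \<inter> U)) (\<lambda>x. s (cinv c x) *\<^sub>R to_chart M c (cinv c x) (X (cinv c x)))"
      using s X c unfolding smooth_field_on_def smooth_fun_on_def by (intro smooth_on_scaleR[OF op]) auto
  qed (metis cinv_mem(1)[OF _ M c] IntD1 linear_scale[OF linear_to_chart[OF M c]])
qed

lemma smooth_field_on_zero:
  assumes M: "smooth_manifold M" and U: "open U"
  shows "smooth_field_on M U (\<lambda>q. 0)"
  unfolding smooth_field_on_def
proof
  fix c assume c: "c \<in> charts M"
  show "smooth_on (cmap c ` (cdom c \<inter> U)) (\<lambda>x. to_chart M c (cinv c x) 0)"
    by (rule smooth_on_cong[OF open_chart_image[OF M c U] _ smooth_on_const])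
      (use cinv_mem(1)[OF _ M c] linear_0[OF linear_to_chart[OF M c]] in auto)
qed

lemma smooth_field_on_sum:
  assumes M: "smooth_manifold M" and U: "open U" and "\<And>i. i \<in> I \<Longrightarrow> smooth_field_on M U (X i)"
  shows "smooth_field_on M U (\<lambda>q. \<Sum>i\<in>I. X i q)"
  using assms(3)
proof (induction I rule: infinite_finite_induct)
  case (insert i I)
  then show ?case by (simp add: smooth_field_on_add[OF M U, of "X i" "\<lambda>q. \<Sum>i\<in>I. X i q"])
qed (simp_all add: smooth_field_on_zero[OF M U])

lemma smooth_field_on_combination:
  assumes M: "smooth_manifold M" and U: "open U"
    and "\<And>i. i \<in> I \<Longrightarrow> smooth_fun_on M U (s i)" "\<And>i. i \<in> I \<Longrightarrow> smooth_field_on M U (X i)"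
  shows "smooth_field_on M U (\<lambda>q. \<Sum>i\<in>I. s i q *\<^sub>R X i q)"
  by (rule smooth_field_on_sum[OF M U], rule smooth_field_on_scale[OF M U assms(3,4)])

lemma smooth_field_on_diff:
  assumes M: "smooth_manifold M" and U: "open U" and X: "smooth_field_on M U X" and Y: "smooth_field_on M U Y"
  shows "smooth_field_on M U (\<lambda>q. X q - Y q)"
  using smooth_field_on_add[OF M U X smooth_field_on_scale[OF M U smooth_fun_on_const[of M U "-1"] Y]] by simp

text \<open>Fields with constant components supply local fields with a prescribed value at a point;
  projected into a bundle, they become the sections used throughout.\<close>

lemma smooth_field_on_coordinate:
  assumes M: "smooth_manifold M" and c: "c \<in> charts M"
  shows "smooth_field_on M (cdom c) (\<lambda>q. of_chart M c q w)"
  unfolding smooth_field_on_def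
proof
  fix d assume d: "d \<in> charts M"
  let ?S = "cmap d ` (cdom d \<inter> cdom c)" and ?T = "cmap c ` (cdom c \<inter> cdom d)"
  show "smooth_on ?S (\<lambda>x. to_chart M d (cinv d x) (of_chart M c (cinv d x) w))"
  proof (rule smooth_on_cong[OF open_chart_overlap[OF M d c]])
    show "smooth_on ?S (\<lambda>x. frechet_derivative (cmap d \<circ> cinv c) (at ((cmap c \<circ> cinv d) x)) w)"
    proof (rule smooth_on_compose[OF open_chart_overlap[OF M d c] open_chart_overlap[OF M c d], of "cmap c \<circ> cinv d"
          "\<lambda>y. frechet_derivative (cmap d \<circ> cinv c) (at y) w"])
      show "(cmap c \<circ> cinv d) ` ?S \<subseteq> ?T" by (auto simp: cinv_cmap[OF M d])
      show "smooth_on ?S (cmap c \<circ> cinv d)" "smooth_on ?T (\<lambda>y. frechet_derivative (cmap d \<circ> cinv c) (at y) w)"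
        using M c d by (auto simp: smooth_manifold_def intro!: smooth_on_frechet)
    qed
    show "frechet_derivative (cmap d \<circ> cinv c) (at ((cmap c \<circ> cinv d) y)) w = to_chart M d (cinv d y) (of_chart M c (cinv d y) w)"
      if "y \<in> ?S" for y
      using cinv_mem[OF that M d] by (simp add: to_chart_of_chart_transition[OF M c d])
  qed
qed


section \<open>The metric\<close>

lemma riemannian_manifoldD:
  assumes "riemannian_manifold M"
  shows "smooth_manifold M" "bilinear (met M p)" "met M p v w = met M p w v" "v \<noteq> 0 \<Longrightarrow> met M p v v > 0"
  using assms unfolding riemannian_manifold_def by auto

lemma met_eq_in_chart:
  assumes M: "smooth_manifold M" "c \<in> charts M" "p \<in> cdom c"
  shows "met M p v w = met_in_chart M c (cmap c p) (to_chart M c p v) (to_chart M c p w)"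
  by (simp add: met_in_chart_def cinv_cmap[OF M] of_chart_to_chart[OF M])

lemma bilinear_met_in_chart:
  assumes R: "riemannian_manifold M" and c: "c \<in> charts M" and x: "x \<in> cmap c ` cdom c"
  shows "bilinear (met_in_chart M c x)"
proof -
  note M = riemannian_manifoldD(1)[OF R]
  have "cinv c x \<in> cdom c" using x by (simp add: inv_into_into)
  note l = linear_of_chart[OF M c this]
  note b = riemannian_manifoldD(2)[OF R]
  show ?thesis
    unfolding bilinear_def met_in_chart_def
    by (intro conjI allI linearI)
      (simp_all add: linear_add[OF l] linear_scale[OF l] bilinear_ladd[OF b] bilinear_lmul[OF b]
        bilinear_radd[OF b] bilinear_rmul[OF b])
qed

text \<open>The base point is allowed to move by a map \<open>g\<close> so that the metric of
  \<open>N\<close> can be evaluated along \<open>F\<close>. The two vector arguments are handled one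
  after the other, each by linearity.\<close>

lemma smooth_on_met_in_chart:
  assumes R: "riemannian_manifold M" and c: "c \<in> charts M"
    and S: "open S" "g ` S \<subseteq> cmap c ` cdom c"
    and g: "smooth_on S g" and s: "smooth_on S s" and t: "smooth_on S t"
  shows "smooth_on S (\<lambda>x. met_in_chart M c (g x) (s x) (t x))"
proof -
  note M = riemannian_manifoldD(1)[OF R]
  have b: "bilinear (met_in_chart M c (g x))" if "x \<in> S" for x
    using that S(2) by (intro bilinear_met_in_chart[OF R c]) blast
  have 0: "smooth_on S (\<lambda>x. met_in_chart M c (g x) v w)" for v w
    using R c unfolding riemannian_manifold_def
    by (intro smooth_on_compose[OF S(1) chart_props(2)[OF M c] S(2) g, of "\<lambda>y. met_in_chart M c y v w"]) blast
  have "smooth_on S (\<lambda>x. met_in_chart M c (g x) v (t x))" for v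
    by (rule smooth_on_linear_apply[OF S(1) _ 0 t]) (use b in \<open>simp add: bilinear_def\<close>)
  then show ?thesis
    by (intro smooth_on_linear_apply[OF S(1) _ _ s, of "\<lambda>x v. met_in_chart M c (g x) v (t x)"])
      (use b in \<open>simp_all add: bilinear_def\<close>)
qed

lemma smooth_fun_on_met:
  assumes R: "riemannian_manifold M" and U: "open U" and X: "smooth_field_on M U X" and Y: "smooth_field_on M U Y"
  shows "smooth_fun_on M U (\<lambda>q. met M q (X q) (Y q))"
  unfolding smooth_fun_on_def
proof
  fix c assume c: "c \<in> charts M"
  note M = riemannian_manifoldD(1)[OF R]
  let ?S = "cmap c ` (cdom c \<inter> U)"
  note op = open_chart_image[OF M c U]
  show "smooth_on ?S (\<lambda>x. met M (cinv c x) (X (cinv c x)) (Y (cinv c x)))"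
  proof (rule smooth_on_cong[OF op])
    show "smooth_on ?S (\<lambda>x. met_in_chart M c ((\<lambda>x. x) x) (to_chart M c (cinv c x) (X (cinv c x)))
       (to_chart M c (cinv c x) (Y (cinv c x))))"
      using X Y c unfolding smooth_field_on_def
      by (intro smooth_on_met_in_chart[OF R c op _ smooth_on_ident]) auto
  qed (use cinv_mem[OF _ M c] in \<open>auto simp: met_eq_in_chart[OF M c]\<close>)
qed

lemma smooth_on_linear_derivative_apply:
  fixes f :: "'x::euclidean_space \<Rightarrow> 'y::euclidean_space"
  assumes "open S" "smooth_on S f" "smooth_on S s"
  shows "smooth_on S (\<lambda>x. frechet_derivative f (at x) (s x))"
  by (rule smooth_on_linear_apply[OF assms(1) _ smooth_on_frechet[OF assms(2)] assms(3)])
    (rule has_derivative_linear[OF smooth_on_has_derivative[OF assms(2,1)]])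

text \<open>These functions are the coefficients of the horizontal projection. A chart of
  \<open>N\<close> around \<open>F q\<close> covers only part of \<open>U\<close>, so smoothness is
  proved near each point and then glued.\<close>

lemma smooth_fun_on_met_differential:
  assumes RM: "riemannian_manifold M" and RN: "riemannian_manifold N" and F: "smooth_map M N F"
    and U: "open U" and X: "smooth_field_on M U X" and Y: "smooth_field_on M U Y"
  shows "smooth_fun_on M U (\<lambda>q. met N (F q) (differential M N F q (X q)) (differential M N F q (Y q)))"
  unfolding smooth_fun_on_def
proof
  fix c assume c: "c \<in> charts M"
  note M = riemannian_manifoldD(1)[OF RM] and N = riemannian_manifoldD(1)[OF RN]
  let ?S = "cmap c ` (cdom c \<inter> U)"
  let ?g = "\<lambda>x. met N (F (cinv c x)) (differential M N F (cinv c x) (X (cinv c x))) (differential M N F (cinv c x) (Y (cinv c x)))"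
  show "smooth_on ?S ?g"
  proof (rule smooth_on_local)
    fix x assume x: "x \<in> ?S"
    let ?d = "chart_at N (F (cinv c x))"
    note d = chart_at_mem[OF N, of "F (cinv c x)"]
    note FD = smooth_mapD[OF F M N c d(1)]
    let ?W = "cdom c \<inter> F -` cdom ?d \<inter> U" and ?f = "cmap ?d \<circ> F \<circ> cinv c"
    let ?T = "cmap c ` (cdom c \<inter> ?W)"
    have op: "open ?T" by (intro open_chart_image[OF M c] open_Int[OF FD(1) U])
    have f: "smooth_on ?T ?f" using FD(3) by (rule smooth_on_subset) auto
    have fld: "smooth_on ?T (\<lambda>y. to_chart M c (cinv c y) (Z (cinv c y)))" if "smooth_field_on M U Z" for Z
      using that c unfolding smooth_field_on_def by (blast intro: smooth_on_subset)
    have "smooth_on ?T ?g"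
    proof (rule smooth_on_cong[OF op])
      show "smooth_on ?T (\<lambda>y. met_in_chart N ?d (?f y)
         (frechet_derivative ?f (at y) (to_chart M c (cinv c y) (X (cinv c y))))
         (frechet_derivative ?f (at y) (to_chart M c (cinv c y) (Y (cinv c y)))))"
      proof (rule smooth_on_met_in_chart[OF RN d(1) op _ f])
        show "?f ` ?T \<subseteq> cmap ?d ` cdom ?d"
          by (auto simp: cinv_cmap[OF M c])
      qed (rule smooth_on_linear_derivative_apply[OF op f] fld X Y)+
    next
      fix y assume y: "y \<in> ?T"
      then have q: "cinv c y \<in> cdom c" "F (cinv c y) \<in> cdom ?d" "cmap c (cinv c y) = y"
        using cinv_mem[OF y M c] by auto
      show "met_in_chart N ?d (?f y)
         (frechet_derivative ?f (at y) (to_chart M c (cinv c y) (X (cinv c y))))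
         (frechet_derivative ?f (at y) (to_chart M c (cinv c y) (Y (cinv c y)))) = ?g y"
        unfolding met_eq_in_chart[OF N d(1) q(2)] to_chart_differential[OF F M c q(1) N d(1) q(2)] q(3)
        by simp
    qed
    moreover have "x \<in> ?T" using x d by (auto simp: cinv_cmap[OF M c])
    ultimately show "\<exists>T. open T \<and> x \<in> T \<and> smooth_on T ?g" using op by blast
  qed
qed

text \<open>\<open>almost_hermitian\<close> tests the smoothness of \<open>J\<close> on coordinate
  fields only; fibrewise linearity carries it to arbitrary fields.\<close>

lemma smooth_field_on_J:
  assumes J: "almost_hermitian M J" and U: "open U" and X: "smooth_field_on M U X"
  shows "smooth_field_on M U (\<lambda>q. J q (X q))"
  unfolding smooth_field_on_def
proof
  fix c assume c: "c \<in> charts M"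
  have M: "smooth_manifold M" and lin: "linear (J q)" for q
    using J by (auto simp: almost_hermitian_def riemannian_manifold_def)
  let ?S = "cmap c ` (cdom c \<inter> U)"
  note op = open_chart_image[OF M c U]
  let ?T = "\<lambda>x w. to_chart M c (cinv c x) (J (cinv c x) (of_chart M c (cinv c x) w))"
  show "smooth_on ?S (\<lambda>x. to_chart M c (cinv c x) (J (cinv c x) (X (cinv c x))))"
  proof (rule smooth_on_cong[OF op])
    show "smooth_on ?S (\<lambda>x. ?T x (to_chart M c (cinv c x) (X (cinv c x))))"
    proof (rule smooth_on_linear_apply[OF op, of ?T])
      show "linear (?T x)" if "x \<in> ?S" for x
      proof -
        have q: "cinv c x \<in> cdom c" using cinv_mem[OF that M c] by auto
        show ?thesis
          using linear_compose[OF linear_compose[OF linear_of_chart[OF M c q] lin] linear_to_chart[OF M c q]]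
          by (simp add: o_def)
      qed
      have "smooth_on (cmap c ` cdom c) (\<lambda>x. ?T x w)" for w
        using J c unfolding almost_hermitian_def field_in_chart_def[abs_def] by blast
      then show "smooth_on ?S (\<lambda>x. ?T x w)" for w by (rule smooth_on_subset) auto
      show "smooth_on ?S (\<lambda>x. to_chart M c (cinv c x) (X (cinv c x)))"
        using X c unfolding smooth_field_on_def by blast
    qed
  qed (use cinv_mem[OF _ M c] in \<open>auto simp: of_chart_to_chart[OF M c]\<close>)
qed


section \<open>Inner products on a Euclidean space\<close>

text \<open>The metric changes from point to point, so its linear algebra cannot use the inner
  product of the type class. The locale is interpreted at \<open>met M q\<close>, usually for all
  \<open>q\<close> at once.\<close>

locale inner_form =
  fixes h :: "'m::euclidean_space \<Rightarrow> 'm \<Rightarrow> real"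
  assumes bil: "bilinear h" and sym: "h v w = h w v" and pos: "v \<noteq> 0 \<Longrightarrow> h v v > 0"
begin

lemmas form_simps = bilinear_ladd[OF bil] bilinear_radd[OF bil] bilinear_lmul[OF bil] bilinear_rmul[OF bil]
  bilinear_lzero[OF bil] bilinear_rzero[OF bil] bilinear_lsub[OF bil] bilinear_rsub[OF bil]

lemma linear_right: "linear (h v)" and linear_left: "linear (\<lambda>v. h v w)"
  using bil by (auto simp: bilinear_def)

lemma sum_left: "h (\<Sum>i\<in>I. f i) w = (\<Sum>i\<in>I. h (f i) w)"
  and sum_right: "h w (\<Sum>i\<in>I. f i) = (\<Sum>i\<in>I. h w (f i))"
  by (rule linear_sum[OF linear_left], rule linear_sum[OF linear_right])

lemma zero_iff: "h v v = 0 \<longleftrightarrow> v = 0"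
  using pos[of v] by (cases "v = 0") (auto simp: form_simps)

text \<open>A family over an arbitrary index type, so that a disjoint sum of index sets can carry
  the union of the bases of several orthogonal subspaces.\<close>

definition orthonormal :: "'i set \<Rightarrow> ('i \<Rightarrow> 'm) \<Rightarrow> bool" where
  "orthonormal I e \<longleftrightarrow> (\<forall>i\<in>I. \<forall>j\<in>I. h (e i) (e j) = (if i = j then 1 else 0))"

lemma orthonormal_coeff:
  assumes "orthonormal I e" "finite I" "j \<in> I"
  shows "h (\<Sum>i\<in>I. a i *\<^sub>R e i) (e j) = a j"
proof -
  have "h (\<Sum>i\<in>I. a i *\<^sub>R e i) (e j) = (\<Sum>i\<in>I. a i * (if i = j then 1 else 0))"
    unfolding sum_left form_simps using assms by (intro sum.cong) (auto simp: orthonormal_def)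
  then show ?thesis using assms by (simp add: if_distrib cong: if_cong)
qed

lemma orthonormal_expand:
  assumes "orthonormal I e" "finite I" "v \<in> span (e ` I)"
  shows "v = (\<Sum>i\<in>I. h v (e i) *\<^sub>R e i)"
  using assms(3)
proof (induction rule: span_induct_alt)
  case base
  then show ?case by (simp add: form_simps)
next
  case (step c x y)
  then obtain j where j: "j \<in> I" "x = e j" by blast
  have "(\<Sum>i\<in>I. h (c *\<^sub>R x + y) (e i) *\<^sub>R e i)
      = c *\<^sub>R (\<Sum>i\<in>I. h (e j) (e i) *\<^sub>R e i) + (\<Sum>i\<in>I. h y (e i) *\<^sub>R e i)"
    by (simp add: form_simps j scaleR_add_left sum.distrib scaleR_sum_right)
  also have "(\<Sum>i\<in>I. h (e j) (e i) *\<^sub>R e i) = (\<Sum>i\<in>I. if j = i then e i else 0)"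
    using assms j by (intro sum.cong) (auto simp: orthonormal_def)
  also have "\<dots> = e j" using assms j by simp
  finally show ?case using step j by simp
qed

lemma orthonormal_independent:
  assumes "orthonormal I e" "finite I"
  shows "inj_on e I" "independent (e ` I)"
proof -
  show inj: "inj_on e I"
  proof (rule inj_onI)
    fix i j assume "i \<in> I" "j \<in> I" "e i = e j"
    then have "h (e i) (e j) = 1" using assms by (auto simp: orthonormal_def)
    then show "i = j" using \<open>i \<in> I\<close> \<open>j \<in> I\<close> assms by (auto simp: orthonormal_def split: if_splits)
  qed
  show "independent (e ` I)"
  proof (rule independent_if_scalars_zero)
    fix f x assume f: "(\<Sum>x\<in>e ` I. f x *\<^sub>R x) = 0" and "x \<in> e ` I"
    then obtain j where j: "j \<in> I" "x = e j" by blast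
    have "(\<Sum>i\<in>I. f (e i) *\<^sub>R e i) = 0" using f by (simp add: sum.reindex[OF inj])
    then show "f x = 0"
      using orthonormal_coeff[OF assms j(1), of "\<lambda>i. f (e i)"] j by (simp add: form_simps)
  qed (use assms in simp)
qed

lemma orthonormal_dim_span:
  assumes "orthonormal I e" "finite I"
  shows "dim (span (e ` I)) = card I"
  using orthonormal_independent[OF assms] by (simp add: dim_eq_card_independent card_image)

lemma orthonormal_card_le:
  assumes "orthonormal I e" "finite I" "e ` I \<subseteq> S" "subspace S"
  shows "card I \<le> dim S"
  using orthonormal_dim_span[OF assms(1,2)] assms(3,4) by (metis dim_subset span_minimal)

lemma orthonormal_span_eq:
  assumes "orthonormal I e" "finite I" "e ` I \<subseteq> S" "subspace S" "dim S = card I"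
  shows "span (e ` I) = S"
  using orthonormal_dim_span[OF assms(1,2)] assms(3-5)
  by (metis order_refl span_minimal subspace_dim_equal subspace_span)

lemma orthonormal_residual:
  assumes "orthonormal I e" "finite I" "j \<in> I"
  shows "h (v - (\<Sum>i\<in>I. h v (e i) *\<^sub>R e i)) (e j) = 0"
  using orthonormal_coeff[OF assms, of "\<lambda>i. h v (e i)"] by (simp add: form_simps)

text \<open>One Gram-Schmidt step: a vector of \<open>S\<close> outside the span has a nonzero
  residual, which stays in \<open>S\<close> and is orthogonal to the span.\<close>

lemma orthonormal_extend:
  assumes "orthonormal {..<k} e" "e ` {..<k} \<subseteq> S" "subspace S" "k < dim S"
  shows "\<exists>v\<in>S. (\<forall>i<k. h v (e i) = 0) \<and> h v v = 1"
proof -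
  have "span (e ` {..<k}) \<noteq> S"
    using orthonormal_dim_span[OF assms(1)] assms(4) by auto
  moreover have sub: "span (e ` {..<k}) \<subseteq> S" using assms by (simp add: span_minimal)
  ultimately obtain w where w: "w \<in> S" "w \<notin> span (e ` {..<k})" by blast
  define r where "r = w - (\<Sum>i<k. h w (e i) *\<^sub>R e i)"
  have s: "(\<Sum>i<k. h w (e i) *\<^sub>R e i) \<in> span (e ` {..<k})"
    by (intro span_sum span_scale span_base) auto
  then have r: "r \<in> S" "r \<noteq> 0"
    using w sub assms(3) unfolding r_def by (auto intro: subspace_diff)
  define v where "v = (h r r powr (-1/2)) *\<^sub>R r"
  have "h r r > 0" using pos[OF r(2)] .
  then have "h v v = 1"
    by (simp add: v_def form_simps powr_minus powr_half_sqrt field_simps)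
  moreover have "h v (e i) = 0" if "i < k" for i
    using orthonormal_residual[OF assms(1), of i w] that by (simp add: v_def r_def form_simps)
  moreover have "v \<in> S" using r assms(3) by (simp add: v_def subspace_scale)
  ultimately show ?thesis by blast
qed

lemma orthonormal_basis_exists:
  assumes "subspace S"
  obtains b where "orthonormal {..<dim S} b" "b ` {..<dim S} \<subseteq> S" "span (b ` {..<dim S}) = S"
proof -
  have "\<exists>b. orthonormal {..<k} b \<and> b ` {..<k} \<subseteq> S" if "k \<le> dim S" for k
    using that
  proof (induction k)
    case 0
    then show ?case by (simp add: orthonormal_def)
  next
    case (Suc k)
    then obtain b where b: "orthonormal {..<k} b" "b ` {..<k} \<subseteq> S" by auto
    obtain v where v: "v \<in> S" "\<forall>i<k. h v (b i) = 0" "h v v = 1"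
      using orthonormal_extend[OF b assms] Suc.prems by auto
    have "orthonormal {..<Suc k} (b(k := v)) \<and> (b(k := v)) ` {..<Suc k} \<subseteq> S"
      using b v sym by (auto simp: orthonormal_def less_Suc_eq)
    then show ?case by blast
  qed
  then obtain b where b: "orthonormal {..<dim S} b" "b ` {..<dim S} \<subseteq> S" by blast
  show ?thesis using that[OF b orthonormal_span_eq[OF b(1) _ b(2) assms]] by simp
qed

text \<open>Since both families span the same space, the coefficients \<open>h (e i) (f j)\<close>
  form an orthogonal matrix. Through this the frame hidden behind \<open>SOME\<close> in a trace can
  be exchanged for any convenient basis at the point.\<close>

lemma trace_independent:
  fixes B :: "'m \<Rightarrow> 'm \<Rightarrow> 'z::real_vector"
  assumes B: "bilinear B" and e: "orthonormal I e" "finite I" and f: "orthonormal J f" "finite J"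
    and eq: "span (e ` I) = span (f ` J)"
  shows "(\<Sum>i\<in>I. B (e i) (e i)) = (\<Sum>j\<in>J. B (f j) (f j))"
proof -
  have lB: "linear (B v)" "linear (\<lambda>v. B v w)" for v w using B by (auto simp: bilinear_def)
  have Be: "B (e i) (e i) = (\<Sum>j\<in>J. \<Sum>l\<in>J. (h (e i) (f j) * h (e i) (f l)) *\<^sub>R B (f j) (f l))" if "i \<in> I" for i
  proof -
    have "e i \<in> span (f ` J)" using that eq by (metis imageI span_base)
    from orthonormal_expand[OF f this] have ei: "e i = (\<Sum>j\<in>J. h (e i) (f j) *\<^sub>R f j)" .
    have "B (e i) (e i) = (\<Sum>j\<in>J. h (e i) (f j) *\<^sub>R B (f j) (e i))"
      by (subst (1) ei) (simp only: linear_sum[OF lB(2)] linear_scale[OF lB(2)])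
    also have "\<dots> = (\<Sum>j\<in>J. h (e i) (f j) *\<^sub>R (\<Sum>l\<in>J. h (e i) (f l) *\<^sub>R B (f j) (f l)))"
      by (subst (2) ei) (simp only: linear_sum[OF lB(1)] linear_scale[OF lB(1)])
    finally show ?thesis by (simp add: scaleR_sum_right)
  qed
  \<comment> \<open>Orthonormality of the columns: expand \<open>f j\<close> in the family
    \<open>e\<close> and pair it with \<open>f l\<close>.\<close>
  have par: "(\<Sum>i\<in>I. h (e i) (f j) * h (e i) (f l)) = (if j = l then 1 else 0)" if "j \<in> J" "l \<in> J" for j l
  proof -
    have "f j \<in> span (e ` I)" using that eq by (metis imageI span_base)
    from orthonormal_expand[OF e this] have "f j = (\<Sum>i\<in>I. h (f j) (e i) *\<^sub>R e i)" .
    then have "h (f j) (f l) = h (\<Sum>i\<in>I. h (f j) (e i) *\<^sub>R e i) (f l)" by (rule arg_cong)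
    also have "\<dots> = (\<Sum>i\<in>I. h (f j) (e i) * h (e i) (f l))"
      by (simp add: sum_left form_simps)
    finally have "h (f j) (f l) = (\<Sum>i\<in>I. h (f j) (e i) * h (e i) (f l))" .
    then show ?thesis using f that sym by (simp add: orthonormal_def)
  qed
  have "(\<Sum>i\<in>I. B (e i) (e i)) = (\<Sum>i\<in>I. \<Sum>j\<in>J. \<Sum>l\<in>J. (h (e i) (f j) * h (e i) (f l)) *\<^sub>R B (f j) (f l))"
    using Be by (rule sum.cong[OF refl])
  also have "\<dots> = (\<Sum>j\<in>J. \<Sum>l\<in>J. (\<Sum>i\<in>I. h (e i) (f j) * h (e i) (f l)) *\<^sub>R B (f j) (f l))"
    unfolding scaleR_sum_left by (subst sum.swap, rule sum.cong[OF refl], rule sum.swap)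
  also have "\<dots> = (\<Sum>j\<in>J. \<Sum>l\<in>J. if j = l then B (f j) (f l) else 0)"
    by (intro sum.cong refl) (simp add: par)
  also have "\<dots> = (\<Sum>j\<in>J. B (f j) (f j))"
    using f by (intro sum.cong refl) simp
  finally show ?thesis .
qed

end

lemma inner_form_met: "riemannian_manifold M \<Longrightarrow> inner_form (met M q)"
  by unfold_locales (auto dest: riemannian_manifoldD)

section \<open>Orthogonal complements\<close>

lemma subspace_orth_compl:
  assumes R: "riemannian_manifold M"
  shows "subspace (orth_compl M p S)"
proof -
  interpret inner_form "met M p" by (rule inner_form_met[OF R])
  show ?thesis by (auto simp: subspace_def orth_compl_def form_simps)
qed

lemma orth_compl_Int:
  assumes R: "riemannian_manifold M" and "v \<in> S" "v \<in> orth_compl M p S"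
  shows "v = 0"
proof -
  interpret inner_form "met M p" by (rule inner_form_met[OF R])
  show ?thesis using assms zero_iff by (auto simp: orth_compl_def)
qed

lemma orth_decomposition:
  assumes R: "riemannian_manifold M" and S: "subspace S"
  shows "\<exists>s\<in>S. v - s \<in> orth_compl M p S"
proof -
  interpret inner_form "met M p" by (rule inner_form_met[OF R])
  obtain b where b: "orthonormal {..<dim S} b" "b ` {..<dim S} \<subseteq> S" "span (b ` {..<dim S}) = S"
    using orthonormal_basis_exists[OF S] .
  let ?s = "\<Sum>i<dim S. met M p v (b i) *\<^sub>R b i"
  have "?s \<in> S" using b(2) S by (intro subspace_sum subspace_scale) auto
  moreover have "met M p (v - ?s) w = 0" if "w \<in> S" for w
  proof -
    have "w = (\<Sum>i<dim S. met M p w (b i) *\<^sub>R b i)"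
      using orthonormal_expand[OF b(1)] b(3) that by simp
    then have "met M p (v - ?s) w = met M p (v - ?s) (\<Sum>i<dim S. met M p w (b i) *\<^sub>R b i)"
      by (rule arg_cong)
    also have "\<dots> = (\<Sum>i<dim S. met M p w (b i) * met M p (v - ?s) (b i))"
      by (simp only: sum_right form_simps(4) real_scaleR_def)
    finally have "met M p (v - ?s) w = (\<Sum>i<dim S. met M p w (b i) * met M p (v - ?s) (b i))" .
    then show ?thesis using orthonormal_residual[OF b(1)] by simp
  qed
  ultimately show ?thesis by (auto simp: orth_compl_def)
qed

text \<open>For the inclusion into \<open>S\<close>, the component of \<open>v\<close> orthogonal to
  \<open>S\<close> lies in the complement and also in the complement of the complement, hence is
  zero.\<close>

lemma orth_compl_orth_compl:
  assumes R: "riemannian_manifold M" and S: "subspace S"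
  shows "orth_compl M p (orth_compl M p S) = S"
proof
  interpret inner_form "met M p" by (rule inner_form_met[OF R])
  show "S \<subseteq> orth_compl M p (orth_compl M p S)"
    using sym by (auto simp: orth_compl_def)
  show "orth_compl M p (orth_compl M p S) \<subseteq> S"
    proof
      fix v assume v: "v \<in> orth_compl M p (orth_compl M p S)"
      obtain s where s: "s \<in> S" "v - s \<in> orth_compl M p S" using orth_decomposition[OF R S] by blast
      have "s \<in> orth_compl M p (orth_compl M p S)" using s sym by (auto simp: orth_compl_def)
      then have "v - s \<in> orth_compl M p (orth_compl M p S)"
        using subspace_diff[OF subspace_orth_compl[OF R] v] by blast
      then have "v - s = 0" using orth_compl_Int[OF R s(2)] by simp
      then show "v \<in> S" using s by simp
    qed
qed

lemma dim_orth_compl_within: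
  assumes R: "riemannian_manifold M" and S: "subspace S" "subspace T" "S \<subseteq> T"
  shows "dim S + dim (T \<inter> orth_compl M p S) = dim T"
proof -
  let ?C = "T \<inter> orth_compl M p S"
  have C: "subspace ?C" using S subspace_orth_compl[OF R] by (simp add: subspace_Int subspace_inter)
  have "{x + y |x y. x \<in> S \<and> y \<in> ?C} = T"
  proof
    show "{x + y |x y. x \<in> S \<and> y \<in> ?C} \<subseteq> T" using S by (auto intro: subspace_add)
    show "T \<subseteq> {x + y |x y. x \<in> S \<and> y \<in> ?C}"
    proof
      fix v assume v: "v \<in> T"
      obtain s where s: "s \<in> S" "v - s \<in> orth_compl M p S" using orth_decomposition[OF R S(1)] by blast
      then have "v - s \<in> ?C" using v S by (auto intro: subspace_diff)
      moreover have "v = s + (v - s)" by simp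
      ultimately show "v \<in> {x + y |x y. x \<in> S \<and> y \<in> ?C}" using s(1) by blast
    qed
  qed
  moreover have "S \<inter> ?C = {0}"
    using orth_compl_Int[OF R] S(1) C subspace_0 by blast
  ultimately show ?thesis using dim_sums_Int[OF S(1) C] by simp
qed


section \<open>Smooth orthonormal frames\<close>

text \<open>Orthonormality at the single point \<open>p\<close> suffices, because a residual of
  positive length at \<open>p\<close> keeps positive length nearby and can be normalised there. The
  span clause keeps the new fields inside any bundle of subspaces that contains the old
  ones.\<close>

lemma local_gram_schmidt_ex:
  fixes k :: nat
  assumes R: "riemannian_manifold M" and U: "open U" "p \<in> U"
    and X: "\<And>i. i < k \<Longrightarrow> smooth_field_on M U (X i)"
    and on: "inner_form.orthonormal (met M p) {..<k} (\<lambda>i. X i p)"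
  shows "\<exists>V E. open V \<and> p \<in> V \<and> V \<subseteq> U \<and> (\<forall>i<k. smooth_field_on M V (E i) \<and> E i p = X i p) \<and>
    (\<forall>q\<in>V. inner_form.orthonormal (met M q) {..<k} (\<lambda>i. E i q) \<and>
       (\<forall>i<k. E i q \<in> span ((\<lambda>j. X j q) ` {..<k})))"
  using X on
proof (induction k)
  case 0
  then show ?case
    using U by (intro exI[of _ U]) (auto simp: inner_form.orthonormal_def[OF inner_form_met[OF R]])
next
  case (Suc k)
  note M = riemannian_manifoldD(1)[OF R]
  interpret h: inner_form "met M q" for q by (rule inner_form_met[OF R])
  have "h.orthonormal p {..<k} (\<lambda>i. X i p)"
    using Suc.prems(2) by (auto simp: h.orthonormal_def)
  have "\<exists>V E. open V \<and> p \<in> V \<and> V \<subseteq> U \<and> (\<forall>i<k. smooth_field_on M V (E i) \<and> E i p = X i p) \<and>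
    (\<forall>q\<in>V. h.orthonormal q {..<k} (\<lambda>i. E i q) \<and> (\<forall>i<k. E i q \<in> span ((\<lambda>j. X j q) ` {..<k})))"
    by (rule Suc.IH) (use Suc.prems(1) \<open>h.orthonormal p {..<k} (\<lambda>i. X i p)\<close> in auto)
  then obtain V E where V: "open V" "p \<in> V" "V \<subseteq> U"
    and E0: "\<forall>i<k. smooth_field_on M V (E i) \<and> E i p = X i p"
    and E1: "\<forall>q\<in>V. h.orthonormal q {..<k} (\<lambda>i. E i q) \<and> (\<forall>i<k. E i q \<in> span ((\<lambda>j. X j q) ` {..<k}))"
    by (elim exE conjE) (rule that)
  have E: "smooth_field_on M V (E i)" "E i p = X i p" if "i < k" for i
    using E0 that by auto
  have oE: "h.orthonormal q {..<k} (\<lambda>i. E i q)" if "q \<in> V" for q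
    using E1 that by blast
  have sE: "E i q \<in> span ((\<lambda>j. X j q) ` {..<k})" if "q \<in> V" "i < k" for q i
    using E1 that by blast
  have Xk: "smooth_field_on M V (X k)" using Suc.prems(1)[of k] V(3) smooth_field_on_subset by blast
  define Y where "Y = (\<lambda>q. X k q - (\<Sum>i<k. met M q (X k q) (E i q) *\<^sub>R E i q))"
  have Y: "smooth_field_on M V Y"
    unfolding Y_def
    by (rule smooth_field_on_diff[OF M V(1) Xk], rule smooth_field_on_combination[OF M V(1)])
      (auto intro: smooth_fun_on_met[OF R V(1) Xk] E)
  define s where "s = (\<lambda>q. met M q (Y q) (Y q))"
  have s: "smooth_fun_on M V s" unfolding s_def by (rule smooth_fun_on_met[OF R V(1) Y Y])
  define W where "W = {q \<in> V. s q > 0}"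
  have W: "open W" "W \<subseteq> V"
    using continuous_on_open_vimage[OF V(1), of s] smooth_fun_on_imp_continuous_on[OF M V(1) s]
    unfolding W_def by (auto simp: vimage_def Int_def conj_commute intro: open_greaterThan dest!: spec[of _ "{0<..}"])
  \<comment> \<open>At \<open>p\<close> the inner products with the earlier fields vanish, so
    nothing is subtracted there and the residual has length one.\<close>
  have "Y p = X k p"
    using Suc.prems(2) E(2) by (simp add: Y_def h.orthonormal_def)
  moreover have "met M p (X k p) (X k p) = 1" using Suc.prems(2) by (auto simp: h.orthonormal_def)
  ultimately have Yp: "s p = 1" "Y p = X k p" by (auto simp: s_def)
  then have pW: "p \<in> W" using V by (simp add: W_def)
  define e where "e = (\<lambda>q. (s q powr (-1/2)) *\<^sub>R Y q)"
  have e: "smooth_field_on M W e"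
    unfolding e_def
  proof (rule smooth_field_on_scale[OF M W(1)])
    have "smooth_fun_on M W s"
      using s W(2) unfolding smooth_fun_on_def by (meson Int_mono image_mono order_refl smooth_on_subset)
    then show "smooth_fun_on M W (\<lambda>q. s q powr (-1/2))"
      by (rule smooth_fun_on_powr[OF M W(1)]) (simp add: W_def)
    show "smooth_field_on M W Y" by (rule smooth_field_on_subset[OF Y W(2)])
  qed
  define E' where "E' = E(k := e)"
  have "smooth_field_on M W (E' i) \<and> E' i p = X i p" if "i < Suc k" for i
    using that e E smooth_field_on_subset[OF _ W(2)] Yp by (auto simp: E'_def less_Suc_eq e_def)
  moreover have "h.orthonormal q {..<Suc k} (\<lambda>i. E' i q)" if q: "q \<in> W" for q
  proof -
    have sq: "s q > 0" "q \<in> V" using q by (auto simp: W_def)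
    have ee: "met M q (e q) (e q) = 1"
      using sq(1) s_def[THEN fun_cong, of q, symmetric] by (simp add: e_def h.form_simps powr_minus powr_half_sqrt field_simps)
    have "met M q (Y q) (E i q) = 0" if "i < k" for i
      using h.orthonormal_residual[OF oE[OF sq(2)], of i "X k q"] that by (simp add: Y_def)
    then have "met M q (e q) (E i q) = 0" "met M q (E i q) (e q) = 0" if "i < k" for i
      using that h.sym by (simp_all add: e_def h.form_simps)
    then show ?thesis
      using oE[OF sq(2)] ee by (auto simp: h.orthonormal_def E'_def less_Suc_eq)
  qed
  moreover have "E' i q \<in> span ((\<lambda>j. X j q) ` {..<Suc k})" if q: "q \<in> W" and i: "i < Suc k" for q i
  proof -
    have sub: "span ((\<lambda>j. X j q) ` {..<k}) \<subseteq> span ((\<lambda>j. X j q) ` {..<Suc k})"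
      by (intro span_mono) auto
    have E: "E i q \<in> span ((\<lambda>j. X j q) ` {..<Suc k})" if "i < k" for i
      using sE[of q i] q W(2) that sub by blast
    have "e q \<in> span ((\<lambda>j. X j q) ` {..<Suc k})"
      unfolding e_def Y_def by (intro span_scale span_diff span_sum E span_base) auto
    then show ?thesis using E i by (auto simp: E'_def less_Suc_eq)
  qed
  ultimately show ?case using W V pW by (intro exI[of _ W] exI[of _ E']) blast
qed

lemma local_gram_schmidt:
  fixes k :: nat
  assumes "riemannian_manifold M" and "open U" "p \<in> U"
    and "\<And>i. i < k \<Longrightarrow> smooth_field_on M U (X i)"
    and "inner_form.orthonormal (met M p) {..<k} (\<lambda>i. X i p)"
  obtains V E where "open V" "p \<in> V" "V \<subseteq> U" "\<And>i. i < k \<Longrightarrow> smooth_field_on M V (E i)"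
    "\<And>q. q \<in> V \<Longrightarrow> inner_form.orthonormal (met M q) {..<k} (\<lambda>i. E i q)"
    "\<And>q i. q \<in> V \<Longrightarrow> i < k \<Longrightarrow> E i q \<in> span ((\<lambda>j. X j q) ` {..<k})"
  using local_gram_schmidt_ex[OF assms] by metis

text \<open>Smoothness of the projection is expressed by its action on local fields, which avoids
  operator-valued maps. The last clause makes \<open>P q\<close> the orthogonal projection onto
  \<open>E q\<close> when \<open>E q\<close> is a subspace; constancy of the rank is not part of the
  notion and is derived later by counting dimensions.\<close>

definition smooth_projection_near ::
    "('a::{t2_space, second_countable_topology}, 'm::euclidean_space) mfd \<Rightarrow> ('a \<Rightarrow> 'm set) \<Rightarrow> 'a \<Rightarrow> 'a set \<Rightarrow>
      ('a \<Rightarrow> 'm \<Rightarrow> 'm) \<Rightarrow> bool" where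
  "smooth_projection_near M E p V P \<longleftrightarrow> open V \<and> p \<in> V \<and>
     (\<forall>W X. open W \<and> W \<subseteq> V \<and> smooth_field_on M W X \<longrightarrow> smooth_field_on M W (\<lambda>q. P q (X q))) \<and>
     (\<forall>q\<in>V. \<forall>v. P q v \<in> E q \<and> v - P q v \<in> orth_compl M q (E q))"

lemma smooth_projection_nearD:
  assumes "smooth_projection_near M E p V P"
  shows "open V" "p \<in> V"
    "open W \<Longrightarrow> W \<subseteq> V \<Longrightarrow> smooth_field_on M W X \<Longrightarrow> smooth_field_on M W (\<lambda>q. P q (X q))"
    "q \<in> V \<Longrightarrow> P q v \<in> E q" "q \<in> V \<Longrightarrow> v - P q v \<in> orth_compl M q (E q)"
  using assms unfolding smooth_projection_near_def by auto

lemma smooth_projection_fixes: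
  assumes R: "riemannian_manifold M" and P: "smooth_projection_near M E p V P"
    and E: "subspace (E q)" and q: "q \<in> V" and v: "v \<in> E q"
  shows "P q v = v"
proof -
  have "v - P q v \<in> E q" using P E q v unfolding smooth_projection_near_def by (blast intro: subspace_diff)
  moreover have "v - P q v \<in> orth_compl M q (E q)" using P q unfolding smooth_projection_near_def by blast
  ultimately have "v - P q v = 0" by (rule orth_compl_Int[OF R])
  then show ?thesis by simp
qed

lemma chart_at_coordinate_field:
  assumes M: "smooth_manifold M"
  shows "of_chart M (chart_at M p) p w = w"
  using of_chart_to_chart[OF M chart_at_mem[OF M], of p] to_chart_chart_at[OF M] by metis

text \<open>Project a coordinate field with value \<open>v\<close> at \<open>p\<close>; the
  projection fixes \<open>v\<close>. Pointwise identities can then be tested on sections of the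
  bundle.\<close>

lemma section_through:
  assumes R: "riemannian_manifold M" and P: "smooth_projection_near M E p V P" and E: "subspace (E p)" and v: "v \<in> E p"
  obtains U Y where "open U" "p \<in> U" "smooth_field_on M U Y" "Y p = v" "\<And>q. q \<in> U \<Longrightarrow> Y q \<in> E q"
proof -
  note M = riemannian_manifoldD(1)[OF R] and PD = smooth_projection_nearD[OF P]
  let ?c = "chart_at M p"
  note c = chart_at_mem[OF M, of p]
  let ?U = "V \<inter> cdom ?c" and ?Y = "\<lambda>q. P q (of_chart M ?c q v)"
  have U: "open ?U" "p \<in> ?U" using PD(1,2) c chart_props(1)[OF M c(1)] by auto
  have "smooth_field_on M ?U ?Y"
    by (rule PD(3)[OF U(1)], simp, rule smooth_field_on_subset[OF smooth_field_on_coordinate[OF M c(1)]]) simp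
  moreover have "?Y p = v"
    by (simp add: chart_at_coordinate_field[OF M] smooth_projection_fixes[OF R P E PD(2) v])
  ultimately show ?thesis using that[of ?U ?Y] U PD(4) by blast
qed

text \<open>Coordinate fields through an orthonormal basis of \<open>E p\<close> are projected into
  \<open>E\<close> and then orthonormalised. At nearby points the result may fail to span
  \<open>E q\<close>: it bounds the dimension from below, and becomes a frame once the dimensions
  are known to agree.\<close>

lemma projection_sections:
  assumes R: "riemannian_manifold M" and P: "smooth_projection_near M E p V P" and E: "\<And>q. subspace (E q)"
  shows "\<exists>W e. open W \<and> p \<in> W \<and> (\<forall>i<dim (E p). smooth_field_on M W (e i)) \<and>
    (\<forall>q\<in>W. inner_form.orthonormal (met M q) {..<dim (E p)} (\<lambda>i. e i q) \<and> (\<lambda>i. e i q) ` {..<dim (E p)} \<subseteq> E q)"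
proof -
  note M = riemannian_manifoldD(1)[OF R]
  interpret h: inner_form "met M q" for q by (rule inner_form_met[OF R])
  let ?c = "chart_at M p"
  note c = chart_at_mem[OF M, of p]
  obtain b where b: "h.orthonormal p {..<dim (E p)} b" "b ` {..<dim (E p)} \<subseteq> E p"
    using h.orthonormal_basis_exists[OF E] by metis
  define X where "X = (\<lambda>i q. P q (of_chart M ?c q (b i)))"
  let ?U = "V \<inter> cdom ?c"
  have U: "open ?U" "p \<in> ?U" using smooth_projection_nearD(1,2)[OF P] c chart_props(1)[OF M c(1)] by auto
  have X: "smooth_field_on M ?U (X i)" for i
    unfolding X_def
    by (rule smooth_projection_nearD(3)[OF P U(1)], simp,
        rule smooth_field_on_subset[OF smooth_field_on_coordinate[OF M c(1)]]) simp
  have Xp: "X i p = b i" if "i < dim (E p)" for i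
    using smooth_projection_fixes[OF R P E] U(2) b(2) that
    by (auto simp: X_def chart_at_coordinate_field[OF M])
  have on0: "h.orthonormal p {..<dim (E p)} (\<lambda>i. X i p)"
    using b(1) by (simp add: h.orthonormal_def Xp)
  obtain W e where W: "open W" "p \<in> W" "W \<subseteq> ?U"
    and e: "\<And>i. i < dim (E p) \<Longrightarrow> smooth_field_on M W (e i)"
    and on: "\<And>q. q \<in> W \<Longrightarrow> h.orthonormal q {..<dim (E p)} (\<lambda>i. e i q)"
    and sp: "\<And>q i. q \<in> W \<Longrightarrow> i < dim (E p) \<Longrightarrow> e i q \<in> span ((\<lambda>j. X j q) ` {..<dim (E p)})"
    using local_gram_schmidt[OF R U X on0] by metis
  have "e i q \<in> E q" if q: "q \<in> W" and i: "i < dim (E p)" for q i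
  proof -
    have "(\<lambda>j. X j q) ` {..<dim (E p)} \<subseteq> E q"
      using q W(3) smooth_projection_nearD(4)[OF P] by (auto simp: X_def)
    then show ?thesis using sp[OF q i] span_minimal[OF _ E] by blast
  qed
  then show ?thesis using W e on by (intro exI[of _ W] exI[of _ e]) blast
qed

lemma projection_dim_ge:
  assumes R: "riemannian_manifold M" and P: "smooth_projection_near M E p V P" and E: "\<And>q. subspace (E q)"
  shows "\<exists>W. open W \<and> p \<in> W \<and> (\<forall>q\<in>W. dim (E p) \<le> dim (E q))"
proof -
  interpret h: inner_form "met M q" for q by (rule inner_form_met[OF R])
  show ?thesis
    using projection_sections[OF R P E] h.orthonormal_card_le[OF _ _ _ E] by (metis card_lessThan finite_lessThan)
qed

lemma orthonormal_frame_exists: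
  assumes R: "riemannian_manifold M" and P: "smooth_projection_near M E p V P" and E: "\<And>q. subspace (E q)"
    and W: "open W" "p \<in> W" "\<And>q. q \<in> W \<Longrightarrow> dim (E q) = dim (E p)"
  shows "\<exists>e. orthonormal_frame_near M E p e"
proof -
  interpret h: inner_form "met M q" for q by (rule inner_form_met[OF R])
  obtain W' e where W': "open W'" "p \<in> W'" and e: "\<And>i. i < dim (E p) \<Longrightarrow> smooth_field_on M W' (e i)"
    and on: "\<And>q. q \<in> W' \<Longrightarrow> h.orthonormal q {..<dim (E p)} (\<lambda>i. e i q)"
    and sp: "\<And>q. q \<in> W' \<Longrightarrow> (\<lambda>i. e i q) ` {..<dim (E p)} \<subseteq> E q"
    using projection_sections[OF R P E] by blast
  have "span ((\<lambda>i. e i q) ` {..<dim (E p)}) = E q" if "q \<in> W \<inter> W'" for q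
    using h.orthonormal_span_eq[OF on _ sp E, of q] that W(3) by simp
  then have "local_frame M E (W \<inter> W') (dim (E p)) e"
    using e W(3) unfolding local_frame_def by (auto intro: smooth_field_on_subset)
  moreover have "open (W \<inter> W')" "p \<in> W \<inter> W'" using W W' by auto
  ultimately show ?thesis
    using on unfolding orthonormal_frame_near_def h.orthonormal_def by (intro exI[of _ e] exI[of _ "W \<inter> W'"]) auto
qed

lemma orthonormal_frame_nearD:
  assumes "orthonormal_frame_near M E p e" "riemannian_manifold M"
  obtains U where "open U" "p \<in> U" "\<And>i. i < dim (E p) \<Longrightarrow> smooth_field_on M U (e i)"
    "\<And>q. q \<in> U \<Longrightarrow> span ((\<lambda>i. e i q) ` {..<dim (E p)}) = E q"
    "\<And>q. q \<in> U \<Longrightarrow> dim (E q) = dim (E p)"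
    "\<And>q. q \<in> U \<Longrightarrow> inner_form.orthonormal (met M q) {..<dim (E p)} (\<lambda>i. e i q)"
  using assms unfolding orthonormal_frame_near_def local_frame_def
    inner_form.orthonormal_def[OF inner_form_met[OF assms(2)]] by (metis lessThan_iff)

text \<open>The identity is the projection here, so the tangent bundle falls under the general
  construction.\<close>

lemma orthonormal_frame_UNIV:
  assumes R: "riemannian_manifold M"
  shows "\<exists>e. orthonormal_frame_near M (\<lambda>q. UNIV) p e"
proof (rule orthonormal_frame_exists[OF R, of _ _ UNIV "\<lambda>q v. v" UNIV])
  interpret h: inner_form "met M q" for q by (rule inner_form_met[OF R])
  show "smooth_projection_near M (\<lambda>q. UNIV) p UNIV (\<lambda>q v. v)"
    by (auto simp: smooth_projection_near_def orth_compl_def h.form_simps)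
qed auto

text \<open>Brings \<open>D1\<close>, which is given through frames, to the form shared with the
  bundles that are given only fibre by fibre.\<close>

lemma smooth_projection_from_orthonormal_frame:
  assumes R: "riemannian_manifold M" and e: "orthonormal_frame_near M E p e"
  shows "\<exists>V P. smooth_projection_near M E p V P"
proof -
  note M = riemannian_manifoldD(1)[OF R]
  interpret h: inner_form "met M q" for q by (rule inner_form_met[OF R])
  let ?k = "dim (E p)"
  from orthonormal_frame_nearD[OF e R] obtain U where U: "open U" "p \<in> U"
    "\<And>i. i < ?k \<Longrightarrow> smooth_field_on M U (e i)" "\<And>q. q \<in> U \<Longrightarrow> span ((\<lambda>i. e i q) ` {..<?k}) = E q"
    and on: "\<And>q. q \<in> U \<Longrightarrow> h.orthonormal q {..<?k} (\<lambda>i. e i q)" by metis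
  define P where "P = (\<lambda>q v. \<Sum>i<?k. met M q v (e i q) *\<^sub>R e i q)"
  have "smooth_field_on M W (\<lambda>q. P q (X q))" if W: "open W" "W \<subseteq> U" "smooth_field_on M W X" for W X
    unfolding P_def
    by (rule smooth_field_on_combination[OF M W(1)])
      (auto intro: smooth_fun_on_met[OF R W(1,3)] smooth_field_on_subset[OF U(3) W(2)])
  moreover have "P q v \<in> E q" if "q \<in> U" for q v
    unfolding P_def U(4)[OF that, symmetric] by (intro span_sum span_scale span_base) auto
  moreover have "v - P q v \<in> orth_compl M q (E q)" if q: "q \<in> U" for q v
    unfolding orth_compl_def
  proof (intro CollectI ballI)
    fix w assume "w \<in> E q"
    then have "w \<in> span ((\<lambda>i. e i q) ` {..<?k})" using U(4)[OF q] by simp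
    then show "met M q (v - P q v) w = 0"
    proof (induction rule: span_induct_alt)
      case base
      then show ?case by (simp add: h.form_simps)
    next
      case (step c x y)
      then obtain i where i: "i < ?k" "x = e i q" by auto
      have "met M q (v - P q v) x = 0"
        using h.orthonormal_residual[OF on[OF q], of i v] i by (simp add: P_def)
      then show ?case using step by (simp add: h.form_simps(2,4))
    qed
  qed
  ultimately show ?thesis
    using U(1,2) unfolding smooth_projection_near_def by (intro exI[of _ U] exI[of _ P]) blast
qed

section \<open>Orthonormal frames of a given distribution\<close>

lemma in_span_image_combination:
  assumes "v \<in> span (f ` I)" "finite I"
  shows "\<exists>a. v = (\<Sum>i\<in>I. a i *\<^sub>R f i)"
  using assms(1)
proof (induction rule: span_induct_alt)
  case base
  show ?case by (rule exI[of _ "\<lambda>i. 0"]) simp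
next
  case (step c x y)
  then obtain a j where a: "y = (\<Sum>i\<in>I. a i *\<^sub>R f i)" and j: "j \<in> I" "x = f j" by blast
  have "(\<Sum>i\<in>I. (a i + (if i = j then c else 0)) *\<^sub>R f i) = y + (\<Sum>i\<in>I. if i = j then c *\<^sub>R f i else 0)"
    unfolding a sum.distrib[symmetric] by (intro sum.cong) (auto simp: scaleR_add_left)
  also have "\<dots> = c *\<^sub>R x + y" using j assms(2) by simp
  finally show ?case by metis
qed

lemma distribution_subspace:
  assumes "distribution M D"
  shows "subspace (D q)"
proof -
  obtain U k e where "q \<in> U" "local_frame M D U k e" using assms unfolding distribution_def by blast
  then have "span ((\<lambda>i. e i q) ` {..<k}) = D q" by (auto simp: local_frame_def)
  then show ?thesis using subspace_span by metis
qed

text \<open>Combinations of the given frame with constant coefficients can be made orthonormal at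
  \<open>p\<close>; that is the starting point required by
  \<open>local_gram_schmidt\<close>.\<close>

lemma orthonormal_frame_distribution:
  assumes R: "riemannian_manifold M" and D: "distribution M D"
  shows "\<exists>e. orthonormal_frame_near M D p e"
proof -
  note M = riemannian_manifoldD(1)[OF R]
  interpret h: inner_form "met M q" for q by (rule inner_form_met[OF R])
  note sub = distribution_subspace[OF D]
  obtain U k f where U: "open U" "p \<in> U" and f: "local_frame M D U k f"
    using D unfolding distribution_def by blast
  have dim: "dim (D q) = k" if "q \<in> U" for q using f that by (auto simp: local_frame_def)
  obtain b where b: "h.orthonormal p {..<k} b" "b ` {..<k} \<subseteq> D p"
    using h.orthonormal_basis_exists[OF sub] dim[OF U(2)] by metis
  have "\<exists>a. b j = (\<Sum>i<k. a i *\<^sub>R f i p)" if "j < k" for j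
    using b(2) f U that by (intro in_span_image_combination) (auto simp: local_frame_def)
  then obtain a where a: "\<And>j. j < k \<Longrightarrow> b j = (\<Sum>i<k. a j i *\<^sub>R f i p)" by metis
  define X where "X = (\<lambda>j q. \<Sum>i<k. a j i *\<^sub>R f i q)"
  have X: "smooth_field_on M U (X j)" for j
    unfolding X_def
    by (rule smooth_field_on_combination[OF M U(1) smooth_fun_on_const]) (use f in \<open>auto simp: local_frame_def\<close>)
  have on0: "h.orthonormal p {..<k} (\<lambda>i. X i p)"
    using b(1) a by (simp add: h.orthonormal_def X_def)
  obtain W e where W: "open W" "p \<in> W" "W \<subseteq> U"
    and e: "\<And>i. i < k \<Longrightarrow> smooth_field_on M W (e i)"
    and on: "\<And>q. q \<in> W \<Longrightarrow> h.orthonormal q {..<k} (\<lambda>i. e i q)"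
    and sp: "\<And>q i. q \<in> W \<Longrightarrow> i < k \<Longrightarrow> e i q \<in> span ((\<lambda>j. X j q) ` {..<k})"
    using local_gram_schmidt[OF R U X on0] by metis
  have eD: "e i q \<in> D q" if q: "q \<in> W" and i: "i < k" for q i
  proof -
    have "(\<lambda>j. X j q) ` {..<k} \<subseteq> span ((\<lambda>i. f i q) ` {..<k})"
      unfolding X_def by (auto intro!: span_sum span_scale intro: span_base)
    also have "\<dots> = D q" using f q W by (auto simp: local_frame_def)
    finally show ?thesis using sp[OF q i] span_minimal[OF _ sub] by blast
  qed
  have "span ((\<lambda>i. e i q) ` {..<k}) = D q" if "q \<in> W" for q
    by (rule h.orthonormal_span_eq[OF on[OF that] _ _ sub])
      (use eD that dim W(3) in \<open>auto simp: subset_iff\<close>)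
  then have "local_frame M D W k e" using e dim W unfolding local_frame_def by blast
  then show ?thesis
    using on W dim[OF U(2)] unfolding orthonormal_frame_near_def h.orthonormal_def
    by (intro exI[of _ e] exI[of _ W]) auto
qed


section \<open>Constant rank of Riemannian maps\<close>

lemma riemannian_mapD:
  assumes "riemannian_map M N F"
  shows "riemannian_manifold M" "riemannian_manifold N" "smooth_map M N F" "linear (differential M N F p)"
    "v \<in> horizontal M N F p \<Longrightarrow> w \<in> horizontal M N F p \<Longrightarrow>
      met N (F p) (differential M N F p v) (differential M N F p w) = met M p v w"
proof -
  show F: "riemannian_manifold M" "riemannian_manifold N" "smooth_map M N F"
    using assms by (auto simp: riemannian_map_def)
  show "linear (differential M N F p)"
    by (rule linear_differential[OF F(3) riemannian_manifoldD(1)[OF F(1)] riemannian_manifoldD(1)[OF F(2)]])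
  show "met N (F p) (differential M N F p v) (differential M N F p w) = met M p v w"
    if "v \<in> horizontal M N F p" "w \<in> horizontal M N F p"
    using assms that by (simp add: riemannian_map_def)
qed

lemma subspace_ker_diff: "riemannian_map M N F \<Longrightarrow> subspace (ker_diff M N F p)"
  using linear_subspace_kernel[OF riemannian_mapD(4)] unfolding ker_diff_def by blast

lemma subspace_horizontal: "riemannian_map M N F \<Longrightarrow> subspace (horizontal M N F p)"
  unfolding horizontal_def by (rule subspace_orth_compl[OF riemannian_mapD(1)])

lemma orth_compl_horizontal:
  "riemannian_map M N F \<Longrightarrow> orth_compl M p (horizontal M N F p) = ker_diff M N F p"
  unfolding horizontal_def by (intro orth_compl_orth_compl riemannian_mapD subspace_ker_diff)

text \<open>One horizontal argument is enough: the kernel component of \<open>v\<close> is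
  annihilated by \<open>F\<^sub>*\<close> on the left and is orthogonal to \<open>w\<close> on the
  right.\<close>

lemma differential_isometry_horizontal:
  assumes F: "riemannian_map M N F" and w: "w \<in> horizontal M N F p"
  shows "met N (F p) (differential M N F p v) (differential M N F p w) = met M p v w"
proof -
  interpret h: inner_form "met M p" by (rule inner_form_met[OF riemannian_mapD(1)[OF F]])
  obtain s where s: "s \<in> ker_diff M N F p" "v - s \<in> horizontal M N F p"
    using orth_decomposition[OF riemannian_mapD(1)[OF F] subspace_ker_diff[OF F]]
    unfolding horizontal_def by blast
  have "differential M N F p v = differential M N F p (v - s)"
    using s(1) by (simp add: linear_diff[OF riemannian_mapD(4)[OF F]] ker_diff_def)
  moreover have "met M p s w = 0"
    using s(1) w h.sym[of s w] by (auto simp: horizontal_def orth_compl_def)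
  ultimately show ?thesis
    using riemannian_mapD(5)[OF F s(2) w] by (simp add: h.form_simps)
qed

text \<open>The horizontal projection is \<open>F\<^sub>*\<^sup>T F\<^sub>*\<close>, hence smooth.\<close>

lemma horizontal_projection:
  fixes M :: "('a::{t2_space, second_countable_topology}, 'm::euclidean_space) mfd"
  assumes F: "riemannian_map M N F"
  shows "\<exists>V P. smooth_projection_near M (horizontal M N F) p V P"
proof -
  note RM = riemannian_mapD(1)[OF F] and RN = riemannian_mapD(2)[OF F] and dF = riemannian_mapD(4)[OF F]
  note M = riemannian_manifoldD(1)[OF RM]
  interpret h: inner_form "met M q" for q by (rule inner_form_met[OF RM])
  interpret g: inner_form "met N q" for q by (rule inner_form_met[OF RN])
  let ?k = "dim (UNIV :: 'm set)" and ?d = "differential M N F"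
  obtain e where "orthonormal_frame_near M (\<lambda>q. UNIV) p e" using orthonormal_frame_UNIV[OF RM] by blast
  from orthonormal_frame_nearD[OF this RM] obtain U where U: "open U" "p \<in> U"
    and e: "\<And>i. i < ?k \<Longrightarrow> smooth_field_on M U (e i)"
    and sp: "\<And>q. q \<in> U \<Longrightarrow> span ((\<lambda>i. e i q) ` {..<?k}) = UNIV"
    and on: "\<And>q. q \<in> U \<Longrightarrow> h.orthonormal q {..<?k} (\<lambda>i. e i q)" by metis
  define P where "P = (\<lambda>q v. \<Sum>i<?k. met N (F q) (?d q v) (?d q (e i q)) *\<^sub>R e i q)"
  \<comment> \<open>Adjointness of \<open>P\<close>. For \<open>w\<close> in the kernel it shows
    that \<open>P q v\<close> is horizontal; for \<open>w\<close> horizontal, combined with the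
    isometry property, it shows that \<open>v - P q v\<close> is orthogonal to
    \<open>w\<close>.\<close>
  have P: "met M q (P q v) w = met N (F q) (?d q v) (?d q w)" if q: "q \<in> U" for q v w
  proof -
    have "w = (\<Sum>i<?k. met M q w (e i q) *\<^sub>R e i q)"
      by (rule h.orthonormal_expand[OF on[OF q]]) (use sp[OF q] in simp_all)
    then have "?d q w = ?d q (\<Sum>i<?k. met M q w (e i q) *\<^sub>R e i q)" by (rule arg_cong)
    also have "\<dots> = (\<Sum>i<?k. met M q w (e i q) *\<^sub>R ?d q (e i q))"
      by (simp only: linear_sum[OF dF] linear_scale[OF dF])
    finally have "met N (F q) (?d q v) (?d q w) = met N (F q) (?d q v) (\<Sum>i<?k. met M q w (e i q) *\<^sub>R ?d q (e i q))"
      by (rule arg_cong)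
    also have "\<dots> = (\<Sum>i<?k. met M q w (e i q) * met N (F q) (?d q v) (?d q (e i q)))"
      by (simp add: g.sum_right g.form_simps)
    also have "\<dots> = met M q (P q v) w"
      unfolding P_def h.sum_left h.form_simps by (intro sum.cong) (simp_all add: h.sym[of _ w])
    finally show ?thesis by simp
  qed
  have "smooth_field_on M W (\<lambda>q. P q (X q))" if W: "open W" "W \<subseteq> U" "smooth_field_on M W X" for W X
    unfolding P_def
  proof (rule smooth_field_on_combination[OF M W(1)])
    fix i assume "i \<in> {..<?k}"
    then show ei: "smooth_field_on M W (e i)" using smooth_field_on_subset[OF e W(2)] by simp
    show "smooth_fun_on M W (\<lambda>q. met N (F q) (?d q (X q)) (?d q (e i q)))"
      by (rule smooth_fun_on_met_differential[OF RM RN riemannian_mapD(3)[OF F] W(1,3) ei])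
  qed
  moreover have "P q v \<in> horizontal M N F q" if "q \<in> U" for q v
    using P[OF that] by (auto simp: horizontal_def orth_compl_def ker_diff_def g.form_simps)
  moreover have "v - P q v \<in> orth_compl M q (horizontal M N F q)" if "q \<in> U" for q v
    using P[OF that] by (auto simp: orth_compl_def[of M q "horizontal M N F q"] h.form_simps differential_isometry_horizontal[OF F])
  ultimately show ?thesis
    using U unfolding smooth_projection_near_def by (intro exI[of _ U] exI[of _ P]) blast
qed

section \<open>Smoothness and constant rank of \<open>D2\<close> and of the horizontal
  bundle\<close>

context
  fixes M :: "('a::{t2_space, second_countable_topology}, 'm::euclidean_space) mfd"
    and N :: "('b::{t2_space, second_countable_topology}, 'n::euclidean_space) mfd"
    and F D1 D2
  assumes F: "riemannian_map M N F" and D1: "distribution M D1" and D1_ker: "\<And>q. D1 q \<subseteq> ker_diff M N F q"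
    and D2: "\<And>q. D2 q = ker_diff M N F q \<inter> orth_compl M q (D1 q)"
begin

lemma subspace_complement_in_kernel: "subspace (D2 q)"
  unfolding D2 by (intro subspace_inter subspace_ker_diff[OF F] subspace_orth_compl[OF riemannian_mapD(1)[OF F]])

text \<open>The horizontal space, \<open>D1\<close> and \<open>D2\<close> are mutually orthogonal
  and span the tangent space, so subtracting the two projections already available from the identity
  leaves the third.\<close>

lemma complement_in_kernel_projection: "\<exists>V P. smooth_projection_near M D2 p V P"
proof -
  note RM = riemannian_mapD(1)[OF F]
  note M = riemannian_manifoldD(1)[OF RM]
  interpret h: inner_form "met M q" for q by (rule inner_form_met[OF RM])
  obtain V P where P: "smooth_projection_near M (horizontal M N F) p V P" using horizontal_projection[OF F] by blast
  obtain V' P' where P': "smooth_projection_near M D1 p V' P'"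
    using smooth_projection_from_orthonormal_frame[OF RM] orthonormal_frame_distribution[OF RM D1] by blast
  note PD = smooth_projection_nearD[OF P] and PD' = smooth_projection_nearD[OF P']
  define Q where "Q = (\<lambda>q v. v - (P q v + P' q v))"
  have "smooth_field_on M W (\<lambda>q. Q q (X q))" if W: "open W" "W \<subseteq> V \<inter> V'" "smooth_field_on M W X" for W X
    unfolding Q_def
    by (rule smooth_field_on_diff[OF M W(1,3)], rule smooth_field_on_add[OF M W(1)])
      (use W in \<open>auto intro!: PD(3) PD'(3)\<close>)
  moreover have "Q q v \<in> D2 q \<and> v - Q q v \<in> orth_compl M q (D2 q)" if q: "q \<in> V" "q \<in> V'" for q v
  proof -
    have a: "v - P q v \<in> ker_diff M N F q" using PD(5)[OF q(1)] orth_compl_horizontal[OF F] by blast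
    have b: "P' q v \<in> ker_diff M N F q" using PD'(4)[OF q(2)] D1_ker by blast
    have "(v - P q v) - P' q v \<in> ker_diff M N F q" by (rule subspace_diff[OF subspace_ker_diff[OF F] a b])
    then have 1: "Q q v \<in> ker_diff M N F q" by (simp add: Q_def algebra_simps)
    have c: "P q v \<in> orth_compl M q (ker_diff M N F q)" using PD(4)[OF q(1)] by (simp add: horizontal_def)
    then have d: "P q v \<in> orth_compl M q (D1 q)" using D1_ker by (auto simp: orth_compl_def)
    have "(v - P' q v) - P q v \<in> orth_compl M q (D1 q)"
      by (rule subspace_diff[OF subspace_orth_compl[OF RM] PD'(5)[OF q(2)] d])
    then have 2: "Q q v \<in> orth_compl M q (D1 q)" by (simp add: Q_def algebra_simps)
    have "P q v \<in> orth_compl M q (D2 q)" using c by (auto simp: D2 orth_compl_def)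
    moreover have "P' q v \<in> orth_compl M q (D2 q)"
      using PD'(4)[OF q(2), of v] h.sym by (auto simp: D2 orth_compl_def)
    ultimately have "P q v + P' q v \<in> orth_compl M q (D2 q)" by (rule subspace_add[OF subspace_orth_compl[OF RM]])
    then show ?thesis using 1 2 by (simp add: Q_def D2 add.commute)
  qed
  ultimately show ?thesis
    using PD PD' unfolding smooth_projection_near_def
    by (intro exI[of _ "V \<inter> V'"] exI[of _ Q]) auto
qed

lemma dim_tangent_decomposition:
  "dim (D1 q) + dim (D2 q) + dim (horizontal M N F q) = dim (UNIV :: 'm set)"
proof -
  note RM = riemannian_mapD(1)[OF F]
  have "dim (D1 q) + dim (D2 q) = dim (ker_diff M N F q)"
    unfolding D2 by (rule dim_orth_compl_within[OF RM distribution_subspace[OF D1] subspace_ker_diff[OF F] D1_ker])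
  moreover have "dim (ker_diff M N F q) + dim (horizontal M N F q) = dim (UNIV :: 'm set)"
    using dim_orth_compl_within[OF RM subspace_ker_diff[OF F] subspace_UNIV] by (simp add: horizontal_def)
  ultimately show ?thesis by simp
qed

text \<open>The three dimensions are lower semicontinuous and have constant sum.\<close>

lemma kernel_frames_exist:
  "\<exists>e. orthonormal_frame_near M D2 p e" "\<exists>e. orthonormal_frame_near M (horizontal M N F) p e"
proof -
  note RM = riemannian_mapD(1)[OF F]
  obtain V P where P: "smooth_projection_near M (horizontal M N F) p V P" using horizontal_projection[OF F] by blast
  obtain V1 P1 where P1: "smooth_projection_near M D1 p V1 P1"
    using smooth_projection_from_orthonormal_frame[OF RM] orthonormal_frame_distribution[OF RM D1] by blast
  obtain V2 P2 where P2: "smooth_projection_near M D2 p V2 P2" using complement_in_kernel_projection by blast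
  obtain W where W: "open W" "p \<in> W" "\<And>q. q \<in> W \<Longrightarrow> dim (horizontal M N F p) \<le> dim (horizontal M N F q)"
    using projection_dim_ge[OF RM P subspace_horizontal[OF F]] by blast
  obtain W1 where W1: "open W1" "p \<in> W1" "\<And>q. q \<in> W1 \<Longrightarrow> dim (D1 p) \<le> dim (D1 q)"
    using projection_dim_ge[OF RM P1 distribution_subspace[OF D1]] by blast
  obtain W2 where W2: "open W2" "p \<in> W2" "\<And>q. q \<in> W2 \<Longrightarrow> dim (D2 p) \<le> dim (D2 q)"
    using projection_dim_ge[OF RM P2 subspace_complement_in_kernel] by blast
  let ?W = "W \<inter> W1 \<inter> W2"
  have op: "open ?W" "p \<in> ?W" using W W1 W2 by auto
  have dims: "dim (D2 q) = dim (D2 p)" "dim (horizontal M N F q) = dim (horizontal M N F p)" if "q \<in> ?W" for q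
    using that W(3)[of q] W1(3)[of q] W2(3)[of q] dim_tangent_decomposition[of q] dim_tangent_decomposition[of p] by auto
  show "\<exists>e. orthonormal_frame_near M D2 p e"
    by (rule orthonormal_frame_exists[OF RM P2 subspace_complement_in_kernel op dims(1)])
  show "\<exists>e. orthonormal_frame_near M (horizontal M N F) p e"
    by (rule orthonormal_frame_exists[OF RM P subspace_horizontal[OF F] op dims(2)])
qed

end

section \<open>The second fundamental form is a tensor\<close>

lemma levi_civita_form:
  assumes R: "riemannian_manifold M" and c: "c \<in> charts M" and x: "x \<in> cmap c ` cdom c"
  shows "bilinear (levi_civita_form M c x)" "levi_civita_form M c x u v = levi_civita_form M c x v u"
    "frechet_derivative (\<lambda>y. met_in_chart M c y v w) (at x) u =
        met_in_chart M c x (levi_civita_form M c x u v) w + met_in_chart M c x v (levi_civita_form M c x u w)"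
proof -
  have "is_levi_civita_form M c x (levi_civita_form M c x)"
    unfolding levi_civita_form_def by (rule theI'[OF ex1_levi_civita_form[OF R c x]])
  then show "bilinear (levi_civita_form M c x)" "levi_civita_form M c x u v = levi_civita_form M c x v u"
    "frechet_derivative (\<lambda>y. met_in_chart M c y v w) (at x) u =
        met_in_chart M c x (levi_civita_form M c x u v) w + met_in_chart M c x v (levi_civita_form M c x u w)"
    unfolding is_levi_civita_form_def by blast+
qed

text \<open>Metricity for vector fields along a map \<open>g\<close>. It is used with
  \<open>g\<close> the identity on \<open>M\<close>, with \<open>F\<close> in coordinates for the
  metric of \<open>N\<close>, and with the parametrization of an integral manifold.\<close>

lemma has_derivative_met_in_chart:
  fixes g :: "'x::euclidean_space \<Rightarrow> 'n::euclidean_space"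
  assumes R: "riemannian_manifold N" and d: "d \<in> charts N"
    and S: "open S" "x \<in> S" "\<And>y. y \<in> S \<Longrightarrow> g y \<in> cmap d ` cdom d"
    and g: "(g has_derivative g') (at x)" and s: "(s has_derivative s') (at x)" and t: "(t has_derivative t') (at x)"
  defines "G \<equiv> levi_civita_form N d (g x)"
  shows "((\<lambda>y. met_in_chart N d (g y) (s y) (t y)) has_derivative
    (\<lambda>u. met_in_chart N d (g x) (s' u + G (g' u) (s x)) (t x) + met_in_chart N d (g x) (s x) (t' u + G (g' u) (t x)))) (at x)"
proof -
  note N = riemannian_manifoldD(1)[OF R]
  let ?h = "met_in_chart N d"
  have bil: "bilinear (?h (g y))" if "y \<in> S" for y by (rule bilinear_met_in_chart[OF R d S(3)[OF that]])
  have gx: "g x \<in> cmap d ` cdom d" by (rule S(3)[OF S(2)])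
  have 0: "((\<lambda>y. ?h (g y) v w) has_derivative (\<lambda>u. ?h (g x) (G (g' u) v) w + ?h (g x) v (G (g' u) w))) (at x)" for v w
  proof -
    have "smooth_on (cmap d ` cdom d) (\<lambda>y. ?h y v w)"
      using R d unfolding riemannian_manifold_def by blast
    from smooth_on_has_derivative[OF this chart_props(2)[OF N d] gx]
    have "((\<lambda>y. ?h y v w) has_derivative (\<lambda>u. ?h (g x) (G u v) w + ?h (g x) v (G u w))) (at (g x))"
      unfolding G_def levi_civita_form(3)[OF R d gx, symmetric] .
    from diff_chain_at[OF g this] show ?thesis by (simp add: o_def)
  qed
  have lin: "linear (?h (g y) v)" "linear (\<lambda>v. ?h (g y) v w)" if "y \<in> S" for y v w
    using bil[OF that] by (auto simp: bilinear_def)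
  have 1: "((\<lambda>y. ?h (g y) v (t y)) has_derivative
      (\<lambda>u. (?h (g x) (G (g' u) v) (t x) + ?h (g x) v (G (g' u) (t x))) + ?h (g x) v (t' u))) (at x)" for v
    by (rule has_derivative_linear_apply[of S x "\<lambda>y w. ?h (g y) v w"
          "\<lambda>u w. ?h (g x) (G (g' u) v) w + ?h (g x) v (G (g' u) w)" t t', OF S(1,2) lin(1) 0 t])
  have "((\<lambda>y. ?h (g y) (s y) (t y)) has_derivative
      (\<lambda>u. (?h (g x) (G (g' u) (s x)) (t x) + ?h (g x) (s x) (G (g' u) (t x)) + ?h (g x) (s x) (t' u)) + ?h (g x) (s' u) (t x))) (at x)"
    by (rule has_derivative_linear_apply[of S x "\<lambda>y v. ?h (g y) v (t y)"
          "\<lambda>u v. ?h (g x) (G (g' u) v) (t x) + ?h (g x) v (G (g' u) (t x)) + ?h (g x) v (t' u)" s s',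
          OF S(1,2) lin(2) 1 s])
  then show ?thesis
    by (rule has_derivative_eq_rhs) (simp add: fun_eq_iff bilinear_ladd[OF bil[OF S(2)]] bilinear_radd[OF bil[OF S(2)]] algebra_simps)
qed

lemma smooth_on_field_in_chart:
  assumes "smooth_field_on M U X" "c \<in> charts M"
  shows "smooth_on (cmap c ` (cdom c \<inter> U)) (field_in_chart M c X)"
  using assms unfolding smooth_field_on_def field_in_chart_def[abs_def] by blast

lemma field_in_chart_at:
  assumes "smooth_manifold M"
  shows "field_in_chart M (chart_at M p) X (cmap (chart_at M p) p) = X p"
  by (simp add: field_in_chart_def cinv_cmap[OF assms chart_at_mem[OF assms]] to_chart_chart_at[OF assms])

lemma field_in_chart_has_derivative:
  assumes M: "smooth_manifold M" and U: "open U" "p \<in> U" and X: "smooth_field_on M U X"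
  defines "c \<equiv> chart_at M p"
  shows "(field_in_chart M c X has_derivative frechet_derivative (field_in_chart M c X) (at (cmap c p))) (at (cmap c p))"
  unfolding c_def
  by (rule smooth_on_has_derivative[OF smooth_on_field_in_chart[OF X chart_at_mem(1)[OF M]]
        open_chart_image[OF M chart_at_mem(1)[OF M] U(1)]])
    (use U chart_at_mem[OF M] in auto)

text \<open>The classical coordinate expression: the Hessian of \<open>F\<close>, plus the
  connection form of \<open>N\<close> on the images, minus the image of the connection form of
  \<open>M\<close>. It takes vectors at \<open>p\<close> instead of fields, so its tensorial nature
  is built in.\<close>

definition sff_tensor ::
    "('a::{t2_space, second_countable_topology}, 'm::euclidean_space) mfd \<Rightarrow>
     ('b::{t2_space, second_countable_topology}, 'n::euclidean_space) mfd \<Rightarrow> ('a \<Rightarrow> 'b) \<Rightarrow> 'a \<Rightarrow> 'm \<Rightarrow> 'm \<Rightarrow> 'n" where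
  "sff_tensor M N F p u v =
     (let c = chart_at M p; d = chart_at N (F p); f = cmap d \<circ> F \<circ> cinv c; x = cmap c p in
       frechet_derivative (\<lambda>y. frechet_derivative f (at y) v) (at x) u
       + levi_civita_form N d (cmap d (F p)) (differential M N F p u) (differential M N F p v)
       - differential M N F p (levi_civita_form M c x u v))"

context
  fixes M :: "('a::{t2_space, second_countable_topology}, 'm::euclidean_space) mfd"
    and N :: "('b::{t2_space, second_countable_topology}, 'n::euclidean_space) mfd"
    and F :: "'a \<Rightarrow> 'b"
  assumes RM: "riemannian_manifold M" and RN: "riemannian_manifold N" and F: "smooth_map M N F"
begin

private lemma M: "smooth_manifold M" and N: "smooth_manifold N"
  using riemannian_manifoldD(1) RM RN by auto

private lemma local_rep:
  fixes p
  defines "c \<equiv> chart_at M p" and "d \<equiv> chart_at N (F p)"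
  shows "open (cmap c ` (cdom c \<inter> F -` cdom d))" "cmap c p \<in> cmap c ` (cdom c \<inter> F -` cdom d)"
    "smooth_on (cmap c ` (cdom c \<inter> F -` cdom d)) (cmap d \<circ> F \<circ> cinv c)"
  unfolding c_def d_def
  using smooth_mapD[OF F M N chart_at_mem(1)[OF M] chart_at_mem(1)[OF N]] chart_at_mem[OF M] chart_at_mem[OF N]
  by auto

text \<open>Each of the three terms is symmetric: the first as a second derivative, the other two
  because the connections are torsion free.\<close>

lemma sff_tensor_symmetric: "sff_tensor M N F p u v = sff_tensor M N F p v u"
  unfolding sff_tensor_def Let_def
  by (intro arg_cong2[of _ _ _ _ "(-)"] arg_cong2[of _ _ _ _ "(+)"] arg_cong[of _ _ "differential M N F p"]
      second_derivative_symmetric[OF local_rep]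
      levi_civita_form(2)[OF RM chart_at_mem(1)[OF M] imageI[OF chart_at_mem(2)[OF M]]]
      levi_civita_form(2)[OF RN chart_at_mem(1)[OF N] imageI[OF chart_at_mem(2)[OF N]]])

lemma bilinear_sff_tensor: "bilinear (sff_tensor M N F p)"
proof -
  let ?c = "chart_at M p" and ?d = "chart_at N (F p)"
  note dF = linear_differential[OF F M N]
  have GM: "linear (\<lambda>u. levi_civita_form M ?c (cmap ?c p) u v)" for v
    using levi_civita_form(1)[OF RM chart_at_mem(1)[OF M] imageI[OF chart_at_mem(2)[OF M]]] by (simp add: bilinear_def)
  have GN: "linear (\<lambda>u. levi_civita_form N ?d (cmap ?d (F p)) u v)" for v
    using levi_civita_form(1)[OF RN chart_at_mem(1)[OF N] imageI[OF chart_at_mem(2)[OF N]]] by (simp add: bilinear_def)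
  have D2: "linear (frechet_derivative (\<lambda>y. frechet_derivative (cmap ?d \<circ> F \<circ> cinv ?c) (at y) v) (at (cmap ?c p)))" for v
    by (rule has_derivative_linear[OF smooth_on_has_derivative[OF smooth_on_frechet[OF local_rep(3)] local_rep(1,2)]])
  have left: "linear (\<lambda>u. sff_tensor M N F p u v)" for v
    unfolding sff_tensor_def Let_def
    using linear_compose_sub[OF linear_compose_add[OF D2[of v] linear_compose[OF dF GN]] linear_compose[OF GM dF]]
    by (simp add: o_def)
  moreover have "sff_tensor M N F p u = (\<lambda>v. sff_tensor M N F p v u)" for u
    using sff_tensor_symmetric by blast
  ultimately show ?thesis unfolding bilinear_def by metis
qed

text \<open>In fixed charts \<open>F\<^sub>* Y\<close> is the Jacobian applied to the components of
  \<open>Y\<close>; the product rule yields the Hessian term and the image of the derivative of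
  \<open>Y\<close>.\<close>

lemma pullback_has_derivative:
  assumes U: "open U" "p \<in> U" and Y: "smooth_field_on M U Y"
  defines "c \<equiv> chart_at M p" and "d \<equiv> chart_at N (F p)"
  shows "((\<lambda>x. to_chart N d (F (cinv c x)) (differential M N F (cinv c x) (Y (cinv c x)))) has_derivative
    (\<lambda>u. frechet_derivative (\<lambda>y. frechet_derivative (cmap d \<circ> F \<circ> cinv c) (at y) (Y p)) (at (cmap c p)) u
       + differential M N F p (frechet_derivative (field_in_chart M c Y) (at (cmap c p)) u))) (at (cmap c p))"
proof -
  let ?f = "cmap d \<circ> F \<circ> cinv c" and ?S = "cmap c ` (cdom c \<inter> F -` cdom d)"
  note cm = chart_at_mem[OF M, of p, folded c_def] and dm = chart_at_mem[OF N, of "F p", folded d_def]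
  note f = local_rep[of p, folded c_def d_def]
  note lin = has_derivative_linear[OF smooth_on_has_derivative[OF f(3,1)]]
  have dd: "((\<lambda>y. frechet_derivative ?f (at y) w) has_derivative
      (\<lambda>u. frechet_derivative (\<lambda>y. frechet_derivative ?f (at y) w) (at (cmap c p)) u)) (at (cmap c p))" for w
    by (rule smooth_on_has_derivative[OF smooth_on_frechet[OF f(3)] f(1,2)])
  have dY: "(field_in_chart M c Y has_derivative frechet_derivative (field_in_chart M c Y) (at (cmap c p))) (at (cmap c p))"
    unfolding c_def by (rule field_in_chart_has_derivative[OF M U Y])
  have Yp: "field_in_chart M c Y (cmap c p) = Y p" unfolding c_def by (rule field_in_chart_at[OF M])
  have df: "differential M N F p = frechet_derivative ?f (at (cmap c p))"
    by (simp add: differential_def[abs_def] c_def d_def)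
  have "((\<lambda>x. frechet_derivative ?f (at x) (field_in_chart M c Y x)) has_derivative
    (\<lambda>u. frechet_derivative (\<lambda>y. frechet_derivative ?f (at y) (Y p)) (at (cmap c p)) u
       + differential M N F p (frechet_derivative (field_in_chart M c Y) (at (cmap c p)) u))) (at (cmap c p))"
    using has_derivative_linear_apply[of ?S "cmap c p" "\<lambda>x w. frechet_derivative ?f (at x) w"
        "\<lambda>u w. frechet_derivative (\<lambda>y. frechet_derivative ?f (at y) w) (at (cmap c p)) u",
        OF f(1,2) lin dd dY] unfolding Yp df .
  then show ?thesis
  proof (rule has_derivative_transform_within_open[OF _ f(1,2)])
    fix x assume x: "x \<in> ?S"
    then have q: "cinv c x \<in> cdom c" "F (cinv c x) \<in> cdom d" "cmap c (cinv c x) = x"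
      using cinv_mem[OF x M cm(1)] by auto
    show "frechet_derivative ?f (at x) (field_in_chart M c Y x)
        = to_chart N d (F (cinv c x)) (differential M N F (cinv c x) (Y (cinv c x)))"
      unfolding to_chart_differential[OF F M cm(1) q(1) N dm(1) q(2)] q(3) field_in_chart_def ..
  qed
qed

text \<open>All derivatives of \<open>Y\<close> are collected in the image of
  \<open>\<nabla>Y\<close>; the connection form of \<open>M\<close> contained in it cancels against
  the last term of \<open>sff_tensor\<close>.\<close>

lemma pullback_cov_deriv_differential:
  assumes U: "open U" "p \<in> U" and Y: "smooth_field_on M U Y"
  shows "pullback_cov_deriv M N F p u (\<lambda>q. differential M N F q (Y q))
    = sff_tensor M N F p u (Y p) + differential M N F p (cov_deriv M p u Y)"
  unfolding pullback_cov_deriv_def sff_tensor_def cov_deriv_def Let_def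
    frechet_derivative_at[OF pullback_has_derivative[OF U Y], symmetric]
  by (simp add: linear_add[OF linear_differential[OF F M N]])

lemma second_fund_form_eq_sff_tensor:
  assumes U: "open U" "p \<in> U" and Y: "smooth_field_on M U Y"
  shows "second_fund_form M N F X Y p = sff_tensor M N F p (X p) (Y p)"
  unfolding second_fund_form_def pullback_cov_deriv_differential[OF U Y] by simp

text \<open>Metricity of the two connections, applied to \<open>g\<^sub>N(F\<^sub>* Y, F\<^sub>* Z) = g\<^sub>M(Y, Z)\<close>.\<close>

lemma metric_derivatives_agree:
  assumes U: "open U" "p \<in> U" and Y: "smooth_field_on M U Y" and Z: "smooth_field_on M U Z"
    and eq: "\<And>q. q \<in> U \<Longrightarrow> met N (F q) (differential M N F q (Y q)) (differential M N F q (Z q)) = met M q (Y q) (Z q)"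
  shows "met N (F p) (pullback_cov_deriv M N F p u (\<lambda>q. differential M N F q (Y q))) (differential M N F p (Z p))
      + met N (F p) (differential M N F p (Y p)) (pullback_cov_deriv M N F p u (\<lambda>q. differential M N F q (Z q)))
    = met M p (cov_deriv M p u Y) (Z p) + met M p (Y p) (cov_deriv M p u Z)"
proof -
  define c where "c = chart_at M p"
  define d where "d = chart_at N (F p)"
  define f where "f = cmap d \<circ> F \<circ> cinv c"
  define S where "S = cmap c ` (cdom c \<inter> (F -` cdom d \<inter> U))"
  note cm = chart_at_mem[OF M, of p, folded c_def] and dm = chart_at_mem[OF N, of "F p", folded d_def]
  have "open (cdom c \<inter> F -` cdom d \<inter> U)" using smooth_mapD(1)[OF F M N cm(1) dm(1)] U(1) by blast
  from open_chart_image[OF M cm(1) this] have S: "open S" "cmap c p \<in> S"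
    using cm dm U by (auto simp: S_def Int_assoc)
  have pp: "cinv c (cmap c p) = p" by (rule cinv_cmap[OF M cm])
  have fx: "f (cmap c p) = cmap d (F p)" by (simp add: f_def pp)
  have fS: "f y \<in> cmap d ` cdom d" if "y \<in> S" for y
    using cinv_mem[OF that[unfolded S_def] M cm(1)] by (simp add: f_def)
  note lr = local_rep[of p, folded c_def d_def, folded f_def]
  note df = smooth_on_has_derivative[OF lr(3,1,2)]
  have diff: "differential M N F p = frechet_derivative f (at (cmap c p))"
    by (simp add: differential_def[abs_def] c_def d_def f_def)
  let ?s = "\<lambda>Y x. to_chart N d (F (cinv c x)) (differential M N F (cinv c x) (Y (cinv c x)))"
  have s: "(?s W has_derivative frechet_derivative (?s W) (at (cmap c p))) (at (cmap c p))" if "smooth_field_on M U W" for W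
    using pullback_has_derivative[OF U that, folded c_def d_def] frechet_derivative_works differentiableI by blast
  have sp: "?s W (cmap c p) = differential M N F p (W p)" for W
    by (simp add: pp) (simp add: d_def to_chart_chart_at[OF N])
  have y: "(field_in_chart M c W has_derivative frechet_derivative (field_in_chart M c W) (at (cmap c p))) (at (cmap c p))"
    if "smooth_field_on M U W" for W
    unfolding c_def by (rule field_in_chart_has_derivative[OF M U that])
  have yp: "field_in_chart M c W (cmap c p) = W p" for W unfolding c_def by (rule field_in_chart_at[OF M])
  have metN: "met_in_chart N d (cmap d (F p)) v w = met N (F p) v w" for v w
    using met_eq_in_chart[OF N dm, of v w] by (simp add: d_def to_chart_chart_at[OF N])
  have metM: "met_in_chart M c (cmap c p) v w = met M p v w" for v w
    using met_eq_in_chart[OF M cm, of v w] by (simp add: c_def to_chart_chart_at[OF M])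
  have pb: "frechet_derivative (?s W) (at (cmap c p)) u
      + levi_civita_form N d (cmap d (F p)) (frechet_derivative f (at (cmap c p)) u) (differential M N F p (W p))
      = pullback_cov_deriv M N F p u (\<lambda>q. differential M N F q (W q))" for W
    by (simp add: pullback_cov_deriv_def Let_def c_def[symmetric] d_def[symmetric] diff)
  have cv: "frechet_derivative (field_in_chart M c W) (at (cmap c p)) u + levi_civita_form M c (cmap c p) u (W p)
      = cov_deriv M p u W" for W
    by (simp add: cov_deriv_def Let_def c_def[symmetric])
  \<comment> \<open>The same function is differentiated twice: here with the connection of
    \<open>N\<close> along \<open>f\<close>, below with that of \<open>M\<close> along the identity.
    The hypothesis \<open>eq\<close> identifies the two functions on \<open>S\<close>.\<close>
  note dN = has_derivative_met_in_chart[OF RN dm(1) S fS df s[OF Y] s[OF Z], unfolded fx sp metN]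
  have "((\<lambda>x. met_in_chart M c x (field_in_chart M c Y x) (field_in_chart M c Z x)) has_derivative
     (\<lambda>u. met_in_chart M c (cmap c p) (frechet_derivative (field_in_chart M c Y) (at (cmap c p)) u
           + levi_civita_form M c (cmap c p) u (field_in_chart M c Y (cmap c p))) (field_in_chart M c Z (cmap c p))
        + met_in_chart M c (cmap c p) (field_in_chart M c Y (cmap c p)) (frechet_derivative (field_in_chart M c Z) (at (cmap c p)) u
           + levi_civita_form M c (cmap c p) u (field_in_chart M c Z (cmap c p))))) (at (cmap c p))"
    by (rule has_derivative_met_in_chart[OF RM cm(1) S _ has_derivative_ident y[OF Y] y[OF Z]]) (auto simp: S_def)
  note dM = this[unfolded yp metM]
  have "((\<lambda>x. met_in_chart N d (f x) (?s Y x) (?s Z x)) has_derivative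
      (\<lambda>u. met M p (frechet_derivative (field_in_chart M c Y) (at (cmap c p)) u
           + levi_civita_form M c (cmap c p) u (Y p)) (Z p)
        + met M p (Y p) (frechet_derivative (field_in_chart M c Z) (at (cmap c p)) u
           + levi_civita_form M c (cmap c p) u (Z p)))) (at (cmap c p))"
  proof (rule has_derivative_transform_within_open[OF dM S])
    fix x assume x: "x \<in> S"
    then have q: "cinv c x \<in> cdom c" "F (cinv c x) \<in> cdom d" "cinv c x \<in> U" "cmap c (cinv c x) = x"
      using cinv_mem[OF x[unfolded S_def] M cm(1)] by auto
    show "met_in_chart M c x (field_in_chart M c Y x) (field_in_chart M c Z x) = met_in_chart N d (f x) (?s Y x) (?s Z x)"
      using eq[OF q(3)] unfolding met_eq_in_chart[OF N dm(1) q(2)] met_eq_in_chart[OF M cm(1) q(1)] q(4) field_in_chart_def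
      by (simp add: f_def)
  qed
  from fun_cong[OF has_derivative_unique[OF dN this], of u] show ?thesis
    by (simp only: pb cv)
qed

end


section \<open>Values of the second fundamental form\<close>

text \<open>For horizontal sections through \<open>v\<close> and \<open>w\<close>, the images of
  their covariant derivatives pair with \<open>F\<^sub>* w\<close> and \<open>F\<^sub>* v\<close>
  exactly as the covariant derivatives do in \<open>M\<close>. These terms cancel in
  \<open>metric_derivatives_agree\<close>, leaving only the tensor.\<close>

lemma sff_tensor_antisymmetric:
  assumes F: "riemannian_map M N F" and v: "v \<in> horizontal M N F p" and w: "w \<in> horizontal M N F p"
  shows "met N (F p) (sff_tensor M N F p u v) (differential M N F p w)
    = - met N (F p) (sff_tensor M N F p u w) (differential M N F p v)"
proof -
  note RM = riemannian_mapD(1)[OF F] and RN = riemannian_mapD(2)[OF F] and sF = riemannian_mapD(3)[OF F]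
  interpret h: inner_form "met M p" by (rule inner_form_met[OF RM])
  interpret g: inner_form "met N (F p)" by (rule inner_form_met[OF RN])
  obtain V P where P: "smooth_projection_near M (horizontal M N F) p V P" using horizontal_projection[OF F] by blast
  obtain U1 Y where Y: "open U1" "p \<in> U1" "smooth_field_on M U1 Y" "Y p = v" "\<And>q. q \<in> U1 \<Longrightarrow> Y q \<in> horizontal M N F q"
    by (rule section_through[OF RM P subspace_horizontal[OF F] v]) (rule that)
  obtain U2 Z where Z: "open U2" "p \<in> U2" "smooth_field_on M U2 Z" "Z p = w" "\<And>q. q \<in> U2 \<Longrightarrow> Z q \<in> horizontal M N F q"
    by (rule section_through[OF RM P subspace_horizontal[OF F] w]) (rule that)
  let ?U = "U1 \<inter> U2"
  have U: "open ?U" "p \<in> ?U" using Y(1,2) Z(1,2) by auto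
  have sY: "smooth_field_on M ?U Y" and sZ: "smooth_field_on M ?U Z"
    using Y(3) Z(3) by (auto intro: smooth_field_on_subset)
  have "met N (F q) (differential M N F q (Y q)) (differential M N F q (Z q)) = met M q (Y q) (Z q)" if "q \<in> ?U" for q
    using that by (intro differential_isometry_horizontal[OF F] Z(5)) simp
  note * = metric_derivatives_agree[OF RM RN sF U sY sZ this, of u,
      unfolded pullback_cov_deriv_differential[OF RM RN sF U sY] pullback_cov_deriv_differential[OF RM RN sF U sZ] Y(4) Z(4)]
  have "met N (F p) (differential M N F p v) (differential M N F p (cov_deriv M p u Z)) = met M p v (cov_deriv M p u Z)"
    unfolding g.sym[of "differential M N F p v"] differential_isometry_horizontal[OF F v] by (rule h.sym)
  with * show ?thesis
    using differential_isometry_horizontal[OF F w, of "cov_deriv M p u Y"] g.sym[of "sff_tensor M N F p u w"]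
    by (simp add: g.form_simps)
qed

text \<open>A trilinear form symmetric in its first two and antisymmetric in its last two arguments vanishes.\<close>

lemma sff_tensor_horizontal_perp_range:
  assumes F: "riemannian_map M N F" and u: "u \<in> horizontal M N F p" and v: "v \<in> horizontal M N F p"
  shows "sff_tensor M N F p u v \<in> orth_compl N (F p) (range_diff M N F p)"
proof -
  note RM = riemannian_mapD(1)[OF F] and RN = riemannian_mapD(2)[OF F] and sF = riemannian_mapD(3)[OF F]
  define C where "C = (\<lambda>u v w. met N (F p) (sff_tensor M N F p u v) (differential M N F p w))"
  have sym: "C a b w = C b a w" for a b w
    unfolding C_def by (subst sff_tensor_symmetric[OF RM RN sF]) (rule refl)
  have anti: "C a b w = - C a w b" if "b \<in> horizontal M N F p" "w \<in> horizontal M N F p" for a b w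
    unfolding C_def by (rule sff_tensor_antisymmetric[OF F that])
  \<comment> \<open>Alternating the two symmetries gives \<open>C u v w = - C u w v = - C w u v = C
    w v u = C v w u = - C v u w = - C u v w\<close>.\<close>
  have 0: "C u v w = 0" if w: "w \<in> horizontal M N F p" for w
    using anti[OF v w, of u] sym[of u w v] anti[OF u v, of w] sym[of w v u] anti[OF w u, of v] sym[of v u w] by linarith
  have "C u v w = 0" for w
  proof -
    obtain s where s: "s \<in> ker_diff M N F p" "w - s \<in> horizontal M N F p"
      using orth_decomposition[OF RM subspace_ker_diff[OF F]] unfolding horizontal_def by blast
    have "differential M N F p w = differential M N F p (w - s)"
      using s(1) by (simp add: linear_diff[OF riemannian_mapD(4)[OF F]] ker_diff_def)
    then show ?thesis using 0[OF s(2)] by (simp add: C_def)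
  qed
  then show ?thesis by (auto simp: orth_compl_def range_diff_def C_def)
qed

text \<open>\<open>F\<^sub>* Y\<close> vanishes on a neighbourhood of \<open>p\<close>, hence so
  does its pullback derivative at \<open>p\<close>, and only the image of \<open>\<nabla>Y\<close>
  remains.\<close>

lemma sff_tensor_kernel_section:
  assumes RM: "riemannian_manifold M" and RN: "riemannian_manifold N" and F: "smooth_map M N F"
    and U: "open U" "p \<in> U" and Y: "smooth_field_on M U Y" and ker: "\<And>q. q \<in> U \<Longrightarrow> Y q \<in> ker_diff M N F q"
  shows "sff_tensor M N F p v (Y p) = - differential M N F p (cov_deriv M p v Y)"
proof -
  note M = riemannian_manifoldD(1)[OF RM] and N = riemannian_manifoldD(1)[OF RN]
  let ?c = "chart_at M p" and ?d = "chart_at N (F p)"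
  note c = chart_at_mem[OF M, of p] and d = chart_at_mem[OF N, of "F p"]
  note FD = smooth_mapD[OF F M N c(1) d(1)]
  let ?S = "cmap ?c ` (cdom ?c \<inter> (F -` cdom ?d \<inter> U))"
  have "open (cdom ?c \<inter> F -` cdom ?d \<inter> U)" using FD(1) U(1) by blast
  from open_chart_image[OF M c(1) this] have S: "open ?S" by (simp add: Int_assoc)
  have pS: "cmap ?c p \<in> ?S" using c d U by auto
  have "frechet_derivative (\<lambda>x. to_chart N ?d (F (cinv ?c x)) (differential M N F (cinv ?c x) (Y (cinv ?c x)))) (at (cmap ?c p))
     = frechet_derivative (\<lambda>x. 0) (at (cmap ?c p))"
  proof (rule frechet_derivative_cong_open[OF S pS])
    fix x assume x: "x \<in> ?S"
    have q: "cinv ?c x \<in> U" "F (cinv ?c x) \<in> cdom ?d" using cinv_mem[OF x M c(1)] by auto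
    show "to_chart N ?d (F (cinv ?c x)) (differential M N F (cinv ?c x) (Y (cinv ?c x))) = 0"
      using ker[OF q(1)] linear_0[OF linear_to_chart[OF N d(1) q(2)]] by (simp add: ker_diff_def)
  qed
  moreover have "differential M N F p (Y p) = 0" using ker[OF U(2)] by (simp add: ker_diff_def)
  moreover have "levi_civita_form N ?d (cmap ?d (F p)) w 0 = 0" for w
    by (rule bilinear_rzero[OF levi_civita_form(1)[OF RN d(1) imageI[OF d(2)]]])
  ultimately have "pullback_cov_deriv M N F p v (\<lambda>q. differential M N F q (Y q)) = 0"
    by (simp add: pullback_cov_deriv_def Let_def)
  then show ?thesis
    using pullback_cov_deriv_differential[OF RM RN F U Y, of v] by (simp add: eq_neg_iff_add_eq_0)
qed


section \<open>Integrable distributions\<close>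

text \<open>Restrict to the line \<open>x + t *\<^sub>R a\<close>, which stays in \<open>V\<close>.
  In directions outside \<open>V\<close> nothing is known, since the integral manifold is
  parametrized by \<open>V\<close> alone.\<close>

lemma has_derivative_vanishes_along_subspace:
  fixes r :: "'x::euclidean_space \<Rightarrow> 'y::real_normed_vector"
  assumes r: "(r has_derivative r') (at x)" and S: "open S" "x \<in> S" and V: "subspace V" "x \<in> V" "a \<in> V"
    and 0: "\<And>y. y \<in> S \<Longrightarrow> y \<in> V \<Longrightarrow> r y = 0"
  shows "r' a = 0"
proof -
  let ?l = "\<lambda>t::real. x + t *\<^sub>R a"
  have l: "(?l has_derivative (\<lambda>t. t *\<^sub>R a)) (at 0)" by (auto intro!: derivative_eq_intros)
  have "(r has_derivative r') (at (?l 0))" using r by simp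
  from diff_chain_at[OF l this] have 1: "((\<lambda>t. r (?l t)) has_derivative (\<lambda>t. r' (t *\<^sub>R a))) (at 0)"
    by (simp add: o_def)
  have "continuous_on UNIV ?l" by (intro continuous_intros)
  then have op: "open (?l -` S)" using S(1) by (simp add: continuous_on_open_vimage)
  have "((\<lambda>t. r (?l t)) has_derivative (\<lambda>t. 0)) (at 0)"
  proof (rule has_derivative_transform_within_open[OF has_derivative_const op])
    show "0 = r (?l t)" if "t \<in> ?l -` S" for t
      using 0[of "?l t"] that V by (simp add: subspace_add subspace_scale)
  qed (use S in simp)
  from fun_cong[OF has_derivative_unique[OF 1 this], of 1] show ?thesis by simp
qed

text \<open>The easy half of the Frobenius theorem; by torsion freeness the difference is the Lie
  bracket. The fields need not be coordinate fields of the integral manifold, so each is compared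
  with a coordinate field that agrees with it at \<open>p\<close>; the mixed derivatives of
  coordinate fields commute.\<close>

lemma integrable_distribution_bracket:
  assumes R: "riemannian_manifold M" and D: "distribution M D" and int: "integrable_distribution M D"
    and U: "open U" "p \<in> U" and X: "smooth_field_on M U X" "\<And>q. q \<in> U \<Longrightarrow> X q \<in> D q"
    and Y: "smooth_field_on M U Y" "\<And>q. q \<in> U \<Longrightarrow> Y q \<in> D q"
  shows "cov_deriv M p (X p) Y - cov_deriv M p (Y p) X \<in> D p"
proof -
  note M = riemannian_manifoldD(1)[OF R]
  note subD = distribution_subspace[OF D]
  interpret h: inner_form "met M q" for q by (rule inner_form_met[OF R])
  have "\<exists>W V \<psi>. open W \<and> subspace V \<and> smooth_param M W \<psi> \<and> inj_on \<psi> (W \<inter> V) \<and> p \<in> \<psi> ` (W \<inter> V) \<and>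
       (\<forall>x\<in>W \<inter> V. inj_on (param_differential M \<psi> x) V \<and> param_differential M \<psi> x ` V = D (\<psi> x))"
    using int unfolding integrable_distribution_def by (rule spec)
  then obtain W V \<psi> where W: "open W" and V: "subspace V" and \<psi>: "smooth_param M W \<psi>" and p\<psi>: "p \<in> \<psi> ` (W \<inter> V)"
    and im0: "\<forall>x\<in>W \<inter> V. inj_on (param_differential M \<psi> x) V \<and> param_differential M \<psi> x ` V = D (\<psi> x)"
    by (elim exE conjE) (rule that)
  obtain x where x: "x \<in> W" "x \<in> V" "\<psi> x = p" using p\<psi> by auto
  have im: "param_differential M \<psi> y ` V = D (\<psi> y)" if "y \<in> W" "y \<in> V" for y
    using im0 that by blast
  obtain e where "orthonormal_frame_near M D p e" using orthonormal_frame_distribution[OF R D] by blast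
  from orthonormal_frame_nearD[OF this R] obtain U' where U': "open U'" "p \<in> U'"
    and e: "\<And>i. i < dim (D p) \<Longrightarrow> smooth_field_on M U' (e i)"
    and sp: "\<And>q. q \<in> U' \<Longrightarrow> span ((\<lambda>i. e i q) ` {..<dim (D p)}) = D q"
    and on: "\<And>q. q \<in> U' \<Longrightarrow> h.orthonormal q {..<dim (D p)} (\<lambda>i. e i q)" by metis
  define k where "k = dim (D p)"
  note e = e[folded k_def] and sp = sp[folded k_def] and on = on[folded k_def]
  define c where "c = chart_at M p"
  note c = chart_at_mem[OF M, of p, folded c_def]
  define \<phi> where "\<phi> = cmap c \<circ> \<psi>"
  have open_pre: "open (W \<inter> \<psi> -` A)" if "open A" for A
    using \<psi> that W continuous_on_open_vimage[OF W, of \<psi>] by (auto simp: smooth_param_def Int_commute)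
  define A where "A = cdom c \<inter> (U \<inter> U')"
  have A: "open A" "p \<in> A" using chart_props(1)[OF M c(1)] U U' c(2) by (auto simp: A_def)
  define S where "S = W \<inter> \<psi> -` A"
  have S: "open S" "x \<in> S" using open_pre[OF A(1)] A(2) x by (auto simp: S_def)
  have \<phi>: "smooth_on S \<phi>"
    using \<psi> c(1) unfolding smooth_param_def \<phi>_def S_def A_def by (blast intro: smooth_on_subset)
  have S_mem: "y \<in> W" "\<psi> y \<in> cdom c" "\<psi> y \<in> U" "\<psi> y \<in> U'" "\<phi> y = cmap c (\<psi> y)" "cinv c (\<phi> y) = \<psi> y" if "y \<in> S" for y
    using that cinv_cmap[OF M c(1)] by (auto simp: S_def A_def \<phi>_def)
  have d\<phi>: "frechet_derivative \<phi> (at y) v = to_chart M c (\<psi> y) (param_differential M \<psi> y v)" if y: "y \<in> S" for y v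
  proof -
    let ?d = "chart_at M (\<psi> y)"
    note d = chart_at_mem[OF M, of "\<psi> y"]
    let ?T = "W \<inter> \<psi> -` (cdom c \<inter> cdom ?d)"
    have op: "open (W \<inter> \<psi> -` cdom ?d)" "open ?T"
      by (rule open_pre, rule chart_props(1)[OF M d(1)],
          rule open_pre, intro open_Int chart_props(1)[OF M] c(1) d(1))
    have "smooth_on (W \<inter> \<psi> -` cdom ?d) (cmap ?d \<circ> \<psi>)" using \<psi> d(1) by (auto simp: smooth_param_def)
    from smooth_on_has_derivative[OF this op(1), of y]
    have "((cmap ?d \<circ> \<psi>) has_derivative param_differential M \<psi> y) (at y)"
      using S_mem(1)[OF y] d(2) by (simp add: param_differential_def[abs_def])
    from chart_change_derivative[OF M c(1) op(2) _ _ this]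
    have "(\<phi> has_derivative (\<lambda>v. to_chart M c (\<psi> y) (param_differential M \<psi> y v))) (at y)"
      using S_mem(1,2)[OF y] d(2) by (auto simp: \<phi>_def)
    from frechet_derivative_at[OF this] show ?thesis by metis
  qed
  have d\<phi>x: "frechet_derivative \<phi> (at x) v = param_differential M \<psi> x v" for v
    using d\<phi>[OF S(2)] by (simp add: x(3) c_def to_chart_chart_at[OF M])
  define H where "H = (\<lambda>b a. frechet_derivative (\<lambda>y. frechet_derivative \<phi> (at y) b) (at x) a)"
  have \<phi>x: "\<phi> x = cmap c p" by (simp add: \<phi>_def x)
  have metp: "met_in_chart M c (cmap c p) v w = met M p v w" for v w
    using met_eq_in_chart[OF M c, of v w] by (simp add: c_def to_chart_chart_at[OF M])
  text \<open>Compare the section \<open>Z\<close> with the derivative of the parametrization in direction \<open>b\<close>: along the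
    integral manifold their difference \<open>z\<close> is a section of \<open>D\<close>, and it vanishes at \<open>p\<close>.\<close>
  have claim: "frechet_derivative (field_in_chart M c Z) (at (cmap c p)) (frechet_derivative \<phi> (at x) a) - H b a \<in> D p"
    if Z: "smooth_field_on M U Z" "\<And>q. q \<in> U \<Longrightarrow> Z q \<in> D q" and ab: "a \<in> V" "b \<in> V" and b: "Z p = frechet_derivative \<phi> (at x) b"
    for Z a b
  proof -
    let ?Z = "field_in_chart M c Z" and ?E = "\<lambda>i. field_in_chart M c (e i)"
    define z where "z = (\<lambda>y. ?Z (\<phi> y) - frechet_derivative \<phi> (at y) b)"
    define z' where "z' = (\<lambda>v. frechet_derivative ?Z (at (cmap c p)) (frechet_derivative \<phi> (at x) v) - H b v)"
    have dp: "(\<phi> has_derivative frechet_derivative \<phi> (at x)) (at x)" by (rule smooth_on_has_derivative[OF \<phi> S])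
    have dX: "((\<lambda>y. field_in_chart M c X (\<phi> y)) has_derivative
        (\<lambda>v. frechet_derivative (field_in_chart M c X) (at (cmap c p)) (frechet_derivative \<phi> (at x) v))) (at x)"
      if "open B" "p \<in> B" "smooth_field_on M B X" for X B
    proof -
      have "(field_in_chart M c X has_derivative frechet_derivative (field_in_chart M c X) (at (cmap c p))) (at (\<phi> x))"
        unfolding \<phi>x c_def by (rule field_in_chart_has_derivative[OF M that])
      from diff_chain_at[OF dp this] show ?thesis by (simp add: o_def)
    qed
    have dz: "(z has_derivative z') (at x)"
      unfolding z_def z'_def H_def
      by (intro has_derivative_diff dX[OF U Z(1)] smooth_on_has_derivative[OF smooth_on_frechet[OF \<phi>] S])
    have Xx: "field_in_chart M c X (\<phi> x) = X p" for X unfolding \<phi>x c_def by (rule field_in_chart_at[OF M])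
    have zx: "z x = 0" unfolding z_def Xx by (simp add: b)
    define co where "co = (\<lambda>i y. met_in_chart M c (\<phi> y) (z y) (?E i (\<phi> y)))"
    have img: "\<phi> y \<in> cmap c ` cdom c" if "y \<in> S" for y using S_mem(2,5)[OF that] by simp
    \<comment> \<open>Since \<open>z x = 0\<close>, the connection terms and the derivative of
      \<open>e i\<close> contribute nothing.\<close>
    have co: "(co i has_derivative (\<lambda>v. met M p (z' v) (e i p))) (at x)" if i: "i < k" for i
    proof -
      note * = has_derivative_met_in_chart[OF R c(1) S img dp dz dX[OF U' e[OF i]]]
      have "levi_civita_form M c (\<phi> x) v 0 = 0" for v
        by (rule bilinear_rzero[OF levi_civita_form(1)[OF R c(1) img[OF S(2)]]])
      then show ?thesis
        using *[unfolded zx Xx] unfolding co_def by (simp add: \<phi>x metp h.form_simps)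
    qed
    have cox: "co i x = 0" for i unfolding co_def \<phi>x metp zx by (simp add: h.form_simps)
    \<comment> \<open>\<open>z\<close> minus its component in \<open>D\<close>. It vanishes along
      \<open>V\<close>, so its derivative in direction \<open>a\<close> is zero; as the coefficients
      vanish at \<open>x\<close>, this says that \<open>z' a\<close> equals its own expansion in the
      frame and hence lies in \<open>D p\<close>.\<close>
    define r where "r = (\<lambda>y. z y - (\<Sum>i<k. co i y *\<^sub>R ?E i (\<phi> y)))"
    have "(r has_derivative (\<lambda>v. z' v - (\<Sum>i<k. co i x *\<^sub>R frechet_derivative (?E i) (at (cmap c p)) (frechet_derivative \<phi> (at x) v)
        + met M p (z' v) (e i p) *\<^sub>R ?E i (\<phi> x)))) (at x)"
      unfolding r_def
      by (intro has_derivative_diff dz has_derivative_sum has_derivative_scaleR co dX[OF U' e]) auto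
    then have dr: "(r has_derivative (\<lambda>v. z' v - (\<Sum>i<k. met M p (z' v) (e i p) *\<^sub>R e i p))) (at x)"
      by (simp add: cox Xx)
    have "r y = 0" if y: "y \<in> S" "y \<in> V" for y
    proof -
      note m = S_mem[OF y(1)]
      let ?v = "Z (\<psi> y) - param_differential M \<psi> y b"
      have "param_differential M \<psi> y b \<in> D (\<psi> y)" using im[OF m(1) y(2)] ab(2) by blast
      then have "?v \<in> D (\<psi> y)" using Z(2)[OF m(3)] by (rule subspace_diff[OF subD, rotated])
      then have "?v = (\<Sum>i<k. met M (\<psi> y) ?v (e i (\<psi> y)) *\<^sub>R e i (\<psi> y))"
        by (intro h.orthonormal_expand on m(4)) (simp_all add: sp[OF m(4)])
      then have "to_chart M c (\<psi> y) ?v = to_chart M c (\<psi> y) (\<Sum>i<k. met M (\<psi> y) ?v (e i (\<psi> y)) *\<^sub>R e i (\<psi> y))"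
        by (rule arg_cong)
      also have "\<dots> = (\<Sum>i<k. met M (\<psi> y) ?v (e i (\<psi> y)) *\<^sub>R ?E i (\<phi> y))"
        using linear_to_chart[OF M c(1) m(2)] by (simp add: linear_sum linear_scale field_in_chart_def m(6))
      finally have 1: "to_chart M c (\<psi> y) ?v = (\<Sum>i<k. met M (\<psi> y) ?v (e i (\<psi> y)) *\<^sub>R ?E i (\<phi> y))" .
      have 2: "z y = to_chart M c (\<psi> y) ?v"
        unfolding z_def d\<phi>[OF y(1)] field_in_chart_def m(6) by (rule linear_diff[OF linear_to_chart[OF M c(1) m(2)], symmetric])
      have "co i y = met M (\<psi> y) ?v (e i (\<psi> y))" for i
        unfolding co_def 2 met_eq_in_chart[OF M c(1) m(2)]
        by (simp add: field_in_chart_def m(5) cinv_cmap[OF M c(1) m(2)])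
      then have "(\<Sum>i<k. co i y *\<^sub>R ?E i (\<phi> y)) = z y" by (simp only: 1[symmetric] 2)
      then show ?thesis by (simp add: r_def)
    qed
    from has_derivative_vanishes_along_subspace[OF dr S V x(2) ab(1) this]
    have "z' a = (\<Sum>i<k. met M p (z' a) (e i p) *\<^sub>R e i p)" by simp
    also have "\<dots> \<in> span ((\<lambda>i. e i p) ` {..<k})" by (intro span_sum span_scale span_base) auto
    finally show ?thesis using sp[OF U'(2)] by (simp add: z'_def)
  qed
  \<comment> \<open>The values of both fields at \<open>p\<close> are realised by directions in
    \<open>V\<close>. In the difference of the two instances of \<open>claim\<close> the mixed
    second derivatives cancel by symmetry, and the connection terms cancel by torsion
    freeness.\<close>
  obtain a b where ab: "a \<in> V" "b \<in> V" "frechet_derivative \<phi> (at x) a = X p" "frechet_derivative \<phi> (at x) b = Y p"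
    using im[OF x(1,2)] X(2)[OF U(2)] Y(2)[OF U(2)] unfolding x(3) d\<phi>x by (metis imageE)
  have "(frechet_derivative (field_in_chart M c Y) (at (cmap c p)) (X p) - H b a)
      - (frechet_derivative (field_in_chart M c X) (at (cmap c p)) (Y p) - H a b) \<in> D p"
    using subspace_diff[OF subD claim[OF Y ab(1,2) ab(4)[symmetric]] claim[OF X ab(2,1) ab(3)[symmetric]]]
    unfolding ab(3,4) .
  moreover have "H a b = H b a" unfolding H_def by (rule second_derivative_symmetric[OF S \<phi>])
  moreover have "levi_civita_form M c (cmap c p) (X p) (Y p) = levi_civita_form M c (cmap c p) (Y p) (X p)"
    by (rule levi_civita_form(2)[OF R c(1) imageI[OF c(2)]])
  ultimately show ?thesis by (simp add: cov_deriv_def Let_def c_def[symmetric])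
qed


section \<open>Traces of the second fundamental form\<close>

text \<open>For a section \<open>X\<close> of \<open>D\<close> through \<open>u\<close>, parallelism
  of \<open>J\<close> turns \<open>\<nabla>\<^sub>J\<^sub>X JX\<close> into
  \<open>J (\<nabla>\<^sub>J\<^sub>X X)\<close>, and the bracket lemma writes
  \<open>\<nabla>\<^sub>J\<^sub>X X\<close> as \<open>\<nabla>\<^sub>X JX + d\<close> with
  \<open>d\<close> in \<open>D\<close>. The result is \<open>- \<nabla>\<^sub>X X + J d\<close>, and
  \<open>F\<^sub>*\<close> annihilates \<open>J d\<close> because \<open>D\<close> is invariant
  under \<open>J\<close>.\<close>

lemma kaehler_sff_tensor_cancel:
  assumes K: "kaehler_manifold M J" and F: "riemannian_map M N F"
    and D: "distribution M D" "integrable_distribution M D" and ker: "\<And>q. D q \<subseteq> ker_diff M N F q"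
    and JD: "\<And>q. J q ` D q = D q" and u: "u \<in> D p"
  shows "sff_tensor M N F p (J p u) (J p u) = - sff_tensor M N F p u u"
proof -
  note RM = riemannian_mapD(1)[OF F] and RN = riemannian_mapD(2)[OF F] and sF = riemannian_mapD(3)[OF F]
  note subD = distribution_subspace[OF D(1)]
  have aH: "almost_hermitian M J" using K by (simp add: kaehler_manifold_def)
  then have J: "linear (J q)" "J q (J q v) = - v" for q v by (auto simp: almost_hermitian_def)
  obtain V P where P: "smooth_projection_near M D p V P"
    using smooth_projection_from_orthonormal_frame[OF RM] orthonormal_frame_distribution[OF RM D(1)] by blast
  obtain U X where U: "open U" "p \<in> U" and X: "smooth_field_on M U X" "\<And>q. q \<in> U \<Longrightarrow> X q \<in> D q" and Xp: "X p = u"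
    by (rule section_through[OF RM P subD u]) (rule that)
  let ?JX = "\<lambda>q. J q (X q)"
  have JX: "smooth_field_on M U ?JX" by (rule smooth_field_on_J[OF aH U(1) X(1)])
  have JXD: "J q (X q) \<in> D q" if "q \<in> U" for q using X(2)[OF that] JD by blast
  have nablaJ: "cov_deriv M p v ?JX = J p (cov_deriv M p v X)" for v
    using K U X(1) unfolding kaehler_manifold_def by blast
  define d where "d = cov_deriv M p (J p u) X - cov_deriv M p u ?JX"
  have "d \<in> D p"
    using integrable_distribution_bracket[OF RM D U JX JXD X] by (simp add: d_def Xp)
  then have "J p d \<in> D p" using JD by blast
  then have Jd: "differential M N F p (J p d) = 0" using ker by (auto simp: ker_diff_def)
  have "cov_deriv M p (J p u) ?JX = J p (cov_deriv M p u ?JX + d)"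
    by (simp add: nablaJ[of "J p u"] d_def)
  also have "\<dots> = J p d - cov_deriv M p u X"
    by (simp add: linear_add[OF J(1)] nablaJ J(2))
  finally have *: "differential M N F p (cov_deriv M p (J p u) ?JX) = - differential M N F p (cov_deriv M p u X)"
    using Jd by (simp add: linear_diff[OF riemannian_mapD(4)[OF F]])
  have "sff_tensor M N F p (J p u) (J p u) = - differential M N F p (cov_deriv M p (J p u) ?JX)"
    using sff_tensor_kernel_section[OF RM RN sF U JX subsetD[OF ker JXD], of "J p u"] by (simp add: Xp)
  moreover have "sff_tensor M N F p u u = - differential M N F p (cov_deriv M p u X)"
    using sff_tensor_kernel_section[OF RM RN sF U X(1) subsetD[OF ker X(2)], of u] by (simp add: Xp)
  ultimately show ?thesis using * by simp
qed

lemma kaehler_trace_vanishes: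
  assumes K: "kaehler_manifold M J" and F: "riemannian_map M N F"
    and D: "distribution M D" "integrable_distribution M D" and ker: "\<And>q. D q \<subseteq> ker_diff M N F q"
    and JD: "\<And>q. J q ` D q = D q"
    and a: "inner_form.orthonormal (met M p) I a" "finite I" "span (a ` I) = D p"
  shows "(\<Sum>i\<in>I. sff_tensor M N F p (a i) (a i)) = 0"
proof -
  note RM = riemannian_mapD(1)[OF F] and RN = riemannian_mapD(2)[OF F] and sF = riemannian_mapD(3)[OF F]
  interpret h: inner_form "met M p" by (rule inner_form_met[OF RM])
  have aD: "a i \<in> D p" if "i \<in> I" for i using that a(3) by (metis imageI span_base)
  have met_J: "met M p (J p v) (J p w) = met M p v w" for v w
    using K by (auto simp: kaehler_manifold_def almost_hermitian_def)
  have Ja: "h.orthonormal I (\<lambda>i. J p (a i))"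
    using a(1) by (simp add: h.orthonormal_def met_J)
  have "span ((\<lambda>i. J p (a i)) ` I) = D p"
  proof (rule h.orthonormal_span_eq[OF Ja a(2) _ distribution_subspace[OF D(1)]])
    show "(\<lambda>i. J p (a i)) ` I \<subseteq> D p" using aD JD by blast
    show "dim (D p) = card I" using h.orthonormal_dim_span[OF a(1,2)] a(3) by simp
  qed
  then have "(\<Sum>i\<in>I. sff_tensor M N F p (a i) (a i)) = (\<Sum>i\<in>I. sff_tensor M N F p (J p (a i)) (J p (a i)))"
    using a by (intro h.trace_independent[OF bilinear_sff_tensor[OF RM RN sF] a(1,2) Ja a(2)]) simp
  also have "\<dots> = - (\<Sum>i\<in>I. sff_tensor M N F p (a i) (a i))"
    by (simp add: kaehler_sff_tensor_cancel[OF K F D ker JD aD] sum_negf[symmetric] cong: sum.cong)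
  finally show ?thesis by (simp add: eq_neg_iff_add_eq_0 scaleR_2[symmetric])
qed

text \<open>Evaluates the \<open>SOME\<close> in \<open>trace_sff\<close>, which is meaningful only
  once a frame exists. After that an orthonormal basis at \<open>p\<close>, over any finite index
  set, may replace the frame.\<close>

lemma trace_sff_eq:
  assumes RM: "riemannian_manifold M" and RN: "riemannian_manifold N" and F: "smooth_map M N F"
    and ex: "\<exists>e. orthonormal_frame_near M E p e"
    and f: "inner_form.orthonormal (met M p) I f" "finite I" "span (f ` I) = E p"
  shows "trace_sff M N F E p = (\<Sum>i\<in>I. sff_tensor M N F p (f i) (f i))"
proof -
  interpret h: inner_form "met M p" by (rule inner_form_met[OF RM])
  define e where "e = (SOME e. orthonormal_frame_near M E p e)"
  have "orthonormal_frame_near M E p e" unfolding e_def using ex by (rule someI_ex)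
  from orthonormal_frame_nearD[OF this RM] obtain U where U: "open U" "p \<in> U"
    and e: "\<And>i. i < dim (E p) \<Longrightarrow> smooth_field_on M U (e i)"
    and sp: "span ((\<lambda>i. e i p) ` {..<dim (E p)}) = E p"
    and on: "h.orthonormal {..<dim (E p)} (\<lambda>i. e i p)" by metis
  have "trace_sff M N F E p = (\<Sum>i<dim (E p). sff_tensor M N F p (e i p) (e i p))"
    unfolding trace_sff_def e_def[symmetric] Let_def
    by (intro sum.cong refl second_fund_form_eq_sff_tensor[OF RM RN F U e]) simp
  also have "\<dots> = (\<Sum>i\<in>I. sff_tensor M N F p (f i) (f i))"
    by (rule h.trace_independent[OF bilinear_sff_tensor[OF RM RN F] on _ f(1,2)]) (simp_all add: sp f(3))
  finally show ?thesis .
qed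

text \<open>The remainder of a projection onto the complement lies in the double complement, which
  is the range itself; uniqueness of the decomposition then determines the \<open>THE\<close> in
  \<open>orth_proj\<close>.\<close>

lemma range_perp_proj_eq:
  assumes F: "riemannian_map M N F" and a: "a \<in> orth_compl N (F p) (range_diff M N F p)" and b: "b \<in> range_diff M N F p"
  shows "range_perp_proj M N F p (a + b) = a"
proof -
  note RN = riemannian_mapD(2)[OF F]
  have sub: "subspace (range_diff M N F p)"
    unfolding range_diff_def using linear_subspace_image[OF riemannian_mapD(4)[OF F] subspace_UNIV] .
  let ?A = "orth_compl N (F p) (range_diff M N F p)"
  have cc: "orth_compl N (F p) ?A = range_diff M N F p" by (rule orth_compl_orth_compl[OF RN sub])
  show ?thesis
    unfolding range_perp_proj_def orth_proj_def cc
  proof (rule the_equality)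
    show "a \<in> ?A \<and> a + b - a \<in> range_diff M N F p" using a b by simp
  next
    fix w assume w: "w \<in> ?A \<and> a + b - w \<in> range_diff M N F p"
    then have 1: "w - a \<in> ?A" using subspace_diff[OF subspace_orth_compl[OF RN]] a by blast
    have "b - (a + b - w) \<in> range_diff M N F p" using w subspace_diff[OF sub b] by blast
    then have "w - a \<in> range_diff M N F p" by (simp add: algebra_simps)
    then have "w - a = 0" using 1 by (rule orth_compl_Int[OF RN])
    then show "w = a" by simp
  qed
qed

text \<open>The pullback derivative of \<open>F\<^sub>* Z\<close> along \<open>Z\<close> is the
  tensor at \<open>Z\<close> plus a vector in the range. The projection removes the latter and fixes
  the former, whose values on horizontal vectors are orthogonal to the range.\<close>

lemma mean_curvature_range_eq:
  assumes F: "riemannian_map M N F" and ex: "\<exists>Z. orthonormal_frame_near M (horizontal M N F) p Z"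
    and f: "inner_form.orthonormal (met M p) I f" "finite I" "span (f ` I) = horizontal M N F p"
  shows "mean_curvature_range M N F p
    = (1 / real (dim (horizontal M N F p))) *\<^sub>R (\<Sum>i\<in>I. sff_tensor M N F p (f i) (f i))"
proof -
  note RM = riemannian_mapD(1)[OF F] and RN = riemannian_mapD(2)[OF F] and sF = riemannian_mapD(3)[OF F]
  interpret h: inner_form "met M p" by (rule inner_form_met[OF RM])
  let ?k = "dim (horizontal M N F p)"
  define e where "e = (SOME Z. orthonormal_frame_near M (horizontal M N F) p Z)"
  have "orthonormal_frame_near M (horizontal M N F) p e" unfolding e_def using ex by (rule someI_ex)
  from orthonormal_frame_nearD[OF this RM] obtain U where U: "open U" "p \<in> U"
    and e: "\<And>i. i < ?k \<Longrightarrow> smooth_field_on M U (e i)"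
    and sp: "span ((\<lambda>i. e i p) ` {..<?k}) = horizontal M N F p"
    and on: "h.orthonormal {..<?k} (\<lambda>i. e i p)" by metis
  have eH: "e i p \<in> horizontal M N F p" if "i < ?k" for i
  proof -
    have "e i p \<in> span ((\<lambda>i. e i p) ` {..<?k})" using that by (intro span_base) auto
    then show ?thesis by (simp only: sp)
  qed
  have "range_perp_proj M N F p (pullback_cov_deriv M N F p (e i p) (\<lambda>q. differential M N F q (e i q)))
      = sff_tensor M N F p (e i p) (e i p)" if i: "i < ?k" for i
    unfolding pullback_cov_deriv_differential[OF RM RN sF U e[OF i]]
    by (rule range_perp_proj_eq[OF F sff_tensor_horizontal_perp_range[OF F eH[OF i] eH[OF i]]]) (simp add: range_diff_def)
  then have "mean_curvature_range M N F p = (1 / real ?k) *\<^sub>R (\<Sum>i<?k. sff_tensor M N F p (e i p) (e i p))"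
    unfolding mean_curvature_range_def e_def[symmetric] Let_def by simp
  also have "(\<Sum>i<?k. sff_tensor M N F p (e i p) (e i p)) = (\<Sum>i\<in>I. sff_tensor M N F p (f i) (f i))"
    by (rule h.trace_independent[OF bilinear_sff_tensor[OF RM RN sF] on _ f(1,2)]) (simp_all add: sp f(3))
  finally show ?thesis .
qed

theorem theorem3p9:
  fixes M :: "('a::{t2_space, second_countable_topology}, 'm::euclidean_space) mfd"
    and N :: "('b::{t2_space, second_countable_topology}, 'n::euclidean_space) mfd"
    and J :: "'a \<Rightarrow> 'm \<Rightarrow> 'm"
    and F :: "'a \<Rightarrow> 'b"
    and D1 D2 :: "'a \<Rightarrow> 'm set"
    and \<theta> :: real
  assumes "kaehler_manifold M J"
    and "riemannian_manifold N"
    and "semi_slant_riemannian_map M J N F D1 D2 \<theta>"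
    and "integrable_distribution M D1"
  shows "harmonic_map M N F \<longleftrightarrow>
    (\<forall>p. trace_sff M N F D2 p = 0) \<and> (\<forall>p. mean_curvature_range M N F p = 0)"
proof -
  have F: "riemannian_map M N F" and D1: "distribution M D1" and ker: "\<And>q. D1 q \<subseteq> ker_diff M N F q"
    and D2: "\<And>q. D2 q = ker_diff M N F q \<inter> orth_compl M q (D1 q)" and JD: "\<And>q. J q ` D1 q = D1 q"
    using assms(3) by (auto simp: semi_slant_riemannian_map_def)
  note RM = riemannian_mapD(1)[OF F] and RN = riemannian_mapD(2)[OF F] and sF = riemannian_mapD(3)[OF F]
  interpret h: inner_form "met M q" for q by (rule inner_form_met[OF RM])
  let ?H = "horizontal M N F" and ?B = "sff_tensor M N F"
  note sub1 = distribution_subspace[OF D1] and sub2 = subspace_complement_in_kernel[OF F D1 ker D2]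
    and subH = subspace_horizontal[OF F]
  note frames = kernel_frames_exist[OF F D1 ker D2]
  have "trace_sff M N F (\<lambda>q. UNIV) p = 0 \<longleftrightarrow> trace_sff M N F D2 p = 0 \<and> mean_curvature_range M N F p = 0" for p
  proof -
    obtain a where a: "h.orthonormal p {..<dim (D1 p)} a" "a ` {..<dim (D1 p)} \<subseteq> D1 p" "span (a ` {..<dim (D1 p)}) = D1 p"
      using h.orthonormal_basis_exists[OF sub1] .
    obtain z where z: "h.orthonormal p {..<dim (?H p)} z" "z ` {..<dim (?H p)} \<subseteq> ?H p" "span (z ` {..<dim (?H p)}) = ?H p"
      using h.orthonormal_basis_exists[OF subH] .
    \<comment> \<open>On \<open>D2\<close> a smooth frame is taken, because placing the trace in the
      range requires sections of the kernel; for \<open>D1\<close> and the horizontal space a basis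
      at \<open>p\<close> is enough here.\<close>
    obtain b where "orthonormal_frame_near M D2 p b" using frames(1) by blast
    from orthonormal_frame_nearD[OF this RM] obtain U where U: "open U" "p \<in> U"
      and sb: "\<And>i. i < dim (D2 p) \<Longrightarrow> smooth_field_on M U (b i)"
      and spb: "\<And>q. q \<in> U \<Longrightarrow> span ((\<lambda>i. b i q) ` {..<dim (D2 p)}) = D2 q"
      and onb: "h.orthonormal p {..<dim (D2 p)} (\<lambda>i. b i p)" by metis
    have bD2: "b i q \<in> D2 q" if "q \<in> U" "i < dim (D2 p)" for q i
      unfolding spb[OF that(1), symmetric] using that(2) by (intro span_base) auto
    \<comment> \<open>The three bases are joined over a disjoint sum of index sets, with no
      renumbering. The ranks add up to the dimension of the model space, so the orthonormal family
      is a basis.\<close>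
    define f where "f = case_sum a (case_sum (\<lambda>i. b i p) z)"
    let ?I = "{..<dim (D1 p)} <+> ({..<dim (D2 p)} <+> {..<dim (?H p)})"
    have orth: "met M p v w = 0" "met M p w v = 0"
      if "v \<in> D1 p \<and> w \<in> D2 p \<or> v \<in> D1 p \<and> w \<in> ?H p \<or> v \<in> D2 p \<and> w \<in> ?H p" for v w
      using that ker[of p] h.sym[of p v w] by (auto simp: D2 horizontal_def orth_compl_def)
    have f: "h.orthonormal p ?I f"
      unfolding h.orthonormal_def
    proof (intro ballI)
      fix i j assume "i \<in> ?I" "j \<in> ?I"
      then show "met M p (f i) (f j) = (if i = j then 1 else 0)"
        using subsetD[OF a(2) imageI] subsetD[OF z(2) imageI] bD2[OF U(2)]
        by (elim PlusE) (auto simp: f_def orth a(1)[unfolded h.orthonormal_def, rule_format]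
            z(1)[unfolded h.orthonormal_def, rule_format] onb[unfolded h.orthonormal_def, rule_format])
    qed
    have "span (f ` ?I) = UNIV"
      by (rule h.orthonormal_span_eq[OF f])
        (use dim_tangent_decomposition[OF F D1 ker D2, of p] in \<open>simp_all add: card_Plus\<close>)
    then have "trace_sff M N F (\<lambda>q. UNIV) p = (\<Sum>i\<in>?I. ?B p (f i) (f i))"
      by (intro trace_sff_eq[OF RM RN sF orthonormal_frame_UNIV[OF RM] f]) simp_all
    also have "\<dots> = (\<Sum>i<dim (D1 p). ?B p (a i) (a i))
        + ((\<Sum>i<dim (D2 p). ?B p (b i p) (b i p)) + (\<Sum>i<dim (?H p). ?B p (z i) (z i)))"
      by (simp add: sum.Plus f_def)
    also have "(\<Sum>i<dim (D1 p). ?B p (a i) (a i)) = 0"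
      by (rule kaehler_trace_vanishes[OF assms(1) F D1 assms(4) ker JD a(1) _ a(3)]) simp
    also have T2: "(\<Sum>i<dim (D2 p). ?B p (b i p) (b i p)) = trace_sff M N F D2 p"
      by (rule trace_sff_eq[OF RM RN sF frames(1) onb _ spb[OF U(2)], symmetric]) simp
    finally have tr: "trace_sff M N F (\<lambda>q. UNIV) p = trace_sff M N F D2 p + (\<Sum>i<dim (?H p). ?B p (z i) (z i))"
      by simp
    have subR: "subspace (range_diff M N F p)"
      unfolding range_diff_def using linear_subspace_image[OF riemannian_mapD(4)[OF F] subspace_UNIV] .
    have R2: "trace_sff M N F D2 p \<in> range_diff M N F p"
      unfolding T2[symmetric]
    proof (rule subspace_sum[OF subR])
      fix i assume "i \<in> {..<dim (D2 p)}"
      then have i: "i < dim (D2 p)" by simp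
      have "?B p (b i p) (b i p) = - differential M N F p (cov_deriv M p (b i p) (b i))"
        by (rule sff_tensor_kernel_section[OF RM RN sF U sb[OF i]]) (use bD2[OF _ i] D2 in blast)
      then show "?B p (b i p) (b i p) \<in> range_diff M N F p"
        by (simp add: range_diff_def linear_neg[OF riemannian_mapD(4)[OF F], symmetric])
    qed
    have RH: "(\<Sum>i<dim (?H p). ?B p (z i) (z i)) \<in> orth_compl N (F p) (range_diff M N F p)"
      using z(2) by (intro subspace_sum[OF subspace_orth_compl[OF RN]] sff_tensor_horizontal_perp_range[OF F]) auto
    \<comment> \<open>For \<open>l = 0\<close> the sum is empty and both sides hold; otherwise the
      factor \<open>1 / l\<close> is nonzero.\<close>
    have mc: "mean_curvature_range M N F p = 0 \<longleftrightarrow> (\<Sum>i<dim (?H p). ?B p (z i) (z i)) = 0"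
      unfolding mean_curvature_range_eq[OF F frames(2) z(1) finite_lessThan z(3)]
      by (cases "dim (?H p) = 0") (simp_all del: dim_eq_0)
    show ?thesis
    proof
      assume "trace_sff M N F (\<lambda>q. UNIV) p = 0"
      then have "(\<Sum>i<dim (?H p). ?B p (z i) (z i)) = - trace_sff M N F D2 p"
        using tr by (simp add: eq_neg_iff_add_eq_0 add.commute)
      then have "(\<Sum>i<dim (?H p). ?B p (z i) (z i)) \<in> range_diff M N F p"
        using subspace_neg[OF subR R2] by simp
      then have "(\<Sum>i<dim (?H p). ?B p (z i) (z i)) = 0" using RH by (rule orth_compl_Int[OF RN])
      then show "trace_sff M N F D2 p = 0 \<and> mean_curvature_range M N F p = 0"
        using tr mc \<open>trace_sff M N F (\<lambda>q. UNIV) p = 0\<close> by simp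
    qed (use tr mc in simp)
  qed
  then show ?thesis unfolding harmonic_map_def by blast
qed

end
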